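(* Let $\Gamma$ be a cyclic group of order $2$, let $(G,\psi)$ be a connected $\Gamma$-gain graph with $|V_0(G)|\le1$, let $\tau:\Gamma\to\mathcal{C}_2$ be a faithful representation (where $\mathcal{C}_2=\{\mathrm{id},C_2\}$, $C_2$ the rotation of $\mathbb{R}^2$ by $\pi$ about the origin), and let $p:V(G)\to\mathbb{R}^2$ be $\mathcal{C}_2$-generic. Then: (a) if $(G,\psi)$ is $(2,0,3,1)$-gain-tight, then the covering framework $(\tilde G,\tilde p)$ is fully-symmetrically isostatic (i.e. $\rho_0$-symmetrically isostatic); (b) if $(G,\psi)$ is $(2,2,3,2)$-gain-tight, then the covering framework $(\tilde G,\tilde p)$ is anti-symmetrically isostatic (i.e. $\rho_1$-symmetrically isostatic).
   Context: **Gain graphs.** A $\Gamma$-gain graph is a pair $(G,\psi)$ with $G$ a finite directed multigraph, $V(G)=V_0(G)\,\dot\cup\,\overline{V(G)}$ a partition into fixed and free vertices, no fixed vertex having a loop or being incident to parallel edges, and $\psi:E(G)\to\Gamma$ such that: $\psi(e)=\mathrm{id}$ if both ends of $e$ are fixed; parallel edges $e,f$ satisfy $\psi(e)\ne\psi(f)$ if they have the same direction and $\psi(e)\ne\psi(f)^{-1}$ if opposite; $\psi(e)\ne\mathrm{id}$ for a loop $e$. Its covering $\tilde G$ is the simple graph with vertices $v$ for $v\in V_0(G)$ and $gv$ ($g\in\Gamma$) for $v\in\overline{V(G)}$; an edge $(u,v)$ of $G$ gives the edge $\{u,v\}$ if both ends are fixed, the edges $\{u,gv\}$, $g\in\Gamma$,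 if $u$ is fixed and $v$ free (similarly with roles exchanged), and the edges $\{hu,h\psi(e)v\}$, $h\in\Gamma$, if both are free. $\Gamma$ acts on $\tilde G$. **Frameworks.** Given $p:V(G)\to\mathbb{R}^2$ (with the fixed vertex, if any, placed at the origin), the covering framework $(\tilde G,\tilde p)$ has $\tilde p(gv)=\tau(g)p(v)$; $\tilde p$ is required to be injective, and it is a standing assumption that the points of a framework affinely span $\mathbb{R}^2$. $\Gamma=\langle\gamma\rangle$. The rigidity map $R=R(\tilde G,\tilde p)$ sends $m:V(\tilde G)\to\mathbb{C}^2$ to $\{u,v\}\mapsto(\tilde p(u)-\tilde p(v))^T(m(u)-m(v))$ on $E(\tilde G)$; $m$ is an infinitesimal motion if $Rm=0$, trivial if $m(u)=M\tilde p(u)+t$ for a fixed skew-symmetric $M$ and vector $t$ (complex entries). $p$ is $\mathcal{C}_2$-generic if $\operatorname{rank}R(\tilde G,\tilde p)\ge\operatorname{rank}R(\tilde G,\tilde q)$ for all $\mathcal{C}_2$-symmetric realisations $(\tilde G,\tilde q)$, i.e. those with $\tilde q(gv)=\tau(g)\tilde q(v)$ for all $g,v$. **$\rho_j$-symmetrically isostatic.** For $j=0,1$ let $\rho_j(\gamma)=(-1)^j$, $V^j=\{m:V(\tilde G)\to\mathbb{C}^2\mid m(gv)=\overline{\rho_j(g)}\,\tau(g)m(v)\ \forall g,v\}$, $W^j=\{w:E(\tilde G)\to\mathbb{C}\mid w(ge)=\overline{\rho_j(g)}\,w(e)\ \forall g,e\}$. $R$ maps $V^j$ into $W^j$; the block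 $\tilde R_j(\tilde G,\tilde p)$ is a matrix of $R|_{V^j}:V^j\to W^j$ (rows correspond to a basis of $W^j$). A motion is $\rho_j$-symmetric if it lies in $V^j$. $(\tilde G,\tilde p)$ is $\rho_j$-symmetrically isostatic if all its $\rho_j$-symmetric infinitesimal motions are trivial and $\tilde R_j(\tilde G,\tilde p)$ has no non-trivial row dependence (equivalently $R|_{V^j}:V^j\to W^j$ is onto). **Sparsity.** For a subgraph $H$ of $G$, $V_0(H)=V(H)\cap V_0(G)$, $\overline{V(H)}=V(H)\cap\overline{V(G)}$. The gain of a walk is the product of $\psi(e)^{\pm1}$ along it (sign according to orientation). $H$ is balanced if, after deleting all fixed vertices and their incident edges, every cycle (including loops and 2-cycles of parallel edges) has gain $\mathrm{id}$. $(G,\psi)$ is $(2,m,3,l)$-gain-sparse if $|E(H)|\le2|V(H)|-3$ for every balanced subgraph $H$ with $E(H)\ne\emptyset$ and $|E(H)|\le2|\overline{V(H)}|+m|V_0(H)|-l$ for every subgraph $H$ with $E(H)\ne\emptyset$; it is $(2,m,3,l)$-gain-tight if moreover $|E(G)|=2|\overline{V(G)}|+m|V_0(G)|-l$. *)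

theory Defs
  imports
    "HOL-Analysis.Analysis"
    "HOL-Algebra.Algebra"
    "HOL-Library.Function_Algebras"
    "Graph_Theory.Digraph_Component"
begin

section \<open>Gain graphs\<close>

text \<open>
  \<open>V0\<close> is the set of fixed vertices; the free vertices are \<open>verts G - V0\<close>. Two distinct loops at
  the same vertex count both as equally and as oppositely directed.
\<close>

locale gain_graph = group \<Gamma> + fin_digraph G
  for \<Gamma> :: "('g, 'm) monoid_scheme" (structure) and G :: "('v, 'e) pre_digraph" +
  fixes V0 :: "'v set" and \<psi> :: "'e \<Rightarrow> 'g"
  assumes fixed_verts: "V0 \<subseteq> verts G"
    and gain_closed: "e \<in> arcs G \<Longrightarrow> \<psi> e \<in> carrier \<Gamma>"
    and fixed_no_loop: "\<lbrakk>e \<in> arcs G; tail G e = head G e\<rbrakk> \<Longrightarrow> tail G e \<notin> V0"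
    and fixed_no_parallel:
      "\<lbrakk>e \<in> arcs G; f \<in> arcs G; e \<noteq> f; {tail G e, head G e} = {tail G f, head G f}\<rbrakk>
        \<Longrightarrow> tail G e \<notin> V0 \<and> head G e \<notin> V0"
    and gain_fixed: "\<lbrakk>e \<in> arcs G; tail G e \<in> V0; head G e \<in> V0\<rbrakk> \<Longrightarrow> \<psi> e = \<one>"
    and gain_parallel:
      "\<lbrakk>e \<in> arcs G; f \<in> arcs G; e \<noteq> f; tail G e = tail G f; head G e = head G f\<rbrakk>
        \<Longrightarrow> \<psi> e \<noteq> \<psi> f"
    and gain_antiparallel:
      "\<lbrakk>e \<in> arcs G; f \<in> arcs G; e \<noteq> f; tail G e = head G f; head G e = tail G f\<rbrakk>
        \<Longrightarrow> \<psi> e \<noteq> inv (\<psi> f)"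
    and gain_loop: "\<lbrakk>e \<in> arcs G; tail G e = head G e\<rbrakk> \<Longrightarrow> \<psi> e \<noteq> \<one>"

text \<open>
  Walks and cycles of a gain graph ignore the orientation of the edges. They are the directed walks
  and cycles of the following digraph, where \<open>(e, True)\<close> is \<open>e\<close> traversed forwards and
  \<open>(e, False)\<close> is \<open>e\<close> traversed backwards.
\<close>

definition both_directions :: "('v, 'e) pre_digraph \<Rightarrow> ('v, 'e \<times> bool) pre_digraph" where
  "both_directions H =
    \<lparr>verts = verts H, arcs = arcs H \<times> UNIV,
     tail = (\<lambda>(e, fwd). if fwd then tail H e else head H e),
     head = (\<lambda>(e, fwd). if fwd then head H e else tail H e)\<rparr>"

primrec walk_gain :: "('g, 'm) monoid_scheme \<Rightarrow> ('e \<Rightarrow> 'g) \<Rightarrow> ('e \<times> bool) list \<Rightarrow> 'g" where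
  "walk_gain \<Gamma> \<psi> [] = \<one>\<^bsub>\<Gamma>\<^esub>"
| "walk_gain \<Gamma> \<psi> (a # w) =
    (if snd a then \<psi> (fst a) else inv\<^bsub>\<Gamma>\<^esub> (\<psi> (fst a))) \<otimes>\<^bsub>\<Gamma>\<^esub> walk_gain \<Gamma> \<psi> w"

text \<open>The edges of a cycle are distinct: going along an edge and straight back is not a cycle.\<close>

definition balanced ::
    "('g, 'm) monoid_scheme \<Rightarrow> 'v set \<Rightarrow> ('e \<Rightarrow> 'g) \<Rightarrow> ('v, 'e) pre_digraph \<Rightarrow> bool" where
  "balanced \<Gamma> V0 \<psi> H \<longleftrightarrow>
    (\<forall>c. pre_digraph.cycle (both_directions (H \<restriction> (verts H - V0))) c \<and> distinct (map fst c)
      \<longrightarrow> walk_gain \<Gamma> \<psi> c = \<one>\<^bsub>\<Gamma>\<^esub>)"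

text \<open>\<open>gain_sparse \<Gamma> G V0 \<psi> m l\<close> is $(2,m,3,l)$-gain-sparsity, and likewise for tightness.\<close>

definition gain_sparse ::
    "('g, 'm) monoid_scheme \<Rightarrow> ('v, 'e) pre_digraph \<Rightarrow> 'v set \<Rightarrow> ('e \<Rightarrow> 'g) \<Rightarrow> int \<Rightarrow> int \<Rightarrow> bool"
  where
  "gain_sparse \<Gamma> G V0 \<psi> m l \<longleftrightarrow>
    (\<forall>H. subgraph H G \<and> arcs H \<noteq> {} \<and> balanced \<Gamma> V0 \<psi> H \<longrightarrow>
      int (card (arcs H)) \<le> 2 * int (card (verts H)) - 3) \<and>
    (\<forall>H. subgraph H G \<and> arcs H \<noteq> {} \<longrightarrow>
      int (card (arcs H)) \<le> 2 * int (card (verts H - V0)) + m * int (card (verts H \<inter> V0)) - l)"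

definition gain_tight ::
    "('g, 'm) monoid_scheme \<Rightarrow> ('v, 'e) pre_digraph \<Rightarrow> 'v set \<Rightarrow> ('e \<Rightarrow> 'g) \<Rightarrow> int \<Rightarrow> int \<Rightarrow> bool"
  where
  "gain_tight \<Gamma> G V0 \<psi> m l \<longleftrightarrow> gain_sparse \<Gamma> G V0 \<psi> m l \<and>
    int (card (arcs G)) = 2 * int (card (verts G - V0)) + m * int (card (verts G \<inter> V0)) - l"


section \<open>The covering graph\<close>

datatype ('g, 'v) cover_vertex = Fixed 'v | Free 'g 'v

primrec act :: "('g, 'm) monoid_scheme \<Rightarrow> 'g \<Rightarrow> ('g, 'v) cover_vertex \<Rightarrow> ('g, 'v) cover_vertex"
  where
  "act \<Gamma> g (Fixed v) = Fixed v"
| "act \<Gamma> g (Free h v) = Free (g \<otimes>\<^bsub>\<Gamma>\<^esub> h) v"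

definition cover_verts ::
    "('g, 'm) monoid_scheme \<Rightarrow> ('v, 'e) pre_digraph \<Rightarrow> 'v set \<Rightarrow> ('g, 'v) cover_vertex set" where
  "cover_verts \<Gamma> G V0 = Fixed ` V0 \<union> {Free g v | g v. g \<in> carrier \<Gamma> \<and> v \<in> verts G - V0}"

text \<open>The vertex $gv$ of the covering, where $gv = v$ if $v$ is fixed.\<close>

definition lift_vertex :: "'v set \<Rightarrow> 'g \<Rightarrow> 'v \<Rightarrow> ('g, 'v) cover_vertex" where
  "lift_vertex V0 g v = (if v \<in> V0 then Fixed v else Free g v)"

text \<open>
  An edge $(u,v)$ yields the edges $\{hu, h\psi(e)v\}$. If $u$ is fixed and $v$ is free, these are
  the edges $\{u, gv\}$ with $g \in \Gamma$, since $h\psi(e)$ runs through $\Gamma$; if both are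
  fixed, they are all equal to $\{u, v\}$.
\<close>

definition cover_edges ::
    "('g, 'm) monoid_scheme \<Rightarrow> ('v, 'e) pre_digraph \<Rightarrow> 'v set \<Rightarrow> ('e \<Rightarrow> 'g)
      \<Rightarrow> ('g, 'v) cover_vertex set set" where
  "cover_edges \<Gamma> G V0 \<psi> =
    {{lift_vertex V0 h (tail G e), lift_vertex V0 (h \<otimes>\<^bsub>\<Gamma>\<^esub> \<psi> e) (head G e)} | h e.
      h \<in> carrier \<Gamma> \<and> e \<in> arcs G}"


section \<open>Rigidity\<close>

text \<open>
  A function on a set \<open>A\<close> is represented by the total function that vanishes outside \<open>A\<close>. The
  complex vector spaces of functions with values in \<open>\<complex>\<^sup>2\<close> and in \<open>\<complex>\<close> are instances of the
  library locale.
\<close>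

definition scale_vfun :: "complex \<Rightarrow> ('a \<Rightarrow> complex^2) \<Rightarrow> 'a \<Rightarrow> complex^2" where
  "scale_vfun c f = (\<lambda>x. c *s f x)"

definition scale_fun :: "complex \<Rightarrow> ('a \<Rightarrow> complex) \<Rightarrow> 'a \<Rightarrow> complex" where
  "scale_fun c f = (\<lambda>x. c * f x)"

global_interpretation vfun: vector_space scale_vfun
  by unfold_locales
    (auto simp: scale_vfun_def fun_eq_iff vector_add_ldistrib vector_sadd_rdistrib vector_smult_assoc)

global_interpretation cfun: vector_space scale_fun
  by unfold_locales (auto simp: scale_fun_def fun_eq_iff algebra_simps)

definition functions_on :: "'a set \<Rightarrow> ('a \<Rightarrow> 'b::zero) set" where
  "functions_on A = {f. \<forall>x. x \<notin> A \<longrightarrow> f x = 0}"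

definition complex_vec :: "real^2 \<Rightarrow> complex^2" where
  "complex_vec x = (\<chi> i. complex_of_real (x $ i))"

definition complex_mat :: "real^2^2 \<Rightarrow> complex^2^2" where
  "complex_mat A = (\<chi> i j. complex_of_real (A $ i $ j))"

text \<open>The expression $(p(u) - p(v))^T (m(u) - m(v))$.\<close>

definition edge_form :: "('a \<Rightarrow> real^2) \<Rightarrow> ('a \<Rightarrow> complex^2) \<Rightarrow> 'a \<Rightarrow> 'a \<Rightarrow> complex" where
  "edge_form p m u v = (\<Sum>i\<in>UNIV. complex_vec (p u - p v) $ i * (m u - m v) $ i)"

text \<open>
  Edges are two-element sets. The value below is well defined since \<open>edge_form\<close> is symmetric in
  \<open>u\<close> and \<open>v\<close>.
\<close>

definition rigidity_map ::
    "'a set set \<Rightarrow> ('a \<Rightarrow> real^2) \<Rightarrow> ('a \<Rightarrow> complex^2) \<Rightarrow> 'a set \<Rightarrow> complex" where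
  "rigidity_map E p m =
    (\<lambda>e. if e \<in> E then THE z. \<exists>u v. e = {u, v} \<and> z = edge_form p m u v else 0)"

lemma edge_form_commute: "edge_form p m v u = edge_form p m u v"
  unfolding edge_form_def complex_vec_def by (intro sum.cong) (simp_all add: algebra_simps)

lemma rigidity_map_edge: "{u, v} \<in> E \<Longrightarrow> rigidity_map E p m {u, v} = edge_form p m u v"
  unfolding rigidity_map_def
  by (auto simp: doubleton_eq_iff edge_form_commute intro!: the_equality)

definition rigidity_rank :: "'a set \<Rightarrow> 'a set set \<Rightarrow> ('a \<Rightarrow> real^2) \<Rightarrow> nat" where
  "rigidity_rank V E p = cfun.dim (rigidity_map E p ` functions_on V)"

definition infinitesimal_motion ::
    "'a set \<Rightarrow> 'a set set \<Rightarrow> ('a \<Rightarrow> real^2) \<Rightarrow> ('a \<Rightarrow> complex^2) \<Rightarrow> bool" where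
  "infinitesimal_motion V E p m \<longleftrightarrow> m \<in> functions_on V \<and> rigidity_map E p m = 0"

definition trivial_motion :: "'a set \<Rightarrow> ('a \<Rightarrow> real^2) \<Rightarrow> ('a \<Rightarrow> complex^2) \<Rightarrow> bool" where
  "trivial_motion V p m \<longleftrightarrow>
    (\<exists>(M :: complex^2^2) t. transpose M = - M \<and> (\<forall>u\<in>V. m u = M *v complex_vec (p u) + t))"


section \<open>Half-turn symmetry\<close>

definition C2_rotation :: "real^2^2" where
  "C2_rotation = vector [vector [cos pi, - sin pi], vector [sin pi, cos pi]]"

definition C2_group :: "(real^2^2) monoid" where
  "C2_group = \<lparr>carrier = {mat 1, C2_rotation}, mult = (**), one = mat 1\<rparr>"

primrec cover_pos ::
    "('g \<Rightarrow> real^2^2) \<Rightarrow> ('v \<Rightarrow> real^2) \<Rightarrow> ('g, 'v) cover_vertex \<Rightarrow> real^2" where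
  "cover_pos \<tau> p (Fixed v) = p v"
| "cover_pos \<tau> p (Free g v) = \<tau> g *v p v"

definition covering_framework ::
    "('g, 'm) monoid_scheme \<Rightarrow> ('v, 'e) pre_digraph \<Rightarrow> 'v set \<Rightarrow> ('g \<Rightarrow> real^2^2)
      \<Rightarrow> ('v \<Rightarrow> real^2) \<Rightarrow> bool" where
  "covering_framework \<Gamma> G V0 \<tau> p \<longleftrightarrow>
    (\<forall>v\<in>V0. p v = 0) \<and>
    inj_on (cover_pos \<tau> p) (cover_verts \<Gamma> G V0) \<and>
    affine hull (cover_pos \<tau> p ` cover_verts \<Gamma> G V0) = UNIV"

definition symmetric_realisation ::
    "('g, 'm) monoid_scheme \<Rightarrow> ('v, 'e) pre_digraph \<Rightarrow> 'v set \<Rightarrow> ('g \<Rightarrow> real^2^2)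
      \<Rightarrow> (('g, 'v) cover_vertex \<Rightarrow> real^2) \<Rightarrow> bool" where
  "symmetric_realisation \<Gamma> G V0 \<tau> q \<longleftrightarrow>
    (\<forall>g\<in>carrier \<Gamma>. \<forall>u\<in>cover_verts \<Gamma> G V0. q (act \<Gamma> g u) = \<tau> g *v q u)"

definition C2_generic ::
    "('g, 'm) monoid_scheme \<Rightarrow> ('v, 'e) pre_digraph \<Rightarrow> 'v set \<Rightarrow> ('e \<Rightarrow> 'g) \<Rightarrow> ('g \<Rightarrow> real^2^2)
      \<Rightarrow> ('v \<Rightarrow> real^2) \<Rightarrow> bool" where
  "C2_generic \<Gamma> G V0 \<psi> \<tau> p \<longleftrightarrow>
    (\<forall>q. symmetric_realisation \<Gamma> G V0 \<tau> q \<longrightarrow>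
      rigidity_rank (cover_verts \<Gamma> G V0) (cover_edges \<Gamma> G V0 \<psi>) q
        \<le> rigidity_rank (cover_verts \<Gamma> G V0) (cover_edges \<Gamma> G V0 \<psi>) (cover_pos \<tau> p))"

text \<open>The character $\rho_j$ of the group $\{1, \gamma\}$ with $\rho_j(\gamma) = (-1)^j$.\<close>

definition rho :: "'g \<Rightarrow> nat \<Rightarrow> 'g \<Rightarrow> complex" where
  "rho \<gamma> j g = (if g = \<gamma> then (- 1) ^ j else 1)"

definition sym_motions ::
    "('g, 'm) monoid_scheme \<Rightarrow> ('v, 'e) pre_digraph \<Rightarrow> 'v set \<Rightarrow> ('g \<Rightarrow> real^2^2)
      \<Rightarrow> ('g \<Rightarrow> complex) \<Rightarrow> (('g, 'v) cover_vertex \<Rightarrow> complex^2) set" where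
  "sym_motions \<Gamma> G V0 \<tau> \<rho> =
    {m \<in> functions_on (cover_verts \<Gamma> G V0).
      \<forall>g\<in>carrier \<Gamma>. \<forall>u\<in>cover_verts \<Gamma> G V0.
        m (act \<Gamma> g u) = cnj (\<rho> g) *s (complex_mat (\<tau> g) *v m u)}"

definition sym_edge_functions ::
    "('g, 'm) monoid_scheme \<Rightarrow> ('v, 'e) pre_digraph \<Rightarrow> 'v set \<Rightarrow> ('e \<Rightarrow> 'g)
      \<Rightarrow> ('g \<Rightarrow> complex) \<Rightarrow> (('g, 'v) cover_vertex set \<Rightarrow> complex) set" where
  "sym_edge_functions \<Gamma> G V0 \<psi> \<rho> =
    {w \<in> functions_on (cover_edges \<Gamma> G V0 \<psi>).
      \<forall>g\<in>carrier \<Gamma>. \<forall>e\<in>cover_edges \<Gamma> G V0 \<psi>. w (act \<Gamma> g ` e) = cnj (\<rho> g) * w e}"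

definition motion_basis ::
    "('a \<Rightarrow> complex^2) set \<Rightarrow> ('a \<Rightarrow> complex^2) set \<Rightarrow> bool" where
  "motion_basis B V \<longleftrightarrow> finite B \<and> \<not> vfun.dependent B \<and> vfun.span B = V"

definition edge_function_basis :: "('a \<Rightarrow> complex) set \<Rightarrow> ('a \<Rightarrow> complex) set \<Rightarrow> bool" where
  "edge_function_basis C W \<longleftrightarrow> finite C \<and> \<not> cfun.dependent C \<and> cfun.span C = W"

lemma sum_fun_apply: "(\<Sum>a\<in>A. (f a :: 'b \<Rightarrow> 'c::comm_monoid_add)) x = (\<Sum>a\<in>A. f a x)"
  by (induction A rule: infinite_finite_induct) auto

lemma edge_function_basis_exists:
  assumes "finite A" "cfun.subspace W" "W \<subseteq> functions_on A"
  shows "\<exists>C. edge_function_basis C W"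
proof -
  define I where "I = (\<lambda>a x. if x = a then 1 else 0 :: complex) ` A"
  have "W \<subseteq> cfun.span I"
  proof
    fix f assume "f \<in> W"
    then have z: "x \<notin> A \<Longrightarrow> f x = 0" for x using assms(3) by (auto simp: functions_on_def)
    have "f = (\<Sum>a\<in>A. scale_fun (f a) (\<lambda>x. if x = a then 1 else 0))"
      using z assms(1) by (auto simp: fun_eq_iff sum_fun_apply scale_fun_def if_distrib cong: if_cong)
    also have "\<dots> \<in> cfun.span I"
      by (intro cfun.span_sum cfun.span_scale cfun.span_base) (auto simp: I_def)
    finally show "f \<in> cfun.span I" .
  qed
  moreover obtain C where "C \<subseteq> W" "\<not> cfun.dependent C" "W \<subseteq> cfun.span C"
    using cfun.maximal_independent_subset by blast
  moreover have "finite I" using assms(1) by (simp add: I_def)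
  ultimately have "finite C" "cfun.span C = W"
    using cfun.independent_span_bound[of I C] cfun.span_minimal[of C W] assms(2) by auto
  then show ?thesis using \<open>\<not> cfun.dependent C\<close> unfolding edge_function_basis_def by blast
qed

lemma motion_basis_exists:
  assumes "finite A" "vfun.subspace W" "W \<subseteq> functions_on A"
  shows "\<exists>C. motion_basis C W"
proof -
  define I where "I = (\<lambda>(a,i) x. if x = a then axis i 1 else 0 :: complex^2) ` (A \<times> UNIV)"
  have "W \<subseteq> vfun.span I"
  proof
    fix f assume "f \<in> W"
    then have z: "x \<notin> A \<Longrightarrow> f x = 0" for x using assms(3) by (auto simp: functions_on_def)
    have "f x = (\<Sum>a\<in>A. \<Sum>i\<in>UNIV. scale_vfun (f a $ i) (\<lambda>x. if x = a then axis i 1 else 0)) x" for x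
    proof (cases "x \<in> A")
      case True
      have "(\<Sum>a\<in>A. \<Sum>i\<in>UNIV. scale_vfun (f a $ i) (\<lambda>x. if x = a then axis i 1 else 0)) x
         = (\<Sum>a\<in>A. if a = x then (\<Sum>i\<in>UNIV. f a $ i *s axis i 1) else 0)"
        by (simp only: sum_fun_apply) (intro sum.cong, auto simp: scale_vfun_def)
      also have "\<dots> = f x" using True assms(1) by (simp add: basis_expansion)
      finally show ?thesis by simp
    next
      case False
      then show ?thesis using z[OF False] by (auto simp: sum_fun_apply scale_vfun_def intro!: sum.neutral)
    qed
    then have "f = (\<Sum>a\<in>A. \<Sum>i\<in>UNIV. scale_vfun (f a $ i) (\<lambda>x. if x = a then axis i 1 else 0))" by blast
    also have "\<dots> \<in> vfun.span I"
      by (intro vfun.span_sum vfun.span_scale vfun.span_base) (auto simp: I_def)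
    finally show "f \<in> vfun.span I" .
  qed
  moreover obtain C where "C \<subseteq> W" "\<not> vfun.dependent C" "W \<subseteq> vfun.span C"
    using vfun.maximal_independent_subset by blast
  moreover have "finite I" using assms(1) by (simp add: I_def)
  ultimately have "finite C" "vfun.span C = W"
    using vfun.independent_span_bound[of I C] vfun.span_minimal[of C W] assms(2) by auto
  then show ?thesis using \<open>\<not> vfun.dependent C\<close> unfolding motion_basis_def by blast
qed

text \<open>
  For a finite group and a finite gain graph, the two spaces of symmetric functions have finite
  bases, so the quantification over bases in \<open>sym_isostatic\<close> below is never vacuous.
\<close>

lemma symmetric_bases_exist:
  assumes "finite (carrier \<Gamma>)" "gain_graph \<Gamma> G V0 \<psi>"
  shows "\<exists>B. motion_basis B (sym_motions \<Gamma> G V0 \<tau> \<rho>)"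
    and "\<exists>C. edge_function_basis C (sym_edge_functions \<Gamma> G V0 \<psi> \<rho>)"
proof -
  interpret gain_graph \<Gamma> G V0 \<psi> by fact
  have "cover_verts \<Gamma> G V0 \<subseteq> Fixed ` V0 \<union> (\<lambda>(g, v). Free g v) ` (carrier \<Gamma> \<times> verts G)"
    by (auto simp: cover_verts_def)
  moreover have "finite V0" using fixed_verts finite_verts by (rule finite_subset)
  ultimately have V: "finite (cover_verts \<Gamma> G V0)"
    using assms(1) by (meson finite_SigmaI finite_UnI finite_imageI finite_subset finite_verts)
  have "cover_edges \<Gamma> G V0 \<psi> =
      (\<lambda>(h, e). {lift_vertex V0 h (tail G e), lift_vertex V0 (h \<otimes>\<^bsub>\<Gamma>\<^esub> \<psi> e) (head G e)}) `
        (carrier \<Gamma> \<times> arcs G)"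
    by (auto simp: cover_edges_def)
  then have E: "finite (cover_edges \<Gamma> G V0 \<psi>)" using assms(1) by simp
  have "vfun.subspace (sym_motions \<Gamma> G V0 \<tau> \<rho>)"
    unfolding vfun.subspace_def sym_motions_def functions_on_def
    by (auto simp: scale_vfun_def vec_eq_iff matrix_vector_mult_def sum_distrib_left sum.distrib
        algebra_simps)
  then show "\<exists>B. motion_basis B (sym_motions \<Gamma> G V0 \<tau> \<rho>)"
    by (intro motion_basis_exists[OF V]) (auto simp: sym_motions_def)
  have "cfun.subspace (sym_edge_functions \<Gamma> G V0 \<psi> \<rho>)"
    unfolding cfun.subspace_def sym_edge_functions_def functions_on_def
    by (auto simp: scale_fun_def algebra_simps)
  then show "\<exists>C. edge_function_basis C (sym_edge_functions \<Gamma> G V0 \<psi> \<rho>)"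
    by (intro edge_function_basis_exists[OF E]) (auto simp: sym_edge_functions_def)
qed

text \<open>
  Entry in row \<open>c\<close> and column \<open>b\<close> of the matrix of the rigidity map: the coefficient of \<open>c\<close> in the
  expansion, with respect to the basis \<open>C\<close> of the target, of the image of the basis vector \<open>b\<close>
  of the source.
\<close>

definition block_entry ::
    "'a set set \<Rightarrow> ('a \<Rightarrow> real^2) \<Rightarrow> ('a set \<Rightarrow> complex) set \<Rightarrow> ('a set \<Rightarrow> complex)
      \<Rightarrow> ('a \<Rightarrow> complex^2) \<Rightarrow> complex" where
  "block_entry E p C c b = cfun.representation C (rigidity_map E p b) c"

definition sym_isostatic ::
    "('g, 'm) monoid_scheme \<Rightarrow> ('v, 'e) pre_digraph \<Rightarrow> 'v set \<Rightarrow> ('e \<Rightarrow> 'g) \<Rightarrow> ('g \<Rightarrow> real^2^2)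
      \<Rightarrow> ('v \<Rightarrow> real^2) \<Rightarrow> ('g \<Rightarrow> complex) \<Rightarrow> bool" where
  "sym_isostatic \<Gamma> G V0 \<psi> \<tau> p \<rho> \<longleftrightarrow>
    (\<forall>m \<in> sym_motions \<Gamma> G V0 \<tau> \<rho>.
      infinitesimal_motion (cover_verts \<Gamma> G V0) (cover_edges \<Gamma> G V0 \<psi>) (cover_pos \<tau> p) m \<longrightarrow>
      trivial_motion (cover_verts \<Gamma> G V0) (cover_pos \<tau> p) m) \<and>
    (\<forall>B C. motion_basis B (sym_motions \<Gamma> G V0 \<tau> \<rho>) \<and>
        edge_function_basis C (sym_edge_functions \<Gamma> G V0 \<psi> \<rho>) \<longrightarrow>
      (\<forall>y. (\<forall>b\<in>B. (\<Sum>c\<in>C. y c * block_entry (cover_edges \<Gamma> G V0 \<psi>) (cover_pos \<tau> p) C c b) = 0)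
        \<longrightarrow> (\<forall>c\<in>C. y c = 0)))"

end

(*
  The half-turn acts as -1, so the symmetric (j = 0) and the antisymmetric (j = 1) motions of the
  covering are determined by vectors m(v) at the vertices of G, the fixed vertex being pinned at the
  origin, and an edge (u,v) of gain +-1 contributes the row (p(u) -+ p(v)) . (m(u) -+ m(v)) or
  (p(u) -+ p(v)) . (m(u) - m(v)), respectively.  Since generic positions maximise the rank of the
  whole rigidity map, which splits into the two blocks, both blocks have maximal rank at p: if one
  block is onto at q, then for all but finitely many r it is onto at q + r p, while the other block
  has at q + r p at least the rank it has at p.  So it suffices to find one position at which the
  rows are independent; counting dimensions, the kernel then consists of trivial motions.

  This is a Henneberg induction on the number of vertices.  A sparse graph has a vertex v of degree
  at most 3, and degree at most 2 is easy.  If v has degree 3 and E' is the graph without v, then v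
  can be placed whenever E' stays sparse after adding one of the edges between the neighbours of v.
  Sparse edge sets are the independent sets of a matroid, and if all these edges were in the closure
  of E', the third edge at v would be in the closure of E' and the other two, because the edges at v
  and between its neighbours form a dependent set.  In the antisymmetric case the induction needs
  one more kind of row, x . m(v) with x a free parameter: a vertex joined to the origin, to a and to
  -a reduces to such a row at a.
*)
theory Submission
  imports Defs "Jordan_Normal_Form.Char_Poly"
begin

section \<open>Square linear systems\<close>

text \<open>Wild rows come from a failure of the usual edge splitting. In the antisymmetric case
  \<open>p(a)\<close> and \<open>-p(a)\<close> have the same velocity, so an edge between them would
  have the zero row and cannot replace a vertex joined to \<open>p(a)\<close>, \<open>-p(a)\<close>
  and the origin. With that vertex at \<open>x\<close>, the mean of the two antipodal rows minus the
  row to the origin leaves \<open>x . m(a)\<close> up to sign, and \<open>x\<close> is not tied to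
  \<open>p(a)\<close>. The induction therefore runs over sets of constraints that are more general
  than gain graphs. The matroid replaces a search for the right edge to add: if all candidates are
  blocked, they lie in the closure of the remaining edges, and a count on at most four vertices, the
  ground included, refutes this. The delicate point of the matroid is that two balanced sets can
  have an unbalanced union, where submodularity of \<open>bound\<close> can fail. There a group of
  order two helps: two potentials that explain the same edge either agree or differ at all its free
  ends.\<close>

lemma reindex_square:
  assumes "bij_betw h {0..<n} I"
  shows "(\<Sum>j\<in>I. g j) = (\<Sum>j\<in>{0..<n}. g (h j))"
  using sum.reindex_bij_betw[OF assms, of g] by simp

lemma square_inj_imp_onto:
  fixes A :: "'i \<Rightarrow> 'j \<Rightarrow> 'k::field"
  assumes "finite I" "finite J" "card I = card J"
    and inj: "\<And>c j. \<lbrakk>\<And>i. i \<in> I \<Longrightarrow> (\<Sum>j\<in>J. A i j * c j) = 0; j \<in> J\<rbrakk> \<Longrightarrow> c j = 0"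
  shows "\<exists>c. \<forall>i\<in>I. (\<Sum>j\<in>J. A i j * c j) = w i"
proof -
  define n where "n = card I"
  obtain h where h: "bij_betw h {0..<n} I" using ex_bij_betw_nat_finite[OF assms(1)] n_def by blast
  obtain g where g: "bij_betw g {0..<n} J" using ex_bij_betw_nat_finite[OF assms(2)] n_def assms(3) by metis
  define M where "M = mat n n (\<lambda>(i,j). A (h i) (g j))"
  define c where "c v j = vec_index v (inv_into {0..<n} g j)" for v :: "'k Matrix.vec" and j
  have M: "M \<in> carrier_mat n n" by (simp add: M_def)
  have c: "c v (g j) = v $ j" if "j < n" for v j using g that by (simp add: c_def bij_betw_def)
  have Mc: "(M *\<^sub>v v) $ i = (\<Sum>j\<in>J. A (h i) j * c v j)" if "i < n" "v \<in> carrier_vec n" for v i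
    using that by (auto simp: M_def scalar_prod_def reindex_square[OF g] c intro!: sum.cong)
  have hI: "\<exists>l<n. i = h l" if "i \<in> I" for i using h that by (auto simp: bij_betw_def)
  have "det M \<noteq> 0"
  proof
    assume "det M = 0"
    then obtain v where v: "v \<in> carrier_vec n" "v \<noteq> 0\<^sub>v n" "M *\<^sub>v v = 0\<^sub>v n"
      using det_0_iff_vec_prod_zero_field[OF M] by auto
    have "(\<Sum>j\<in>J. A i j * c v j) = 0" if i: "i \<in> I" for i
    proof -
      obtain l where "l < n" "i = h l" using hI[OF i] by blast
      then show ?thesis using Mc[of l v] v by simp
    qed
    then have "c v (g j) = 0" if "j < n" for j
      using inj[of "c v" "g j"] g that by (auto simp: bij_betw_def)
    then have "v = 0\<^sub>v n" using v(1) c by (intro eq_vecI) auto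
    then show False using v(2) by blast
  qed
  then obtain B where B: "B \<in> carrier_mat n n" "M * B = 1\<^sub>m n"
    using det_non_zero_imp_unit[OF M] M unfolding Units_def by (auto simp: ring_mat_simps)
  define u where "u = B *\<^sub>v vec n (\<lambda>i. w (h i))"
  have u: "u \<in> carrier_vec n" using B by (simp add: u_def)
  have Mu: "M *\<^sub>v u = vec n (\<lambda>i. w (h i))" using B M by (simp add: u_def flip: assoc_mult_mat_vec)
  have "(\<Sum>j\<in>J. A i j * c u j) = w i" if i: "i \<in> I" for i
  proof -
    obtain l where "l < n" "i = h l" using hI[OF i] by blast
    then show ?thesis using Mc[of l u] u Mu by simp
  qed
  then show ?thesis by blast
qed

text \<open>If \<open>A + t\<close> is not onto, it has a kernel vector, which is an eigenvector of
  \<open>A\<close> for \<open>-t\<close>. Every rank estimate at a perturbed position is brought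
  into this form.\<close>

lemma finite_not_solvable:
  fixes A :: "'i \<Rightarrow> 'i \<Rightarrow> 'k::field"
  assumes "finite I"
  shows "finite {t. \<not> (\<forall>w. \<exists>c. \<forall>i\<in>I. (\<Sum>j\<in>I. A i j * c j) + t * c i = w i)}"
proof -
  define n where "n = card I"
  obtain h where h: "bij_betw h {0..<n} I" using ex_bij_betw_nat_finite[OF assms] n_def by blast
  define M where "M = mat n n (\<lambda>(i,j). A (h i) (h j))"
  have M: "M \<in> carrier_mat n n" by (simp add: M_def)
  have "{t. \<not> (\<forall>w. \<exists>c. \<forall>i\<in>I. (\<Sum>j\<in>I. A i j * c j) + t * c i = w i)}
      \<subseteq> uminus ` {x. poly (char_poly M) x = 0}"
  proof
    fix t assume "t \<in> {t. \<not> (\<forall>w. \<exists>c. \<forall>i\<in>I. (\<Sum>j\<in>I. A i j * c j) + t * c i = w i)}"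
    then obtain w where no: "\<nexists>c. \<forall>i\<in>I. (\<Sum>j\<in>I. A i j * c j) + t * c i = w i" by blast
    define A' where "A' i j = A i j + (if i = j then t else 0)" for i j
    have A': "(\<Sum>j\<in>I. A' i j * c j) = (\<Sum>j\<in>I. A i j * c j) + t * c i" if "i \<in> I" for i c
    proof -
      have "(\<Sum>j\<in>I. A' i j * c j) = (\<Sum>j\<in>I. A i j * c j + (if i = j then t * c j else 0))"
        by (intro sum.cong) (auto simp: A'_def distrib_right)
      then show ?thesis using that assms by (simp add: sum.distrib)
    qed
    have "\<exists>c j. j \<in> I \<and> c j \<noteq> 0 \<and> (\<forall>i\<in>I. (\<Sum>j\<in>I. A' i j * c j) = 0)"
      using square_inj_imp_onto[OF assms assms refl, of A' w] no A' by metis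
    then obtain c j where c: "j \<in> I" "c j \<noteq> 0" "\<And>i. i \<in> I \<Longrightarrow> (\<Sum>j\<in>I. A i j * c j) + t * c i = 0"
      using A' by metis
    define v where "v = vec n (\<lambda>i. c (h i))"
    have hI: "h l \<in> I" if "l < n" for l using h that by (auto simp: bij_betw_def)
    have "M *\<^sub>v v = (- t) \<cdot>\<^sub>v v"
    proof (rule eq_vecI)
      fix i assume "i < dim_vec ((- t) \<cdot>\<^sub>v v)"
      then have i: "i < n" by (simp add: v_def)
      then have "(M *\<^sub>v v) $ i = (\<Sum>j\<in>I. A (h i) j * c j)"
        by (simp add: M_def v_def scalar_prod_def reindex_square[OF h])
      then show "(M *\<^sub>v v) $ i = ((- t) \<cdot>\<^sub>v v) $ i"
        using c(3)[OF hI[OF i]] i by (simp add: v_def eq_neg_iff_add_eq_0)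
    qed (simp add: M_def v_def)
    moreover have "v \<noteq> 0\<^sub>v n"
    proof
      assume v0: "v = 0\<^sub>v n"
      obtain l where "l < n" "j = h l" using h c(1) by (auto simp: bij_betw_def)
      then show False using arg_cong[OF v0, of "\<lambda>v. v $ l"] c(2) by (simp add: v_def)
    qed
    moreover have "v \<in> carrier_vec n" by (simp add: v_def)
    ultimately have "eigenvalue M (- t)" using M by (auto simp: eigenvalue_def eigenvector_def)
    then have "poly (char_poly M) (- t) = 0" using eigenvalue_root_char_poly[OF M] by blast
    then show "t \<in> uminus ` {x. poly (char_poly M) x = 0}" by force
  qed
  moreover have "char_poly M \<noteq> 0" using degree_monic_char_poly[OF M] by auto
  ultimately show ?thesis using poly_roots_finite finite_subset by blast
qed

text \<open>A right inverse \<open>d\<close> of \<open>A\<close> has trivial kernel, so it is onto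
  by \<open>square_inj_imp_onto\<close>; if \<open>c = d x\<close> and \<open>A c = 0\<close>, then
  \<open>x = A d x = 0\<close>.\<close>

lemma square_onto_imp_inj:
  fixes A :: "'i \<Rightarrow> 'j \<Rightarrow> 'k::field"
  assumes "finite I" "finite J" "card I = card J"
    and onto: "\<And>w. \<exists>c. \<forall>i\<in>I. (\<Sum>j\<in>J. A i j * c j) = w i"
    and zero: "\<And>i. i \<in> I \<Longrightarrow> (\<Sum>j\<in>J. A i j * c j) = 0" and "j \<in> J"
  shows "c j = 0"
proof -
  obtain d where d: "\<And>k i. i \<in> I \<Longrightarrow> (\<Sum>j\<in>J. A i j * d k j) = (if i = k then 1 else 0)"
    using onto[of "\<lambda>i. if i = _ then 1 else 0"] by metis
  have Ad: "(\<Sum>j\<in>J. A i j * (\<Sum>k\<in>I. d k j * x k)) = x i" if "i \<in> I" for x i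
  proof -
    have "(\<Sum>j\<in>J. A i j * (\<Sum>k\<in>I. d k j * x k)) = (\<Sum>k\<in>I. (\<Sum>j\<in>J. A i j * d k j) * x k)"
      unfolding sum_distrib_left sum_distrib_right mult.assoc by (rule sum.swap)
    also have "\<dots> = (\<Sum>k\<in>I. if i = k then x k else 0)" by (intro sum.cong) (auto simp: d that)
    finally show ?thesis using that assms(1) by simp
  qed
  have "\<exists>x. \<forall>j\<in>J. (\<Sum>k\<in>I. d k j * x k) = c j"
  proof (rule square_inj_imp_onto[OF assms(2,1) assms(3)[symmetric]])
    fix x i assume x: "\<And>j. j \<in> J \<Longrightarrow> (\<Sum>k\<in>I. d k j * x k) = 0" and "i \<in> I"
    then show "x i = 0" using Ad[of i x] by simp
  qed
  then obtain x where x: "\<And>j. j \<in> J \<Longrightarrow> (\<Sum>k\<in>I. d k j * x k) = c j" by metis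
  have "x i = 0" if "i \<in> I" for i using Ad[OF that, of x] zero[OF that] x by simp
  then show ?thesis using x[OF \<open>j \<in> J\<close>] by simp
qed

no_notation scalar_prod (infix "\<bullet>" 70) and vec_index (infixl "$" 100)
hide_const (open) Matrix.mat
lemmas cart_eq_iff = Finite_Cartesian_Product.vec_eq_iff

section \<open>The count matroid\<close>

text \<open>
  \<open>compat \<phi> e\<close> says that the potential \<open>\<phi>\<close> of the free vertices explains the gain of \<open>e\<close>. The only
  possible fixed vertex is \<open>None\<close>; potentials ignore it.
\<close>

locale gain_count =
  fixes ends :: "'e \<Rightarrow> 'v option set" and compat :: "('v \<Rightarrow> bool) \<Rightarrow> 'e \<Rightarrow> bool" and k :: int
  assumes finite_ends: "finite (ends e)"
    and ground_end: "None \<in> ends e \<Longrightarrow> k = 2"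
    and k_cases: "k = 1 \<or> k = 2"
    and free_end: "\<exists>v. Some v \<in> ends e"
    and compat_agree: "\<lbrakk>compat \<phi> e; compat \<phi>' e; Some u \<in> ends e; Some v \<in> ends e\<rbrakk>
      \<Longrightarrow> (\<phi> u = \<phi>' u) = (\<phi> v = \<phi>' v)"
    and compat_cong: "\<lbrakk>compat \<phi> e; \<And>v. Some v \<in> ends e \<Longrightarrow> \<phi> v = \<phi>' v\<rbrakk> \<Longrightarrow> compat \<phi>' e"
    and compat_flip: "compat \<phi> e \<Longrightarrow> compat (\<lambda>v. \<not> \<phi> v) e"
begin

definition span_verts :: "'e set \<Rightarrow> 'v option set" where
  "span_verts F = (\<Union>e\<in>F. ends e)"

definition potential_balanced :: "'e set \<Rightarrow> bool" where
  "potential_balanced F \<longleftrightarrow> (\<exists>\<phi>. \<forall>e\<in>F. compat \<phi> e)"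

definition bound :: "'e set \<Rightarrow> int" where
  "bound F = 2 * int (card (span_verts F)) - (if potential_balanced F then 3 else k)"

definition sparse :: "'e set \<Rightarrow> bool" where
  "sparse E \<longleftrightarrow> finite E \<and> (\<forall>F\<subseteq>E. F \<noteq> {} \<longrightarrow> int (card F) \<le> bound F)"

lemma finite_span_verts: "finite F \<Longrightarrow> finite (span_verts F)"
  by (simp add: span_verts_def finite_ends)

lemma span_verts_mono: "F \<subseteq> F' \<Longrightarrow> span_verts F \<subseteq> span_verts F'"
  by (auto simp: span_verts_def)

lemma span_verts_Un: "span_verts (F \<union> F') = span_verts F \<union> span_verts F'"
  by (auto simp: span_verts_def)

lemma potential_balanced_mono: "F \<subseteq> F' \<Longrightarrow> potential_balanced F' \<Longrightarrow> potential_balanced F"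
  by (auto simp: potential_balanced_def)

lemma bound_mono: "finite F' \<Longrightarrow> F \<subseteq> F' \<Longrightarrow> bound F \<le> bound F'"
  using card_mono[OF finite_span_verts span_verts_mono, of F' F] potential_balanced_mono[of F F'] k_cases
  by (auto simp: bound_def)

lemma sparse_subset: "sparse E \<Longrightarrow> F \<subseteq> E \<Longrightarrow> sparse F"
  by (auto simp: sparse_def finite_subset)

lemma sparse_finite: "sparse E \<Longrightarrow> finite E"
  by (simp add: sparse_def)

lemma sparse_bound: "sparse E \<Longrightarrow> E \<noteq> {} \<Longrightarrow> int (card E) \<le> bound E"
  by (auto simp: sparse_def)

lemma sparse_balanced_bound:
  assumes "sparse I" "I \<noteq> {}" "potential_balanced I" "span_verts I \<subseteq> U" "finite U"
  shows "int (card I) \<le> 2 * int (card U) - 3"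
proof -
  have "card (span_verts I) \<le> card U" using assms by (intro card_mono)
  then show ?thesis using sparse_bound[OF assms(1,2)] assms(3) by (simp add: bound_def)
qed

text \<open>The term \<open>card (U \<inter> Y)\<close> cannot simply be replaced by
  \<open>bound (U \<inter> Y)\<close>: if two balanced sets have an unbalanced union, that
  inequality can fail. In this case \<open>2 |N| - 6 + k\<close> common edges are allowed,
  \<open>N\<close> being the set of common vertices. The two potentials split the common edges into
  those on which they agree and those on which they disagree; both classes are balanced and share at
  most the ground.\<close>

lemma bound_submodular:
  assumes "finite U" "finite Y" "sparse (U \<inter> Y)" "U \<inter> Y \<noteq> {}"
  shows "int (card (U \<inter> Y)) + bound (U \<union> Y) \<le> bound U + bound Y"
proof -
  define N where "N = span_verts U \<inter> span_verts Y"
  have fN: "finite N" using assms by (simp add: N_def finite_span_verts)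
  have cN: "card (span_verts (U \<union> Y)) + card N = card (span_verts U) + card (span_verts Y)"
    using card_Un_Int[of "span_verts U" "span_verts Y"] assms
    by (simp add: N_def span_verts_Un finite_span_verts)
  have sN: "span_verts (U \<inter> Y) \<subseteq> N" by (auto simp: N_def span_verts_def)
  have cI: "card (span_verts (U \<inter> Y)) \<le> card N" using fN sN by (rule card_mono)
  have bI: "int (card (U \<inter> Y)) \<le> bound (U \<inter> Y)" using assms sparse_bound by blast
  have mX: "potential_balanced U \<Longrightarrow> potential_balanced (U \<inter> Y)" by (rule potential_balanced_mono) auto
  have mY: "potential_balanced Y \<Longrightarrow> potential_balanced (U \<inter> Y)" by (rule potential_balanced_mono) auto
  have mU: "potential_balanced (U \<union> Y) \<Longrightarrow> potential_balanced U \<and> potential_balanced Y"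
    using potential_balanced_mono by blast
  show ?thesis
  proof (cases "potential_balanced U \<and> potential_balanced Y \<and> \<not> potential_balanced (U \<union> Y)")
    case False
    then show ?thesis using cN cI bI mX mY mU k_cases by (auto simp: bound_def split: if_splits)
  next
    case True
    obtain e where e: "e \<in> U" "e \<in> Y" using assms by blast
    obtain v where v: "Some v \<in> ends e" using free_end by blast
    obtain \<phi> where phi: "\<And>f. f \<in> U \<Longrightarrow> compat \<phi> f" using True by (auto simp: potential_balanced_def)
    obtain \<phi>0 where phi0: "\<And>f. f \<in> Y \<Longrightarrow> compat \<phi>0 f" using True by (auto simp: potential_balanced_def)
    \<comment> \<open>Flipping the second potential if necessary makes both agree at an end of a
      common edge, so that \<open>IA\<close> below is nonempty and obeys the bound with 3.\<close>
    obtain \<phi>' where phi': "\<And>f. f \<in> Y \<Longrightarrow> compat \<phi>' f" and veq: "\<phi> v = \<phi>' v"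
    proof (cases "\<phi> v = \<phi>0 v")
      case True then show ?thesis using that phi0 by blast
    next
      case False then show ?thesis using that[of "\<lambda>v. \<not> \<phi>0 v"] phi0 compat_flip by blast
    qed
    define A where "A = {u. Some u \<in> N \<and> \<phi> u = \<phi>' u}"
    define D where "D = {u. Some u \<in> N \<and> \<phi> u \<noteq> \<phi>' u}"
    define g where "g = (if None \<in> N then {None} else {} :: 'v option set)"
    have Nsplit: "N = Some ` A \<union> Some ` D \<union> g"
      unfolding A_def D_def g_def using not_None_eq by (auto simp: image_iff) (metis option.exhaust)+
    have fA: "finite A" "finite D"
      using fN finite_vimageI[of N Some] by (auto simp: A_def D_def vimage_def intro: finite_subset[rotated])
    have "card N = card (Some ` A \<union> Some ` D) + card g"
      unfolding Nsplit by (rule card_Un_disjoint) (auto simp: fA g_def)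
    also have "card (Some ` A \<union> Some ` D) = card (Some ` A) + card (Some ` D)"
      by (rule card_Un_disjoint) (use fA in \<open>auto simp: A_def D_def\<close>)
    finally have cNs: "card N = card A + card D + card g" by (simp add: card_image)
    \<comment> \<open>If the potentials agreed on all common vertices, they would glue to a
      potential of the union.\<close>
    have "D \<noteq> {}"
    proof
      assume D0: "D = {}"
      let ?\<phi> = "\<lambda>u. if Some u \<in> span_verts U then \<phi> u else \<phi>' u"
      have "compat ?\<phi> f" if "f \<in> U" for f
        by (rule compat_cong[OF phi[OF that]]) (use that in \<open>auto simp: span_verts_def\<close>)
      moreover have "compat ?\<phi> f" if "f \<in> Y" for f
        by (rule compat_cong[OF phi'[OF that]]) (use that D0 in \<open>auto simp: D_def N_def span_verts_def\<close>)
      ultimately have "potential_balanced (U \<union> Y)" unfolding potential_balanced_def by blast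
      then show False using True by blast
    qed
    then have D1: "card D \<ge> 1" using fA by (simp add: Suc_leI card_gt_0_iff)
    define IA where "IA = {f \<in> U \<inter> Y. \<exists>u. Some u \<in> ends f \<and> \<phi> u = \<phi>' u}"
    define ID where "ID = {f \<in> U \<inter> Y. \<not> (\<exists>u. Some u \<in> ends f \<and> \<phi> u = \<phi>' u)}"
    have eIA: "e \<in> IA" using e v veq by (auto simp: IA_def)
    have vIA: "span_verts IA \<subseteq> Some ` A \<union> g"
    proof
      fix z assume "z \<in> span_verts IA"
      then obtain f u where f: "f \<in> U" "f \<in> Y" "z \<in> ends f" "Some u \<in> ends f" "\<phi> u = \<phi>' u"
        by (auto simp: span_verts_def IA_def)
      have zN: "z \<in> N" using f by (auto simp: N_def span_verts_def)
      show "z \<in> Some ` A \<union> g"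
      proof (cases z)
        case None then show ?thesis using zN by (simp add: g_def)
      next
        case (Some w)
        then show ?thesis using compat_agree[OF phi phi', of f u w] f zN by (auto simp: A_def)
      qed
    qed
    have vID: "span_verts ID \<subseteq> Some ` D \<union> g"
    proof
      fix z assume "z \<in> span_verts ID"
      then obtain f where f: "f \<in> U" "f \<in> Y" "z \<in> ends f" "\<not> (\<exists>u. Some u \<in> ends f \<and> \<phi> u = \<phi>' u)"
        by (auto simp: span_verts_def ID_def)
      have zN: "z \<in> N" using f by (auto simp: N_def span_verts_def)
      show "z \<in> Some ` D \<union> g"
        by (cases z) (use zN f in \<open>auto simp: g_def D_def\<close>)
    qed
    have fg: "finite (Some ` A \<union> g)" "finite (Some ` D \<union> g)" using fA by (auto simp: g_def)
    have cg: "card (Some ` A \<union> g) = card A + card g" "card (Some ` D \<union> g) = card D + card g"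
      using fA by (subst card_Un_disjoint; auto simp: g_def card_image)+
    have IAD: "U \<inter> Y = IA \<union> ID" "IA \<inter> ID = {}" by (auto simp: IA_def ID_def)
    have fI: "finite IA" "finite ID" using assms by (auto simp: IA_def ID_def)
    have cI': "card (U \<inter> Y) = card IA + card ID" using IAD fI by (simp add: card_Un_disjoint)
    have sI: "sparse IA" "sparse ID" using assms(3) sparse_subset IAD by auto
    have bal: "potential_balanced IA" "potential_balanced ID"
      using True IAD by (auto intro: potential_balanced_mono[of _ U])
    have a: "int (card IA) \<le> 2 * (int (card A) + int (card g)) - 3"
      using sparse_balanced_bound[OF sI(1) _ bal(1) vIA fg(1)] eIA cg by auto
    \<comment> \<open>If \<open>ID\<close> is empty, the vertices of \<open>D\<close> still count in
      \<open>N\<close>; the 2 gained from one of them makes up for the missing 3 because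
      \<open>k\<close> is at least 1.\<close>
    have d: "int (card ID) \<le> 2 * (int (card D) + int (card g)) - 3 \<or> card ID = 0"
      using sparse_balanced_bound[OF sI(2) _ bal(2) vID fg(2)] cg by (cases "ID = {}") auto
    \<comment> \<open>The ground belongs to both classes and is counted twice. The excess of 2 is
      exactly what \<open>k = 2\<close> pays for.\<close>
    have g1: "card g = 0 \<or> card g = 1 \<and> k = 2"
    proof (cases "None \<in> N")
      case True
      then have "k = 2" using ground_end by (auto simp: N_def span_verts_def)
      then show ?thesis by (simp add: g_def)
    qed (simp add: g_def)
    have "int (card (U \<inter> Y)) \<le> 2 * int (card N) - 6 + k"
    proof -
      have "int (card (U \<inter> Y)) = int (card IA) + int (card ID)"
        "int (card N) = int (card A) + int (card D) + int (card g)" "int (card D) \<ge> 1"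
        using cI' cNs D1 by simp_all
      moreover have "int (card g) = 0 \<or> int (card g) = 1 \<and> k = 2" using g1 by auto
      moreover have "int (card ID) = 0 \<or> int (card ID) \<le> 2 * (int (card D) + int (card g)) - 3"
        using d by auto
      ultimately show ?thesis using a k_cases by presburger
    qed
    then show ?thesis using True cN by (simp add: bound_def)
  qed
qed

section \<open>Circuits, exchange and closure\<close>

definition circuit :: "'e set \<Rightarrow> bool" where
  "circuit C \<longleftrightarrow> finite C \<and> \<not> sparse C \<and> (\<forall>e\<in>C. sparse (C - {e}))"

lemma circuit_card: assumes "circuit C" shows "bound C < int (card C)" "C \<noteq> {}"
proof -
  obtain F where F: "F \<subseteq> C" "F \<noteq> {}" "bound F < int (card F)"
    using assms by (auto simp: circuit_def sparse_def not_le)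
  have "F = C"
  proof (rule ccontr)
    assume "F \<noteq> C"
    then obtain e where "e \<in> C" "F \<subseteq> C - {e}" using F by blast
    then have "sparse (C - {e})" using assms by (simp add: circuit_def)
    then have "sparse F" using \<open>F \<subseteq> C - {e}\<close> sparse_subset by blast
    then show False using F sparse_bound by fastforce
  qed
  then show "bound C < int (card C)" "C \<noteq> {}" using F by auto
qed

lemma circuit_proper_subset: "circuit C \<Longrightarrow> F \<subset> C \<Longrightarrow> sparse F"
proof -
  assume C: "circuit C" and "F \<subset> C"
  then obtain e where "e \<in> C" "F \<subseteq> C - {e}" by blast
  then show "sparse F" using C sparse_subset[of "C - {e}" F] unfolding circuit_def by blast
qed

lemma circuit_not_subset: "circuit C \<Longrightarrow> sparse E \<Longrightarrow> \<not> C \<subseteq> E"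
  using sparse_subset unfolding circuit_def by blast

lemma circuit_exists:
  assumes "finite E" "\<not> sparse E" shows "\<exists>C\<subseteq>E. circuit C"
  using assms
proof (induction E rule: finite_psubset_induct)
  case (psubset E)
  show ?case
  proof (cases "\<forall>e\<in>E. sparse (E - {e})")
    case True then show ?thesis using psubset by (auto simp: circuit_def)
  next
    case False
    then obtain e where "e \<in> E" "\<not> sparse (E - {e})" by blast
    then show ?thesis using psubset.IH[of "E - {e}"] by blast
  qed
qed

text \<open>Each circuit exceeds its bound by at least 1. By submodularity the union exceeds its
  bound by at least 2, and removing \<open>e\<close> takes away only 1.\<close>

lemma circuit_elimination:
  assumes "circuit C" "circuit C'" "C \<noteq> C'" "e \<in> C" "e \<in> C'"
  shows "\<not> sparse (C \<union> C' - {e})"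
proof
  assume s: "sparse (C \<union> C' - {e})"
  have f: "finite C" "finite C'" using assms by (auto simp: circuit_def)
  have "\<not> C \<subseteq> C'" using assms circuit_proper_subset[of C' C] by (auto simp: circuit_def)
  then have ne: "C \<union> C' - {e} \<noteq> {}" using assms by blast
  have "C \<inter> C' \<subset> C" using \<open>\<not> C \<subseteq> C'\<close> by blast
  then have "sparse (C \<inter> C')" using circuit_proper_subset assms by blast
  then have "int (card (C \<inter> C')) + bound (C \<union> C') \<le> bound C + bound C'"
    using bound_submodular f assms by blast
  moreover have "card (C \<union> C') + card (C \<inter> C') = card C + card C'" using card_Un_Int f by metis
  moreover have "card (C \<union> C' - {e}) + 1 = card (C \<union> C')"
    using f assms card_Suc_Diff1[of "C \<union> C'" e] by simp
  moreover have "int (card (C \<union> C' - {e})) \<le> bound (C \<union> C' - {e})" using s ne sparse_bound by blast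
  moreover have "bound (C \<union> C' - {e}) \<le> bound (C \<union> C')" using f by (intro bound_mono) auto
  moreover have "bound C < int (card C)" "bound C' < int (card C')" using assms circuit_card by auto
  ultimately show False by linarith
qed

text \<open>By elimination the circuit that \<open>j\<close> closes with \<open>I\<close> is unique,
  so exchanging one of its elements outside \<open>J\<close> for \<open>j\<close> keeps
  \<open>I\<close> sparse. The new set has the same size, still spans \<open>J\<close> and contains
  more of it.\<close>

lemma sparse_card_le:
  assumes "sparse I" "sparse J" "\<And>j. j \<in> J - I \<Longrightarrow> \<not> sparse (insert j I)"
  shows "card J \<le> card I"
  using assms
proof (induction "card (J - I)" arbitrary: I rule: less_induct)
  case less
  have fI: "finite I" "finite J" using less sparse_finite by auto
  show ?case
  proof (cases "J \<subseteq> I")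
    case True then show ?thesis using fI card_mono by blast
  next
    case False
    then obtain j where j: "j \<in> J" "j \<notin> I" by blast
    then obtain C where C: "C \<subseteq> insert j I" "circuit C"
      using less.prems(3)[of j] circuit_exists[of "insert j I"] fI by auto
    have unique: "C' = C" if "C' \<subseteq> insert j I" "circuit C'" for C'
    proof (rule ccontr)
      assume "C' \<noteq> C"
      have "j \<in> C" "j \<in> C'"
        using C that circuit_not_subset[OF C(2) less.prems(1)] circuit_not_subset[OF that(2) less.prems(1)] by blast+
      then have "\<not> sparse (C \<union> C' - {j})" using circuit_elimination[OF C(2) that(2)] \<open>C' \<noteq> C\<close> by blast
      moreover have "C \<union> C' - {j} \<subseteq> I" using C that by blast
      ultimately show False using sparse_subset[OF less.prems(1)] by blast
    qed
    have "\<not> C \<subseteq> J" using circuit_not_subset[OF C(2) less.prems(2)] .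
    then obtain i where i: "i \<in> C" "i \<notin> J" by blast
    then have iI: "i \<in> I" using C j by blast
    define I' where "I' = insert j (I - {i})"
    have sI': "sparse I'"
    proof (rule ccontr)
      assume "\<not> sparse I'"
      then obtain C' where "C' \<subseteq> I'" "circuit C'" using circuit_exists[of I'] fI by (auto simp: I'_def)
      then have "C' = C" using unique by (auto simp: I'_def)
      then show False using \<open>C' \<subseteq> I'\<close> i j by (auto simp: I'_def)
    qed
    have "card I' = card I" using fI iI j card_Suc_Diff1[of I i] by (simp add: I'_def)
    have "J - I' \<subset> J - I" using i j by (auto simp: I'_def)
    then have lt: "card (J - I') < card (J - I)" using fI by (intro psubset_card_mono) auto
    have "card J \<le> card I'"
    proof (rule less.hyps[OF lt sI' less.prems(2)])
      fix j' assume j': "j' \<in> J - I'"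
      then have "j' \<in> J - I" "j' \<noteq> j" using i by (auto simp: I'_def)
      then obtain C' where C': "C' \<subseteq> insert j' I" "circuit C'"
        using less.prems(3)[of j'] circuit_exists[of "insert j' I"] fI by auto
      show "\<not> sparse (insert j' I')"
      proof (cases "i \<in> C'")
        case False
        then have "C' \<subseteq> insert j' I'" using C' by (auto simp: I'_def)
        then show ?thesis using circuit_not_subset[OF C'(2)] by blast
      next
        case True
        have "j \<in> C" using C circuit_not_subset[OF C(2) less.prems(1)] by blast
        then have "C \<noteq> C'" using C' \<open>j' \<noteq> j\<close> j by blast
        then have "\<not> sparse (C \<union> C' - {i})" using circuit_elimination[OF C(2) C'(2)] i True by blast
        moreover have "C \<union> C' - {i} \<subseteq> insert j' I'" using C C' by (auto simp: I'_def)
        ultimately show ?thesis using sparse_subset[of "insert j' I'"] by blast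
      qed
    qed
    then show ?thesis using \<open>card I' = card I\<close> by simp
  qed
qed

text \<open>Idempotence of the closure. A maximal sparse \<open>J\<close> between \<open>K\<close>
  and \<open>insert f (K \<union> I)\<close> avoids \<open>f\<close>; if \<open>insert f I\<close>
  were sparse, then \<open>|insert f I| <= |J| <= |I|\<close>.\<close>

lemma not_sparse_closure:
  assumes "sparse I" "sparse K" "\<And>e. e \<in> K \<Longrightarrow> e \<in> I \<or> \<not> sparse (insert e I)"
    and "\<not> sparse (insert f K)" "f \<notin> I"
  shows "\<not> sparse (insert f I)"
proof
  assume s: "sparse (insert f I)"
  have fin: "finite I" "finite K" using assms sparse_finite by auto
  define \<J> where "\<J> = {J. K \<subseteq> J \<and> J \<subseteq> insert f (K \<union> I) \<and> sparse J}"
  have "\<J> \<subseteq> Pow (insert f (K \<union> I))" by (auto simp: \<J>_def)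
  then have "finite \<J>" using fin finite_subset by blast
  moreover have "K \<in> \<J>" using assms(2) by (auto simp: \<J>_def)
  ultimately obtain J where J: "J \<in> \<J>" and max: "\<And>J'. J' \<in> \<J> \<Longrightarrow> J \<subseteq> J' \<Longrightarrow> J' = J"
    using finite_has_maximal2[of \<J> K] by (metis (no_types))
  have J': "K \<subseteq> J" "J \<subseteq> insert f (K \<union> I)" "sparse J" using J by (simp_all add: \<J>_def)
  have "f \<notin> J" using sparse_subset[OF J'(3), of "insert f K"] J'(1) assms(4) by blast
  have "card (insert f I) \<le> card J"
  proof (rule sparse_card_le)
    fix j assume j: "j \<in> insert f I - J"
    show "\<not> sparse (insert j J)"
    proof
      assume "sparse (insert j J)"
      then have "insert j J \<in> \<J>" using J'(1,2) j unfolding \<J>_def by blast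
      then show False using max[of "insert j J"] j by blast
    qed
  qed (fact J'(3), fact s)
  moreover have "card J \<le> card I"
  proof (rule sparse_card_le[OF assms(1) J'(3)])
    fix j assume "j \<in> J - I"
    then show "\<not> sparse (insert j I)" using assms(3)[of j] J'(2) \<open>f \<notin> J\<close> by blast
  qed
  ultimately show False using fin assms(5) by simp
qed

end

section \<open>Rows of the orbit rigidity matrix\<close>

text \<open>
  \<open>Link u v s\<close> is an edge between free vertices with gain \<open>\<plusminus>1\<close>, where \<open>s\<close> means \<open>+1\<close>; \<open>Spoke v\<close> is a
  loop at \<open>v\<close> or an edge from \<open>v\<close> to the fixed vertex; \<open>Wild v i\<close> is the auxiliary row whose
  direction is a parameter of its own. A configuration \<open>c\<close> places \<open>v\<close> at \<open>c v 0\<close> and gives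
  \<open>Wild v i\<close> the direction \<open>c v (Suc i)\<close>.
\<close>

datatype 'v constraint = Link 'v 'v bool | Spoke 'v | Wild 'v nat

text \<open>
  The other end of an edge at a given free vertex: \<open>To a s\<close> is the point \<open>p(a)\<close> or \<open>-p(a)\<close> of the
  covering framework.
\<close>

datatype 'v arm = To 'v bool | Centre | Free_dir nat

definition sg :: "bool \<Rightarrow> real" where "sg s = (if s then 1 else - 1)"

lemma sg_simps [simp]: "sg True = 1" "sg False = - 1" "sg s * sg s = 1" "sg s \<noteq> 0" "sg (\<not> s) = - sg s"
  by (auto simp: sg_def)

definition det2 :: "real^2 \<Rightarrow> real^2 \<Rightarrow> real" where
  "det2 x y = x $ 1 * y $ 2 - x $ 2 * y $ 1"

lemma det2_solve: assumes "det2 x y \<noteq> 0" shows "\<exists>z. x \<bullet> z = a \<and> y \<bullet> z = b"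
proof -
  define z :: "real^2" where
    "z = (1 / det2 x y) *\<^sub>R vector [a * y $ 2 - b * x $ 2, b * x $ 1 - a * y $ 1]"
  have "x \<bullet> z = a * det2 x y / det2 x y" "y \<bullet> z = b * det2 x y / det2 x y"
    by (simp_all add: z_def inner_vec_def sum_2 det2_def algebra_simps flip: add_divide_distrib)
  then show ?thesis using assms by auto
qed

lemma finite_det2_pencil:
  assumes "det2 x y \<noteq> 0"
  shows "finite {t. det2 (x + t *\<^sub>R x') (y + t *\<^sub>R y') = 0}"
proof -
  let ?p = "[:det2 x y, det2 x y' + det2 x' y, det2 x' y':]"
  have "det2 (x + t *\<^sub>R x') (y + t *\<^sub>R y') = poly ?p t" for t
    by (simp add: det2_def algebra_simps)
  moreover have "?p \<noteq> 0" using assms by simp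
  ultimately show ?thesis using poly_roots_finite[of ?p] by simp
qed

locale half_turn_rows =
  fixes parity :: nat
begin

definition anti :: bool where "anti \<longleftrightarrow> parity = 1"

text \<open>The sign of the velocity at the rotated copy: the point at \<open>-p(v)\<close> moves by
  \<open>-m(v)\<close> in the symmetric and by \<open>m(v)\<close> in the antisymmetric
  case.\<close>

definition chi :: "bool \<Rightarrow> real" where "chi s = (if anti then 1 else sg s)"

lemma chi_simps [simp]: "chi s * chi s = 1" "chi s \<noteq> 0"
  by (auto simp: chi_def)

primrec row :: "('v \<Rightarrow> nat \<Rightarrow> real^2) \<Rightarrow> ('v \<Rightarrow> real^2) \<Rightarrow> 'v constraint \<Rightarrow> real" where
  "row c m (Link u v s) = (c u 0 - sg s *\<^sub>R c v 0) \<bullet> (m u - chi s *\<^sub>R m v)"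
| "row c m (Spoke v) = c v 0 \<bullet> m v"
| "row c m (Wild v i) = c v (Suc i) \<bullet> m v"

text \<open>
  \<open>None\<close> is the fixed vertex. It is left out in the symmetric case, where it contributes nothing to
  the count \<open>2 |V| - 1\<close> of unbalanced subgraphs and spokes make a subgraph unbalanced.
\<close>

primrec ends :: "'v constraint \<Rightarrow> 'v option set" where
  "ends (Link u v s) = {Some u, Some v}"
| "ends (Spoke v) = insert (Some v) {x. anti \<and> x = None}"
| "ends (Wild v i) = insert (Some v) {x. anti \<and> x = None}"

text \<open>Balance ignores edges to the fixed vertex, hence \<open>anti\<close> for
  \<open>Spoke\<close>. Counting a spoke as unbalanced in the symmetric case loses nothing: for a
  set that meets the fixed vertex, \<open>2 (|V| - 1) - 1 = 2 |V| - 3\<close>. Wild rows are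
  unbalanced so that two of them at one vertex are sparse.\<close>

primrec compat :: "('v \<Rightarrow> bool) \<Rightarrow> 'v constraint \<Rightarrow> bool" where
  "compat \<phi> (Link u v s) = ((\<phi> u = \<phi> v) = s)"
| "compat \<phi> (Spoke v) = anti"
| "compat \<phi> (Wild v i) = False"

definition slack :: int where "slack = (if anti then 2 else 1)"

sublocale gain_count ends compat slack
proof
  fix e :: "'v constraint" and \<phi> \<phi>' :: "'v \<Rightarrow> bool" and u v
  show "finite (ends e)" "\<exists>v. Some v \<in> ends e" by (cases e; auto)+
  show "None \<in> ends e \<Longrightarrow> slack = 2" by (cases e) (auto simp: slack_def)
  show "compat \<phi> e \<Longrightarrow> compat \<phi>' e \<Longrightarrow> Some u \<in> ends e \<Longrightarrow> Some v \<in> ends e \<Longrightarrow> (\<phi> u = \<phi>' u) = (\<phi> v = \<phi>' v)"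
    by (cases e) auto
  show "compat \<phi> e \<Longrightarrow> (\<And>v. Some v \<in> ends e \<Longrightarrow> \<phi> v = \<phi>' v) \<Longrightarrow> compat \<phi>' e"
    by (cases e) auto
  show "compat \<phi> e \<Longrightarrow> compat (\<lambda>v. \<not> \<phi> v) e" by (cases e) auto
qed (auto simp: slack_def)

lemma row_add: "row c (\<lambda>v. m v + m' v) e = row c m e + row c m' e"
  by (cases e) (simp_all add: algebra_simps inner_simps)

lemma row_scale: "row c (\<lambda>v. a *\<^sub>R m v) e = a * row c m e"
  by (cases e) (simp_all add: algebra_simps inner_simps)

lemma row_zero: "row c (\<lambda>v. 0) e = 0"
  by (cases e) simp_all

lemma row_sum: "row c (\<lambda>v. \<Sum>f\<in>F. a f *\<^sub>R m f v) e = (\<Sum>f\<in>F. a f * row c (m f) e)"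
  by (induction F rule: infinite_finite_induct) (simp_all add: row_zero row_add row_scale)

lemma row_config: "row (\<lambda>v n. q v n + t *\<^sub>R c v n) m e = row q m e + t * row c m e"
  by (cases e) (simp_all add: algebra_simps inner_simps)

lemma row_cong: "\<lbrakk>\<And>u. Some u \<in> ends e \<Longrightarrow> m u = m' u\<rbrakk> \<Longrightarrow> row c m e = row c m' e"
  by (cases e) (auto split: if_splits)

lemma row_config_cong: "\<lbrakk>\<And>u. Some u \<in> ends e \<Longrightarrow> c u = c' u\<rbrakk> \<Longrightarrow> row c m e = row c' m e"
  by (cases e) (auto split: if_splits)

definition onto :: "('v \<Rightarrow> nat \<Rightarrow> real^2) \<Rightarrow> 'v constraint set \<Rightarrow> bool" where
  "onto c E \<longleftrightarrow> (\<forall>w. \<exists>m. \<forall>e\<in>E. row c m e = w e)"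

lemma onto_subset: "onto c E \<Longrightarrow> F \<subseteq> E \<Longrightarrow> onto c F"
  unfolding onto_def by (meson subsetD)

lemma onto_config_cong:
  assumes "onto c E" "\<And>e u. e \<in> E \<Longrightarrow> Some u \<in> ends e \<Longrightarrow> c u = c' u"
  shows "onto c' E"
  unfolding onto_def
proof
  fix w
  obtain m where m: "\<forall>e\<in>E. row c m e = w e" using assms(1) unfolding onto_def by blast
  have "row c' m e = row c m e" if "e \<in> E" for e
    by (rule row_config_cong) (simp add: assms(2)[OF that])
  then show "\<exists>m. \<forall>e\<in>E. row c' m e = w e" using m by metis
qed

text \<open>On combinations of a family \<open>\<mu>\<close> dual to the rows at \<open>c\<close>,
  the rows at \<open>q + t c\<close> have the matrix of the rows at \<open>q\<close> plus
  \<open>t\<close> times the identity.\<close>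

lemma finite_not_onto:
  assumes "finite E" "onto c E"
  shows "finite {t. \<not> onto (\<lambda>v n. q v n + t *\<^sub>R c v n) E}"
proof -
  obtain \<mu> where mu: "\<And>f e. e \<in> E \<Longrightarrow> row c (\<mu> f) e = (if e = f then 1 else 0)"
    using assms(2)[unfolded onto_def, rule_format, of "\<lambda>e. if e = _ then 1 else 0"] by metis
  have "onto (\<lambda>v n. q v n + t *\<^sub>R c v n) E"
    if sol: "\<forall>w. \<exists>a. \<forall>e\<in>E. (\<Sum>f\<in>E. row q (\<mu> f) e * a f) + t * a e = w e" for t
    unfolding onto_def
  proof
    fix w :: "'a constraint \<Rightarrow> real"
    obtain a where a: "\<And>e. e \<in> E \<Longrightarrow> (\<Sum>f\<in>E. row q (\<mu> f) e * a f) + t * a e = w e" using sol by metis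
    have "row (\<lambda>v n. q v n + t *\<^sub>R c v n) (\<lambda>v. \<Sum>f\<in>E. a f *\<^sub>R \<mu> f v) e = w e" if e: "e \<in> E" for e
    proof -
      have "(\<Sum>f\<in>E. a f * (row q (\<mu> f) e + t * row c (\<mu> f) e))
          = (\<Sum>f\<in>E. row q (\<mu> f) e * a f + (if e = f then t * a f else 0))"
        by (intro sum.cong) (auto simp: mu e algebra_simps)
      then show ?thesis using a[OF e] assms(1) e by (simp add: row_sum row_config sum.distrib)
    qed
    then show "\<exists>m. \<forall>e\<in>E. row (\<lambda>v n. q v n + t *\<^sub>R c v n) m e = w e" by blast
  qed
  then have "{t. \<not> onto (\<lambda>v n. q v n + t *\<^sub>R c v n) E}
    \<subseteq> {t. \<not> (\<forall>w. \<exists>a. \<forall>e\<in>E. (\<Sum>f\<in>E. row q (\<mu> f) e * a f) + t * a e = w e)}" by blast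
  then show ?thesis using finite_not_solvable[OF assms(1), of "\<lambda>e f. row q (\<mu> f) e"] finite_subset by blast
qed

text \<open>Combines two conditions with different witnesses, independent rows at \<open>c\<close>
  and two independent vectors at \<open>q\<close>: on the line \<open>q + t c\<close> each fails for
  finitely many \<open>t\<close> only.\<close>

lemma onto_generic:
  assumes "finite E" "onto c E" "det2 (f q) (g q) \<noteq> 0"
    and "\<And>t. f (\<lambda>v n. q v n + t *\<^sub>R c v n) = f q + t *\<^sub>R f c"
    and "\<And>t. g (\<lambda>v n. q v n + t *\<^sub>R c v n) = g q + t *\<^sub>R g c"
  shows "\<exists>c'. onto c' E \<and> det2 (f c') (g c') \<noteq> 0"
proof -
  have "finite ({t. \<not> onto (\<lambda>v n. q v n + t *\<^sub>R c v n) E} \<union> {t. det2 (f q + t *\<^sub>R f c) (g q + t *\<^sub>R g c) = 0})"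
    using finite_not_onto[OF assms(1,2)] finite_det2_pencil[OF assms(3)] by blast
  then obtain t where "t \<notin> {t. \<not> onto (\<lambda>v n. q v n + t *\<^sub>R c v n) E}
      \<union> {t. det2 (f q + t *\<^sub>R f c) (g q + t *\<^sub>R g c) = 0}"
    using ex_new_if_finite infinite_UNIV_char_0 by blast
  then show ?thesis using assms(4,5) by (intro exI[of _ "\<lambda>v n. q v n + t *\<^sub>R c v n"]) auto
qed

section \<open>Edges seen from one of their ends\<close>

primrec arm_of :: "'v \<Rightarrow> 'v arm \<Rightarrow> 'v constraint \<Rightarrow> bool" where
  "arm_of v (To a s) e = (a \<noteq> v \<and> (e = Link v a s \<or> e = Link a v s))"
| "arm_of v Centre e = (e = Spoke v)"
| "arm_of v (Free_dir i) e = (e = Wild v i)"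

primrec direction :: "('v \<Rightarrow> nat \<Rightarrow> real^2) \<Rightarrow> 'v \<Rightarrow> 'v arm \<Rightarrow> real^2" where
  "direction c v (To a s) = c v 0 - sg s *\<^sub>R c a 0"
| "direction c v Centre = c v 0"
| "direction c v (Free_dir i) = c v (Suc i)"

primrec offset :: "('v \<Rightarrow> real^2) \<Rightarrow> 'v arm \<Rightarrow> real^2" where
  "offset m (To a s) = chi s *\<^sub>R m a"
| "offset m Centre = 0"
| "offset m (Free_dir i) = 0"

lemma direction_config:
  "direction (\<lambda>v n. q v n + t *\<^sub>R c v n) v r = direction q v r + t *\<^sub>R direction c v r"
  by (cases r) (simp_all add: algebra_simps)

lemma offset_linear: "offset (\<lambda>v. m v + t *\<^sub>R m' v) r = offset m r + t *\<^sub>R offset m' r"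
  by (cases r) (simp_all add: algebra_simps)

lemma arm_of_unique: "arm_of v r e \<Longrightarrow> arm_of v r' e \<Longrightarrow> r = r'"
  by (cases r; cases r') auto

lemma arm_of_ends: "arm_of v r e \<Longrightarrow> Some v \<in> ends e"
  by (cases r) auto

lemma offset_update: "arm_of v r e \<Longrightarrow> offset (m(v := y)) r = offset m r"
  by (cases r) auto

lemma row_arm:
  assumes "arm_of v r e"
  obtains \<epsilon> where "\<epsilon> \<noteq> 0" "\<And>c m. row c m e = \<epsilon> * (direction c v r \<bullet> (m v - offset m r))"
proof (cases r)
  case (To a s)
  have "row c m (Link a v s) = sg s * chi s * (direction c v r \<bullet> (m v - offset m r))" for c m
    using To by (simp add: chi_def sg_def inner_diff_left inner_diff_right inner_commute algebra_simps)
  then show ?thesis using assms To that[of 1] that[of "sg s * chi s"] by auto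
qed (use assms that[of 1] in auto)

text \<open>The two new rows form a regular system for the velocity of \<open>v\<close>, whatever
  the velocities elsewhere.\<close>

lemma onto_insert2:
  assumes "onto c E" "\<And>e. e \<in> E \<Longrightarrow> Some v \<notin> ends e"
    and e: "arm_of v r1 e1" "arm_of v r2 e2" and d: "det2 (direction c v r1) (direction c v r2) \<noteq> 0"
  shows "onto c (insert e1 (insert e2 E))"
  unfolding onto_def
proof
  fix w
  obtain m where m: "\<And>e. e \<in> E \<Longrightarrow> row c m e = w e" using assms(1) unfolding onto_def by metis
  obtain a where a: "a \<noteq> 0" "\<And>m. row c m e1 = a * (direction c v r1 \<bullet> (m v - offset m r1))"
    using row_arm[OF e(1)] by metis
  obtain b where b: "b \<noteq> 0" "\<And>m. row c m e2 = b * (direction c v r2 \<bullet> (m v - offset m r2))"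
    using row_arm[OF e(2)] by metis
  obtain y where y: "direction c v r1 \<bullet> y = w e1 / a + direction c v r1 \<bullet> offset m r1"
    "direction c v r2 \<bullet> y = w e2 / b + direction c v r2 \<bullet> offset m r2"
    using det2_solve[OF d] by blast
  have "row c (m(v := y)) f = w f" if "f \<in> E" for f
  proof -
    have "row c (m(v := y)) f = row c m f" by (rule row_cong) (use assms(2)[OF that] in auto)
    then show ?thesis using m[OF that] by simp
  qed
  moreover have "row c (m(v := y)) e1 = w e1" "row c (m(v := y)) e2 = w e2"
    using a(1) b(1) y by (simp_all add: a(2) b(2) offset_update[OF e(1)] offset_update[OF e(2)] inner_diff_right)
  ultimately show "\<exists>m. \<forall>e\<in>insert e1 (insert e2 E). row c m e = w e" by blast
qed

text \<open>Three rows at \<open>v\<close> can be solved for the velocity of \<open>v\<close> only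
  under one linear condition on the other velocities, obtained from the combination of rows that
  cancels \<open>m v\<close>. A motion \<open>h\<close> annihilated by the rows of \<open>E\<close>
  shifts this condition by a nonzero amount, so a multiple of \<open>h\<close> repairs any
  motion.\<close>

lemma onto_insert3:
  assumes "onto c E" "\<And>e. e \<in> E \<Longrightarrow> Some v \<notin> ends e"
    and e: "arm_of v r1 e1" "arm_of v r2 e2" "arm_of v r3 e3"
    and d: "det2 (direction c v r1) (direction c v r2) \<noteq> 0"
    and l: "direction c v r3 = x *\<^sub>R direction c v r1 + y *\<^sub>R direction c v r2"
    and h: "\<And>e. e \<in> E \<Longrightarrow> row c h e = 0"
      "direction c v r3 \<bullet> offset h r3
        \<noteq> x * (direction c v r1 \<bullet> offset h r1) + y * (direction c v r2 \<bullet> offset h r2)"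
  shows "onto c (insert e1 (insert e2 (insert e3 E)))"
  unfolding onto_def
proof
  fix w
  obtain m where m: "\<And>e. e \<in> E \<Longrightarrow> row c m e = w e" using assms(1) unfolding onto_def by metis
  obtain a1 where a1: "a1 \<noteq> 0" "\<And>m. row c m e1 = a1 * (direction c v r1 \<bullet> (m v - offset m r1))"
    using row_arm[OF e(1)] by metis
  obtain a2 where a2: "a2 \<noteq> 0" "\<And>m. row c m e2 = a2 * (direction c v r2 \<bullet> (m v - offset m r2))"
    using row_arm[OF e(2)] by metis
  obtain a3 where a3: "a3 \<noteq> 0" "\<And>m. row c m e3 = a3 * (direction c v r3 \<bullet> (m v - offset m r3))"
    using row_arm[OF e(3)] by metis
  define D1 D2 D3 where "D1 = direction c v r1" and "D2 = direction c v r2" and "D3 = direction c v r3"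
  define P where "P m = D3 \<bullet> offset m r3 - x * (D1 \<bullet> offset m r1) - y * (D2 \<bullet> offset m r2)" for m
  define Q where "Q = w e3 / a3 - x * (w e1 / a1) - y * (w e2 / a2)"
  \<comment> \<open>Chosen so that \<open>Q + P m' = 0\<close>, which makes the third equation a
    consequence of the first two.\<close>
  define s where "s = - (Q + P m) / P h"
  have Ph: "P h \<noteq> 0" using h(2) by (simp add: P_def D1_def D2_def D3_def)
  define m' where "m' = (\<lambda>v. m v + s *\<^sub>R h v)"
  have "P m' = P m + s * P h"
    by (simp add: P_def m'_def offset_linear inner_add_right algebra_simps)
  then have Pm': "Q + P m' = 0" using Ph by (simp add: s_def)
  obtain z where z: "D1 \<bullet> z = w e1 / a1 + D1 \<bullet> offset m' r1" "D2 \<bullet> z = w e2 / a2 + D2 \<bullet> offset m' r2"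
    using det2_solve[OF d] unfolding D1_def D2_def by blast
  have "D3 \<bullet> z = x * (D1 \<bullet> z) + y * (D2 \<bullet> z)"
    by (simp add: D1_def D2_def D3_def l inner_add_left)
  then have z3: "D3 \<bullet> z = w e3 / a3 + D3 \<bullet> offset m' r3"
    using Pm' z by (simp add: P_def Q_def algebra_simps)
  have "row c (m'(v := z)) f = w f" if "f \<in> E" for f
  proof -
    have "row c (m'(v := z)) f = row c m' f" by (rule row_cong) (use assms(2)[OF that] in auto)
    then show ?thesis using m[OF that] h(1)[OF that] by (simp add: m'_def row_add row_scale)
  qed
  moreover have "row c (m'(v := z)) e1 = w e1" "row c (m'(v := z)) e2 = w e2" "row c (m'(v := z)) e3 = w e3"
    using a1(1) a2(1) a3(1) z z3
    by (simp_all add: a1(2) a2(2) a3(2) offset_update[OF e(1)] offset_update[OF e(2)] offset_update[OF e(3)]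
        inner_diff_right D1_def D2_def D3_def)
  ultimately show "\<exists>m. \<forall>e\<in>insert e1 (insert e2 (insert e3 E)). row c m e = w e" by blast
qed

end

section \<open>Placing a new vertex\<close>

lemma det2_vector [simp]: "det2 (vector [a, b]) (vector [c, d]) = a * d - b * c"
  by (simp add: det2_def)

lemma det2_simps [simp]: "det2 x 0 = 0" "det2 0 y = 0" "det2 x x = 0" "det2 (- x) y = - det2 x y"
  "det2 x (- y) = - det2 x y" "det2 (r *\<^sub>R x) y = r * det2 x y" "det2 x (r *\<^sub>R y) = r * det2 x y"
  by (simp_all add: det2_def algebra_simps)

lemma det2_double [simp]: "det2 x (2 * y) = 2 * det2 x y" "det2 (2 * x) y = 2 * det2 x y"
  by (simp_all add: det2_def right_diff_distrib)

lemma det2_add: "det2 (x + x') y = det2 x y + det2 x' y" "det2 x (y + y') = det2 x y + det2 x y'"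
  "det2 (x - x') y = det2 x y - det2 x' y" "det2 x (y - y') = det2 x y - det2 x y'"
  by (simp_all add: det2_def algebra_simps)

lemma det2_commute: "det2 y x = - det2 x y"
  by (simp add: det2_def)

lemma det2_rotate: "x \<noteq> 0 \<Longrightarrow> det2 x (vector [- (x $ 2), x $ 1]) \<noteq> 0"
  by (auto simp: det2_def cart_eq_iff forall_2 sum_squares_eq_zero_iff)

definition two_point_config ::
    "'v \<Rightarrow> nat \<Rightarrow> 'v \<Rightarrow> nat \<Rightarrow> 'v \<Rightarrow> nat \<Rightarrow> real^2" where
  "two_point_config u i v j = (\<lambda>w n. if w = u \<and> n = i then vector [1, 0]
    else if w = v \<and> n = j then vector [0, 1] else 0)"

context half_turn_rows
begin

lemma chi_anti: "anti \<Longrightarrow> chi s = 1" and chi_sym: "\<not> anti \<Longrightarrow> chi s = sg s"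
  unfolding chi_def by simp_all

primrec point :: "('v \<Rightarrow> nat \<Rightarrow> real^2) \<Rightarrow> 'v arm \<Rightarrow> real^2" where
  "point c (To a s) = sg s *\<^sub>R c a 0"
| "point c Centre = 0"
| "point c (Free_dir i) = 0"

definition is_free :: "'v arm \<Rightarrow> bool" where
  "is_free r \<longleftrightarrow> (\<exists>i. r = Free_dir i)"

lemma is_free_simps [simp]: "\<not> is_free (To a s)" "\<not> is_free Centre" "is_free (Free_dir i)"
  by (auto simp: is_free_def)

lemma direction_point: "\<not> is_free r \<Longrightarrow> direction c v r = c v 0 - point c r"
  by (cases r) simp_all

lemma point_config: "point (\<lambda>v n. q v n + t *\<^sub>R c v n) r = point q r + t *\<^sub>R point c r"
  by (cases r) (simp_all add: algebra_simps)

lemma point_update: "arm_of v r e \<Longrightarrow> point (c(v := x)) r = point c r"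
  by (cases r) auto

lemma independent_directions_exist:
  assumes "arm_of v r e" "arm_of v r' e'" "r \<noteq> r'"
  shows "\<exists>q. det2 (direction q v r) (direction q v r') \<noteq> 0"
proof -
  \<comment> \<open>Up to exchanging the arms, \<open>r\<close> does not come after
    \<open>r'\<close> in the order \<open>To\<close>, \<open>Centre\<close>,
    \<open>Free_dir\<close>.\<close>
  have *: "\<exists>q. det2 (direction q v r) (direction q v r') \<noteq> 0"
    if A: "arm_of v r e" "arm_of v r' e'" "r \<noteq> r'" "is_free r \<Longrightarrow> is_free r'" "r = Centre \<Longrightarrow> r' \<noteq> Centre \<and> is_free r'"
    for r r' :: "'a arm" and e e'
  proof (cases r')
    case r': (To b t)
    then obtain a s where r: "r = To a s" using A by (cases r) auto
    show ?thesis
    proof (cases "a = b")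
      case True
      then have "t = (\<not> s)" using r r' A by auto
      then show ?thesis using A True r r'
        by (intro exI[of _ "two_point_config v 0 a 0"])
          (auto simp: two_point_config_def det2_add det2_commute[of "vector [0, 1]"])
    next
      case False
      then show ?thesis using A r r'
        by (intro exI[of _ "two_point_config a 0 b 0"]) (auto simp: two_point_config_def)
    qed
  next
    case r': Centre
    then obtain a s where r: "r = To a s" using A by (cases r) auto
    then show ?thesis using A r'
      by (intro exI[of _ "two_point_config v 0 a 0"]) (auto simp: two_point_config_def det2_add det2_commute[of "vector [0, 1]"])
  next
    case r': (Free_dir j)
    show ?thesis
    proof (cases r)
      case (Free_dir i)
      then show ?thesis using A r'
        by (intro exI[of _ "two_point_config v (Suc i) v (Suc j)"]) (auto simp: two_point_config_def)
    qed (use A r' in \<open>intro exI[of _ "two_point_config v 0 v (Suc j)"], auto simp: two_point_config_def\<close>)+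
  qed
  show ?thesis
  proof (cases "(is_free r \<longrightarrow> is_free r') \<and> (r = Centre \<longrightarrow> r' \<noteq> Centre \<and> is_free r')")
    case True then show ?thesis using *[OF assms] by blast
  next
    case False
    then have "(is_free r' \<longrightarrow> is_free r) \<and> (r' = Centre \<longrightarrow> r \<noteq> Centre \<and> is_free r)"
      using assms(3) by (cases r; cases r') auto
    then obtain q where "det2 (direction q v r') (direction q v r) \<noteq> 0"
      using *[OF assms(2,1)] assms(3) by blast
    then show ?thesis by (subst (asm) det2_commute) auto
  qed
qed

lemma extend_by_two:
  assumes "finite E" "onto c E" "\<And>e. e \<in> E \<Longrightarrow> Some v \<notin> ends e"
    and "arm_of v r1 e1" "arm_of v r2 e2" "r1 \<noteq> r2"
  shows "\<exists>c. onto c (insert e1 (insert e2 E))"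
proof -
  obtain q where "det2 (direction q v r1) (direction q v r2) \<noteq> 0"
    using independent_directions_exist[OF assms(4,5,6)] by blast
  then obtain c' where "onto c' E" "det2 (direction c' v r1) (direction c' v r2) \<noteq> 0"
    using onto_generic[OF assms(1,2), of "\<lambda>c. direction c v r1" q "\<lambda>c. direction c v r2"]
    by (auto simp: direction_config)
  then show ?thesis using onto_insert2[OF _ assms(3,4,5)] by blast
qed

text \<open>Up to a factor, \<open>f\<close> is the covering edge between the far ends of the two
  arms, the one that the new vertex subdivides.\<close>

definition joins :: "'v constraint \<Rightarrow> 'v arm \<Rightarrow> 'v arm \<Rightarrow> bool" where
  "joins f r1 r2 \<longleftrightarrow> (\<exists>\<kappa>. \<forall>c m. row c m f = \<kappa> * ((point c r1 - point c r2) \<bullet> (offset m r1 - offset m r2)))"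

lemma joins_Link: "joins (Link a b (s = t)) (To a s) (To b t)"
  unfolding joins_def
  by (rule exI[of _ "sg s * chi s"]) (auto simp: chi_def sg_def inner_diff_left inner_diff_right algebra_simps)

lemma joins_Spoke: "joins (Spoke a) (To a s) Centre"
  unfolding joins_def by (rule exI[of _ "sg s * chi s"]) (auto simp: chi_def sg_def)

text \<open>The position and velocity differences are twice the values at \<open>a\<close>, up to a
  common sign, whence the factor \<open>1/4\<close>.\<close>

lemma joins_loop: assumes "\<not> anti" shows "joins (Spoke a) (To a s) (To a (\<not> s))"
proof -
  have "chi s = sg s" "chi (\<not> s) = - sg s" unfolding chi_def using assms by simp_all
  then have "point c (To a s) - point c (To a (\<not> s)) = (2 * sg s) *\<^sub>R c a 0"
    "offset m (To a s) - offset m (To a (\<not> s)) = (2 * sg s) *\<^sub>R m a" for c m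
    by (simp_all add: cart_eq_iff)
  then show ?thesis unfolding joins_def by (intro exI[of _ "1/4"]) (simp add: sg_def)
qed

lemma obtain_separating:
  assumes "onto c (insert f E)" "f \<notin> E"
  obtains h where "row c h f = 1" "\<And>e. e \<in> E \<Longrightarrow> row c h e = 0"
proof -
  obtain h where "\<forall>e\<in>insert f E. row c h e = (if e = f then 1 else 0)"
    using assms(1)[unfolded onto_def, rule_format, of "\<lambda>e. if e = f then 1 else 0"] by blast
  moreover from this have "\<forall>e\<in>E. row c h e = 0" using assms(2) by auto
  ultimately show ?thesis using that[of h] by auto
qed

text \<open>The new vertex is placed at the midpoint of the segment that carries the removed edge.\<close>

lemma extend_join:
  assumes fin: "finite E" and on: "onto c (insert f E)" "f \<notin> E"
    and av: "\<And>e. e \<in> insert f E \<Longrightarrow> Some v \<notin> ends e"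
    and arms: "arm_of v r1 e1" "arm_of v r2 e2" "arm_of v r3 e3"
    and nf: "\<not> is_free r1" "\<not> is_free r2" "\<not> is_free r3"
    and j: "joins f r1 r2" and q: "det2 (point q r2 - point q r1) (point q r3 - point q r1) \<noteq> 0"
  shows "\<exists>c. onto c (insert e1 (insert e2 (insert e3 E)))"
proof -
  obtain c1 where c1: "onto c1 (insert f E)" "det2 (point c1 r2 - point c1 r1) (point c1 r3 - point c1 r1) \<noteq> 0"
    using onto_generic[OF _ on(1), of "\<lambda>c. point c r2 - point c r1" q "\<lambda>c. point c r3 - point c r1"] fin q
    by (auto simp: point_config algebra_simps)
  define c2 where "c2 = c1(v := (c1 v)(0 := (1/2) *\<^sub>R (point c1 r1 + point c1 r2)))"
  have "onto c2 (insert f E)"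
    by (rule onto_config_cong[OF c1(1)]) (use av in \<open>auto simp: c2_def\<close>)
  then obtain h where h: "row c2 h f = 1" "\<And>e. e \<in> E \<Longrightarrow> row c2 h e = 0"
    using obtain_separating on(2) by blast
  have pt: "point c2 r1 = point c1 r1" "point c2 r2 = point c1 r2" "point c2 r3 = point c1 r3"
    using arms by (simp_all add: c2_def point_update)
  have d: "direction c2 v r1 = (1/2) *\<^sub>R (point c1 r2 - point c1 r1)"
    "direction c2 v r2 = - (1/2) *\<^sub>R (point c1 r2 - point c1 r1)"
    "direction c2 v r3 = (1/2) *\<^sub>R (point c1 r2 - point c1 r1) - (point c1 r3 - point c1 r1)"
    using pt by (simp_all add: direction_point nf) (simp_all add: c2_def cart_eq_iff field_simps)
  \<comment> \<open>At the midpoint the directions of \<open>e1\<close> and \<open>e2\<close> are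
    opposite, so \<open>e2\<close> plays the dependent row, and the condition on \<open>h\<close> is
    its value on \<open>f\<close> up to a factor.\<close>
  have "onto c2 (insert e1 (insert e3 (insert e2 E)))"
  proof (rule onto_insert3[OF _ _ arms(1,3,2), where x = "- 1" and y = 0 and h = h])
    show "onto c2 E" using \<open>onto c2 (insert f E)\<close> onto_subset by blast
    show "Some v \<notin> ends e" if "e \<in> E" for e using av that by blast
    show "det2 (direction c2 v r1) (direction c2 v r3) \<noteq> 0"
      using c1(2) unfolding d by (simp add: det2_add(4))
    show "direction c2 v r2 = - 1 *\<^sub>R direction c2 v r1 + 0 *\<^sub>R direction c2 v r3" by (simp add: d)
    obtain \<kappa> where "row c2 h f = \<kappa> * ((point c2 r1 - point c2 r2) \<bullet> (offset h r1 - offset h r2))"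
      using j unfolding joins_def by blast
    then have "(point c1 r1 - point c1 r2) \<bullet> (offset h r1 - offset h r2) \<noteq> 0" using h(1) pt by auto
    then show "direction c2 v r2 \<bullet> offset h r2
        \<noteq> - 1 * (direction c2 v r1 \<bullet> offset h r1) + 0 * (direction c2 v r3 \<bullet> offset h r3)"
      by (simp add: d inner_diff_left inner_diff_right field_simps)
  qed (use h in auto)
  then show ?thesis by (metis insert_commute)
qed

text \<open>
  The three neighbours \<open>p(a)\<close>, \<open>-p(a)\<close> and \<open>0\<close> are collinear, so the midpoint construction fails here.
\<close>

lemma extend_antipodal_centre_sym:
  assumes "\<not> anti" and on: "onto c (insert (Spoke a) E)" "Spoke a \<notin> E"
    and av: "\<And>e. e \<in> E \<Longrightarrow> Some v \<notin> ends e"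
    and arms: "arm_of v (To a s) e1" "arm_of v (To a (\<not> s)) e2" "arm_of v Centre e3"
  shows "\<exists>c. onto c (insert e1 (insert e2 (insert e3 E)))"
proof -
  have va: "a \<noteq> v" using arms by auto
  \<comment> \<open>Any position off the line of the three neighbours serves. The direction to the
    origin is the mean of the other two, and the condition on \<open>h\<close> reduces to the row
    \<open>Spoke a\<close>.\<close>
  define x :: "real^2" where "x = vector [- (c a 0 $ 2), c a 0 $ 1]"
  define c2 where "c2 = c(v := (c v)(0 := x))"
  have "onto c2 (insert (Spoke a) E)"
    by (rule onto_config_cong[OF on(1)]) (use av va in \<open>auto simp: c2_def\<close>)
  then obtain h where h: "row c2 h (Spoke a) = 1" "\<And>e. e \<in> E \<Longrightarrow> row c2 h e = 0"
    using obtain_separating on(2) by blast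
  have ca: "c2 a 0 = c a 0" "c2 v 0 = x" using va by (simp_all add: c2_def)
  have "c a 0 \<noteq> 0" using h(1) ca by auto
  then have det: "det2 (c a 0) x \<noteq> 0" unfolding x_def by (rule det2_rotate)
  have "onto c2 (insert e1 (insert e2 (insert e3 E)))"
  proof (rule onto_insert3[OF _ _ arms, where x = "1/2" and y = "1/2" and h = h])
    show "onto c2 E" using \<open>onto c2 (insert (Spoke a) E)\<close> onto_subset by blast
    show "det2 (direction c2 v (To a s)) (direction c2 v (To a (\<not> s))) \<noteq> 0"
      using det by (simp add: ca det2_add det2_commute[of x])
    show "direction c2 v Centre = (1/2) *\<^sub>R direction c2 v (To a s) + (1/2) *\<^sub>R direction c2 v (To a (\<not> s))"
      by (simp add: cart_eq_iff field_simps)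
    show "direction c2 v Centre \<bullet> offset h Centre \<noteq> 1/2 * (direction c2 v (To a s) \<bullet> offset h (To a s))
        + 1/2 * (direction c2 v (To a (\<not> s)) \<bullet> offset h (To a (\<not> s)))"
      using h(1) by (cases s) (simp_all add: ca chi_sym[OF assms(1)] inner_diff_left inner_add_left field_simps)
  qed (use h av in auto)
  then show ?thesis by blast
qed

text \<open>The combination used in the symmetric case now leaves the product of \<open>m(a)\<close>
  with the position of \<open>v\<close>. So \<open>v\<close> is placed at the direction vector of
  the removed row \<open>Wild a i\<close>, after making that vector independent of
  \<open>p(a)\<close>.\<close>

lemma extend_antipodal_centre_anti:
  assumes anti and fin: "finite E" and on: "onto c (insert (Wild a i) E)" "Wild a i \<notin> E"
    and av: "\<And>e. e \<in> E \<Longrightarrow> Some v \<notin> ends e"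
    and arms: "arm_of v (To a s) e1" "arm_of v (To a (\<not> s)) e2" "arm_of v Centre e3"
  shows "\<exists>c. onto c (insert e1 (insert e2 (insert e3 E)))"
proof -
  have va: "a \<noteq> v" using arms by auto
  obtain c1 where c1: "onto c1 (insert (Wild a i) E)" "det2 (c1 a (Suc i)) (c1 a 0) \<noteq> 0"
    using onto_generic[OF _ on(1), of "\<lambda>c. c a (Suc i)" "two_point_config a (Suc i) a 0" "\<lambda>c. c a 0"] fin
    by (auto simp: two_point_config_def)
  define x :: "real^2" where "x = c1 a (Suc i)"
  define c2 where "c2 = c1(v := (c1 v)(0 := x))"
  have "onto c2 (insert (Wild a i) E)"
    by (rule onto_config_cong[OF c1(1)]) (use av va in \<open>auto simp: c2_def\<close>)
  then obtain h where h: "row c2 h (Wild a i) = 1" "\<And>e. e \<in> E \<Longrightarrow> row c2 h e = 0"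
    using obtain_separating on(2) by blast
  have ca: "c2 a 0 = c1 a 0" "c2 v 0 = x" "c2 a (Suc i) = x" using va by (simp_all add: c2_def x_def)
  have "onto c2 (insert e1 (insert e2 (insert e3 E)))"
  proof (rule onto_insert3[OF _ _ arms, where x = "1/2" and y = "1/2" and h = h])
    show "onto c2 E" using \<open>onto c2 (insert (Wild a i) E)\<close> onto_subset by blast
    show "det2 (direction c2 v (To a s)) (direction c2 v (To a (\<not> s))) \<noteq> 0"
      using c1(2) by (simp add: ca det2_add det2_commute[of x] flip: x_def)
    show "direction c2 v Centre = (1/2) *\<^sub>R direction c2 v (To a s) + (1/2) *\<^sub>R direction c2 v (To a (\<not> s))"
      by (simp add: cart_eq_iff field_simps)
    show "direction c2 v Centre \<bullet> offset h Centre \<noteq> 1/2 * (direction c2 v (To a s) \<bullet> offset h (To a s))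
        + 1/2 * (direction c2 v (To a (\<not> s)) \<bullet> offset h (To a (\<not> s)))"
      using h(1) by (simp add: ca chi_anti[OF assms(1)] inner_diff_left inner_add_left field_simps)
  qed (use h av in auto)
  then show ?thesis by blast
qed

text \<open>Let \<open>d\<close> be the direction of \<open>Wild a j\<close>. Displacing
  \<open>v\<close> by \<open>d\<close> from the far end of the first arm and giving the wild row at
  \<open>v\<close> the direction \<open>d\<close> too makes two directions equal; the difference of
  the two rows, suitably scaled, is \<open>d . m(a)\<close>.\<close>

lemma extend_free_direction:
  assumes anti and fin: "finite E" and on: "onto c (insert (Wild a j) E)" "Wild a j \<notin> E"
    and av: "\<And>e. e \<in> E \<Longrightarrow> Some v \<notin> ends e"
    and arms: "arm_of v (To a s) e1" "arm_of v r e2" "arm_of v (Free_dir i) e3"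
    and ne: "r \<noteq> To a s" "r \<noteq> Free_dir i"
  shows "\<exists>c. onto c (insert e1 (insert e2 (insert e3 E)))"
proof -
  have va: "a \<noteq> v" using arms by auto
  \<comment> \<open>From the new position a link or centre arm \<open>r\<close> has direction
    \<open>d + Y\<close>, and a free \<open>r\<close> is given the direction \<open>Y\<close>; in
    both cases independence from \<open>d\<close> is that of \<open>Y\<close>.\<close>
  define Y where "Y c = (case r of To b t \<Rightarrow> sg s *\<^sub>R c a 0 - sg t *\<^sub>R c b 0 | _ \<Rightarrow> sg s *\<^sub>R c a 0)"
    for c :: "'a \<Rightarrow> nat \<Rightarrow> real^2"
  have Y1: "Y (\<lambda>v n. q v n + t *\<^sub>R c v n) = Y q + t *\<^sub>R Y c" for q t c
    by (cases r) (simp_all add: Y_def algebra_simps)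
  have Y2: "det2 (two_point_config a 0 a (Suc j) a (Suc j)) (Y (two_point_config a 0 a (Suc j))) \<noteq> 0"
  proof (cases r)
    case (To b t)
    then show ?thesis using ne(1)
      by (cases s; cases t; cases "a = b")
        (auto simp: Y_def two_point_config_def det2_add)
  qed (auto simp: Y_def two_point_config_def)
  obtain c1 where c1: "onto c1 (insert (Wild a j) E)" "det2 (c1 a (Suc j)) (Y c1) \<noteq> 0"
    using onto_generic[OF _ on(1), of "\<lambda>c. c a (Suc j)" "two_point_config a 0 a (Suc j)" Y] fin Y1 Y2
    by auto
  define d :: "real^2" where "d = c1 a (Suc j)"
  define c2 where "c2 = c1(v := (\<lambda>n. if n = 0 then sg s *\<^sub>R c1 a 0 + d else if n = Suc i then d else Y c1))"
  have "onto c2 (insert (Wild a j) E)"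
    by (rule onto_config_cong[OF c1(1)]) (use av va in \<open>auto simp: c2_def\<close>)
  then obtain h where h: "row c2 h (Wild a j) = 1" "\<And>e. e \<in> E \<Longrightarrow> row c2 h e = 0"
    using obtain_separating on(2) by blast
  have ca: "c2 a 0 = c1 a 0" "c2 a (Suc j) = d" using va by (simp_all add: c2_def d_def)
  have dir1: "direction c2 v (To a s) = d" using va by (simp add: c2_def)
  have dir3: "direction c2 v (Free_dir i) = d" by (simp add: c2_def)
  have dir2: "det2 d (direction c2 v r) = det2 d (Y c1)"
  proof (cases r)
    case (To b t)
    then have "direction c2 v r = d + Y c1" using arms by (simp add: c2_def Y_def)
    then show ?thesis by (simp add: det2_add)
  next
    case Centre
    then have "direction c2 v r = d + Y c1" by (simp add: c2_def Y_def)
    then show ?thesis by (simp add: det2_add)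
  qed (use ne in \<open>simp add: c2_def\<close>)
  have "onto c2 (insert e1 (insert e2 (insert e3 E)))"
  proof (rule onto_insert3[OF _ _ arms, where x = 1 and y = 0 and h = h])
    show "onto c2 E" using \<open>onto c2 (insert (Wild a j) E)\<close> onto_subset by blast
    show "det2 (direction c2 v (To a s)) (direction c2 v r) \<noteq> 0"
      unfolding dir1 dir2 using c1(2) by (simp add: d_def)
    show "direction c2 v (Free_dir i) = 1 *\<^sub>R direction c2 v (To a s) + 0 *\<^sub>R direction c2 v r"
      by (simp only: dir1 dir3) simp
    show "direction c2 v (Free_dir i) \<bullet> offset h (Free_dir i)
        \<noteq> 1 * (direction c2 v (To a s) \<bullet> offset h (To a s)) + 0 * (direction c2 v r \<bullet> offset h r)"
      using h(1) unfolding dir1 dir3 by (simp add: ca chi_anti[OF assms(1)])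
  qed (use h av in auto)
  then show ?thesis by blast
qed

end

section \<open>Sparsity implies independence\<close>

context half_turn_rows
begin

definition proper :: "'v constraint \<Rightarrow> bool" where
  "proper e \<longleftrightarrow> (\<forall>u s. e \<noteq> Link u u s) \<and> (\<forall>u i. e = Wild u i \<longrightarrow> anti)"

lemma proper_simps [simp]: "proper (Link u v s) \<longleftrightarrow> u \<noteq> v" "proper (Spoke v)" "proper (Wild v i) \<longleftrightarrow> anti"
  by (auto simp: proper_def)

lemma arm_exists: "proper e \<Longrightarrow> Some v \<in> ends e \<Longrightarrow> \<exists>r. arm_of v r e"
  by (cases e) (auto intro: exI[of _ "To _ _"] exI[of _ Centre] exI[of _ "Free_dir _"])

lemma not_sparse_if_card:
  assumes "finite F" "span_verts F \<subseteq> U" "finite U" "card U \<le> n"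
    and "2 * int n - (if potential_balanced F then 3 else slack) < int (card F)" "F \<noteq> {}"
  shows "\<not> sparse F"
proof
  assume "sparse F"
  then have "int (card F) \<le> bound F" using sparse_bound assms(6) by blast
  moreover have "card (span_verts F) \<le> n" using card_mono[OF assms(3,2)] assms(4) by simp
  ultimately show False using assms(5) by (simp add: bound_def split: if_splits)
qed

lemma potential_balanced_same_arm:
  assumes "arm_of v (To a s) e" "arm_of v (To a s) e'"
  shows "potential_balanced {e, e'}"
  unfolding potential_balanced_def
  by (rule exI[of _ "\<lambda>u. u = v \<or> s"]) (use assms in auto)

text \<open>Only links can repeat an arm, and two links with the same arm form a balanced pair on
  two vertices, whose bound is 1.\<close>

lemma sparse_arms_distinct:
  assumes "sparse E" "e \<in> E" "e' \<in> E" "e \<noteq> e'" "arm_of v r e" "arm_of v r' e'"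
  shows "r \<noteq> r'"
proof
  assume rr: "r = r'"
  then obtain a s where r: "r = To a s" using assms by (cases r) auto
  have "\<not> sparse {e, e'}"
  proof (rule not_sparse_if_card[of _ "{Some v, Some a}" 2])
    show "span_verts {e, e'} \<subseteq> {Some v, Some a}" using assms r rr by (auto simp: span_verts_def)
    have "potential_balanced {e, e'}" using potential_balanced_same_arm[of v a s e e'] assms r rr by blast
    then show "2 * int 2 - (if potential_balanced {e, e'} then 3 else slack) < int (card {e, e'})"
      using assms(4) by simp
  qed (auto simp: card_insert_if slack_def)
  moreover have "sparse {e, e'}" using assms(2,3) by (intro sparse_subset[OF assms(1)]) auto
  ultimately show False by blast
qed

lemma sparse_single:
  assumes "arm_of v r e" "proper e" shows "1 \<le> bound {e}"
proof (cases r)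
  case (To a s)
  then have "span_verts {e} = {Some v, Some a}" "v \<noteq> a" using assms by (auto simp: span_verts_def)
  then show ?thesis using k_cases by (auto simp: bound_def)
next
  case Centre
  then have "span_verts {e} = insert (Some v) {x. anti \<and> x = None}" using assms by (simp add: span_verts_def)
  moreover have "potential_balanced {e} \<longleftrightarrow> anti" using assms Centre by (simp add: potential_balanced_def)
  ultimately show ?thesis unfolding bound_def unfolding slack_def by simp
next
  case (Free_dir i)
  then have "anti" using assms by simp
  then have "span_verts {e} = {Some v, None}" using assms Free_dir by (simp add: span_verts_def)
  moreover have "\<not> potential_balanced {e}" using assms Free_dir by (simp add: potential_balanced_def)
  ultimately show ?thesis using k_cases by (auto simp: bound_def)
qed

text \<open>Distinct arms span three vertices, the ground included, or form an unbalanced pair on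
  two; either way there is room for both edges.\<close>

lemma sparse_pair:
  assumes "arm_of v r1 e1" "arm_of v r2 e2" "r1 \<noteq> r2" "proper e1" "proper e2"
  shows "2 \<le> bound {e1, e2}"
proof -
  have fin: "finite (span_verts {e1, e2})" by (simp add: finite_span_verts)
  have *: ?thesis if "card (span_verts {e1, e2}) \<ge> 3"
    using that k_cases by (auto simp: bound_def)
  have **: ?thesis if "card (span_verts {e1, e2}) \<ge> 2" "\<not> potential_balanced {e1, e2}"
    using that k_cases by (auto simp: bound_def)
  have bal1: "potential_balanced {e1, e2} \<Longrightarrow> potential_balanced {e1} \<and> potential_balanced {e2}"
    using potential_balanced_mono[of "{e1}" "{e1, e2}"] potential_balanced_mono[of "{e2}" "{e1, e2}"] by auto
  have centre: "potential_balanced {e} \<longleftrightarrow> anti" if "arm_of v Centre e" for e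
    using that by (simp add: potential_balanced_def)
  have wild: "\<not> potential_balanced {e}" if "arm_of v (Free_dir i) e" for e i
    using that by (simp add: potential_balanced_def)
  have two: "card (span_verts {e1, e2}) \<ge> 2" if "x \<in> span_verts {e1, e2}" "x \<noteq> Some v" for x
    using card_mono[OF fin, of "{Some v, x}"] that arm_of_ends[OF assms(1)] by (auto simp: span_verts_def)
  have three: "card (span_verts {e1, e2}) \<ge> 3"
    if "x \<in> span_verts {e1, e2}" "x \<noteq> Some v" "y \<in> span_verts {e1, e2}" "y \<noteq> Some v" "x \<noteq> y" for x y
    using card_mono[OF fin, of "{Some v, x, y}"] that arm_of_ends[OF assms(1)] by (auto simp: span_verts_def)
  have To: "Some a \<in> span_verts {e1, e2} \<and> a \<noteq> v"
    if "arm_of v (To a s) e" "e \<in> {e1, e2}" for a s e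
    using that by (auto simp: span_verts_def)
  have ground: "None \<in> span_verts {e1, e2}"
    if "arm_of v Centre e \<or> arm_of v (Free_dir i) e" "e \<in> {e1, e2}" anti for e i
    using that by (auto simp: span_verts_def)
  have mixed: ?thesis
    if A: "arm_of v (To a s) e" "e \<in> {e1, e2}" "arm_of v r e'" "e' \<in> {e1, e2}"
      "r = Centre \<or> (\<exists>i. r = Free_dir i)" "proper e'"
    for a s e e' r
  proof -
    have a: "Some a \<in> span_verts {e1, e2}" "Some a \<noteq> Some v" using To[OF A(1,2)] by auto
    show ?thesis
    proof (cases anti)
      case True
      then have n: "None \<in> span_verts {e1, e2}" using ground[of e'] A(3,4,5) by blast
      show ?thesis by (rule *, rule three[OF a n]) auto
    next
      case False
      then have "r = Centre" using A(3,5,6) by auto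
      then have "\<not> potential_balanced {e'}" using centre[of e'] A(3) False by blast
      then have "\<not> potential_balanced {e1, e2}" using bal1 A(4) by blast
      then show ?thesis using ** two[OF a] by blast
    qed
  qed
  show ?thesis
  proof (cases r1)
    case r1: (To a s)
    show ?thesis
    proof (cases r2)
      case r2: (To b t)
      show ?thesis
      proof (cases "a = b")
        case True
        then have "t = (\<not> s)" using assms r1 r2 by auto
        then have "\<not> potential_balanced {e1, e2}"
          using True assms r1 r2 by (auto simp: potential_balanced_def)
        then show ?thesis using two[of "Some a"] To[of a s e1] assms(1) r1 ** by auto
      next
        case False
        have "Some a \<in> span_verts {e1, e2}" "Some b \<in> span_verts {e1, e2}" "a \<noteq> v" "b \<noteq> v"
          using To[of a s e1] To[of b t e2] assms(1,2) r1 r2 by auto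
        then show ?thesis using three[of "Some a" "Some b"] False * by auto
      qed
    qed (use mixed[of a s e1 r2 e2] assms r1 in auto)
  next
    case r1: Centre
    show ?thesis
    proof (cases r2)
      case r2: (To b t)
      show ?thesis using mixed[of b t e2 r1 e1] r1 r2 assms by auto
    next
      case r2: (Free_dir i)
      then have "None \<in> span_verts {e1, e2}" using ground[of e2 i] assms by auto
      then show ?thesis using two[of None] ** wild[of i e2] r2 assms bal1 by auto
    qed (use assms r1 in auto)
  next
    case r1: (Free_dir i)
    show ?thesis
    proof (cases r2)
      case r2: (To b t)
      show ?thesis using mixed[of b t e2 r1 e1] r1 r2 assms by auto
    qed (use two[of None] ** wild[of i e1] ground[of e1 i] r1 assms bal1 in auto)
  qed
qed

text \<open>The new vertex raises the bound of a subset by 2, enough for its at most two new edges.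
  Subsets without edges of \<open>K\<close> have no bound to start from and are treated by
  \<open>sparse_single\<close> and \<open>sparse_pair\<close>.\<close>

lemma sparse_insert_two:
  assumes K: "sparse K" "\<And>e. e \<in> K \<Longrightarrow> Some v \<notin> ends e"
    and e: "arm_of v r1 e1" "arm_of v r2 e2" "r1 \<noteq> r2" "proper e1" "proper e2"
  shows "sparse (insert e1 (insert e2 K))"
  unfolding sparse_def
proof (intro conjI allI impI)
  show "finite (insert e1 (insert e2 K))" using sparse_finite[OF K(1)] by simp
  fix F assume F: "F \<subseteq> insert e1 (insert e2 K)" "F \<noteq> {}"
  have finF: "finite F" using F sparse_finite[OF K(1)] finite_subset by blast
  show "int (card F) \<le> bound F"
  proof (cases "F \<inter> K = {}")
    case True
    have "e1 \<noteq> e2" using arm_of_unique[of v r1 e1 r2] e by auto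
    have "F = {e1} \<or> F = {e2} \<or> F = {e1, e2}" using F True by blast
    then show ?thesis using sparse_single[OF e(1,4)] sparse_single[OF e(2,5)] sparse_pair[OF e] \<open>e1 \<noteq> e2\<close> by auto
  next
    case False
    have s: "int (card (F \<inter> K)) \<le> bound (F \<inter> K)"
      using False K(1) by (intro sparse_bound sparse_subset[OF K(1)]) auto
    show ?thesis
    proof (cases "F \<subseteq> K")
      case True then show ?thesis using s by (simp add: inf_absorb1)
    next
      case nsub: False
      have cF: "card F \<le> card (F \<inter> K) + 2"
      proof -
        have "card F \<le> card ((F \<inter> K) \<union> {e1, e2})" using F finF by (intro card_mono) auto
        also have "\<dots> \<le> card (F \<inter> K) + card {e1, e2}" by (rule card_Un_le)
        also have "card {e1, e2} \<le> 2" by (simp add: card_insert_if)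
        finally show ?thesis by simp
      qed
      have "Some v \<in> span_verts F" using nsub F arm_of_ends[OF e(1)] arm_of_ends[OF e(2)] by (auto simp: span_verts_def)
      moreover have "Some v \<notin> span_verts (F \<inter> K)" using K(2) by (auto simp: span_verts_def)
      moreover have "span_verts (F \<inter> K) \<subseteq> span_verts F" by (rule span_verts_mono) blast
      ultimately have "card (insert (Some v) (span_verts (F \<inter> K))) \<le> card (span_verts F)"
        using finF by (intro card_mono finite_span_verts) auto
      then have "card (span_verts (F \<inter> K)) + 1 \<le> card (span_verts F)"
        using \<open>Some v \<notin> span_verts (F \<inter> K)\<close> finF by (simp add: finite_span_verts)
      moreover have "potential_balanced F \<Longrightarrow> potential_balanced (F \<inter> K)" by (rule potential_balanced_mono) auto
      ultimately have "bound (F \<inter> K) + 2 \<le> bound F"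
        using k_cases by (auto simp: bound_def split: if_splits)
      then show ?thesis using cF s by linarith
    qed
  qed
qed

lemma sparse_empty: "sparse {}"
  by (simp add: sparse_def)

text \<open>With \<open>V\<close> the free vertices, minimum degree 4 would give
  \<open>4 |V| <= 2 |E|\<close>. Without the ground \<open>|E| <= 2 |V| - 1\<close>. With it
  \<open>|E| = 2 |V|\<close> is possible, but then some edge has a single free end, which lowers the
  degree sum below \<open>4 |V|\<close>.\<close>

lemma low_degree_vertex:
  assumes "sparse E" "E \<noteq> {}"
  shows "\<exists>v. Some v \<in> span_verts E \<and> card {e \<in> E. Some v \<in> ends e} \<le> 3"
proof (rule ccontr)
  assume "\<not> ?thesis"
  then have deg: "card {e \<in> E. Some v \<in> ends e} \<ge> 4" if "Some v \<in> span_verts E" for v using that by force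
  define V where "V = {v. Some v \<in> span_verts E}"
  have fE: "finite E" using assms(1) by (rule sparse_finite)
  have fV: "finite V" using finite_vimageI[OF finite_span_verts[OF fE], of Some] by (simp add: V_def vimage_def)
  have le2: "card {v \<in> V. Some v \<in> ends e} \<le> (if None \<in> ends e then 1 else 2)" if "e \<in> E" for e
  proof (cases e)
    case (Link a b s)
    have "card {v \<in> V. Some v \<in> ends e} \<le> card {a, b}" using Link by (intro card_mono) auto
    then show ?thesis using Link by (auto simp: card_insert_if split: if_splits)
  next
    case (Spoke a)
    have "card {v \<in> V. Some v \<in> ends e} \<le> card {a}" using Spoke by (intro card_mono) auto
    then show ?thesis by auto
  next
    case (Wild a i)
    have "card {v \<in> V. Some v \<in> ends e} \<le> card {a}" using Wild by (intro card_mono) auto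
    then show ?thesis by auto
  qed
  have "4 * card V \<le> (\<Sum>v\<in>V. card {e \<in> E. Some v \<in> ends e})"
    using sum_mono[of V "\<lambda>_. 4 :: nat" "\<lambda>v. card {e \<in> E. Some v \<in> ends e}"] deg by (simp add: V_def)
  also have "\<dots> = (\<Sum>e\<in>E. card {v \<in> V. Some v \<in> ends e})"
    using sum_multicount_gen[OF fV fE, of "\<lambda>v e. Some v \<in> ends e"] by simp
  finally have dbl: "4 * card V \<le> (\<Sum>e\<in>E. card {v \<in> V. Some v \<in> ends e})" .
  have b: "int (card E) \<le> bound E" using assms by (rule sparse_bound)
  have spanV: "span_verts E \<subseteq> insert None (Some ` V)"
  proof
    fix x assume "x \<in> span_verts E"
    then show "x \<in> insert None (Some ` V)" unfolding V_def by (cases x) auto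
  qed
  show False
  proof (cases "None \<in> span_verts E")
    case False
    then have "span_verts E \<subseteq> Some ` V" using spanV by blast
    then have "card (span_verts E) \<le> card V" using fV by (meson card_image_le card_mono finite_imageI le_trans)
    then have "int (card E) \<le> 2 * int (card V) - 1" using b k_cases by (auto simp: bound_def split: if_splits)
    moreover have "(\<Sum>e\<in>E. card {v \<in> V. Some v \<in> ends e}) \<le> (\<Sum>e\<in>E. 2)"
      by (intro sum_mono) (use le2 in \<open>force split: if_splits\<close>)
    ultimately show False using dbl by simp
  next
    case True
    then obtain e0 where e0: "e0 \<in> E" "None \<in> ends e0" by (auto simp: span_verts_def)
    then have "anti" using ground_end[OF e0(2)] by (simp add: slack_def split: if_splits)
    have "card (span_verts E) \<le> card (insert None (Some ` V))" using spanV fV by (intro card_mono) auto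
    also have "\<dots> = card V + 1" using fV by (simp add: card_image)
    finally have c: "card (span_verts E) \<le> card V + 1" .
    have "bound E \<le> 2 * int (card (span_verts E)) - 2" using \<open>anti\<close> unfolding bound_def unfolding slack_def by simp
    then have "int (card E) \<le> 2 * int (card V)" using b c by linarith
    moreover have "(\<Sum>e\<in>E. card {v \<in> V. Some v \<in> ends e}) \<le> (\<Sum>e\<in>E. if e = e0 then 1 else 2)"
      by (intro sum_mono) (use le2 e0 in \<open>force split: if_splits\<close>)
    moreover have "(\<Sum>e\<in>E. if e = e0 then 1 else 2) + 1 = 2 * card E"
    proof -
      have "(\<Sum>e\<in>E. if e = e0 then 1 else 2) = 1 + (\<Sum>e\<in>E - {e0}. 2 :: nat)"
        using sum.remove[OF fE e0(1), of "\<lambda>e. if e = e0 then 1 else (2::nat)"] sum.cong[of "E - {e0}" "E - {e0}" "\<lambda>e. if e = e0 then 1 else 2" "\<lambda>_. 2::nat"] by simp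
      moreover have "card E = Suc (card (E - {e0}))" using fE e0 by (metis card_Suc_Diff1)
      ultimately show ?thesis by simp
    qed
    ultimately show False using dbl by linarith
  qed
qed


section \<open>The closure argument at a vertex of degree three\<close>

lemma sparse_singleton: "arm_of v r e \<Longrightarrow> proper e \<Longrightarrow> sparse {e}"
  using sparse_single by (auto simp: sparse_def subset_singleton_iff)

text \<open>
  The last conjunct is the induction hypothesis for the graph without \<open>v\<close> and one more edge.
\<close>

definition star :: "'v constraint set \<Rightarrow> 'v \<Rightarrow> 'v constraint \<Rightarrow> 'v arm \<Rightarrow> 'v constraint \<Rightarrow> 'v arm
    \<Rightarrow> 'v constraint \<Rightarrow> 'v arm \<Rightarrow> bool" where
  "star E v e1 r1 e2 r2 e3 r3 \<longleftrightarrow>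
    (\<forall>e\<in>E. Some v \<notin> ends e) \<and> arm_of v r1 e1 \<and> arm_of v r2 e2 \<and> arm_of v r3 e3 \<and>
    r1 \<noteq> r2 \<and> r1 \<noteq> r3 \<and> r2 \<noteq> r3 \<and> proper e1 \<and> proper e2 \<and> proper e3 \<and>
    sparse (insert e1 (insert e2 (insert e3 E))) \<and>
    (\<forall>f. proper f \<longrightarrow> ends f \<subseteq> insert None (ends e1 \<union> ends e2 \<union> ends e3 - {Some v}) \<longrightarrow>
      sparse (insert f E) \<longrightarrow> (\<exists>c. onto c (insert f E)))"

lemma star_swap12: "star E v e1 r1 e2 r2 e3 r3 \<Longrightarrow> star E v e2 r2 e1 r1 e3 r3"
  unfolding star_def by (auto simp: insert_commute Un_commute Un_left_commute)

lemma star_swap23: "star E v e1 r1 e2 r2 e3 r3 \<Longrightarrow> star E v e1 r1 e3 r3 e2 r2"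
  unfolding star_def by (auto simp: insert_commute Un_commute Un_left_commute)

lemma starD:
  assumes "star E v e1 r1 e2 r2 e3 r3"
  shows "\<And>e. e \<in> E \<Longrightarrow> Some v \<notin> ends e" "arm_of v r1 e1" "arm_of v r2 e2" "arm_of v r3 e3"
    "r1 \<noteq> r2" "r1 \<noteq> r3" "r2 \<noteq> r3" "proper e1" "proper e2" "proper e3"
    "sparse (insert e1 (insert e2 (insert e3 E)))"
  using assms unfolding star_def by blast+

lemma insert_rotations:
  "insert x (insert z (insert y A)) = insert x (insert y (insert z A))"
  "insert y (insert z (insert x A)) = insert x (insert y (insert z A))"
  "insert y (insert x (insert z A)) = insert x (insert y (insert z A))"
  by blast+

lemma star_distinct:
  assumes "star E v e1 r1 e2 r2 e3 r3"
  shows "e1 \<noteq> e2" "e1 \<noteq> e3" "e2 \<noteq> e3" "e1 \<notin> E" "e2 \<notin> E" "e3 \<notin> E"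
  using assms arm_of_unique[of v r1 e1] arm_of_unique[of v r2 e2] arm_of_ends[of v r1 e1] arm_of_ends[of v r2 e2]
    arm_of_ends[of v r3 e3]
  unfolding star_def by blast+

lemma star_finite: "star E v e1 r1 e2 r2 e3 r3 \<Longrightarrow> finite E"
  unfolding star_def using sparse_finite by fastforce

text \<open>\<open>K\<close> lies in the closure of \<open>E\<close> with \<open>e1\<close> and
  \<open>e2\<close>; if \<open>e3\<close> depended on \<open>K\<close>, it would lie there too,
  against the sparsity of the whole star.\<close>

lemma star_closure:
  assumes st: "star E v e1 r1 e2 r2 e3 r3"
    and K: "sparse K" "\<And>f. f \<in> K \<Longrightarrow> f = e1 \<or> f = e2 \<or> f \<in> E \<or> \<not> sparse (insert f E)"
  shows "sparse (insert e3 K)"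
proof (rule ccontr)
  assume no: "\<not> sparse (insert e3 K)"
  let ?I = "insert e1 (insert e2 E)"
  have s: "sparse (insert e1 (insert e2 (insert e3 E)))" using st unfolding star_def by blast
  have "\<not> sparse (insert e3 ?I)"
  proof (rule not_sparse_closure[OF _ K(1) _ no])
    show "sparse ?I" by (rule sparse_subset[OF s]) blast
    show "e3 \<notin> ?I" using star_distinct[OF st] by auto
    fix f assume "f \<in> K"
    then consider "f \<in> ?I" | "\<not> sparse (insert f E)" using K(2) by blast
    then show "f \<in> ?I \<or> \<not> sparse (insert f ?I)"
    proof cases
      case 2
      then show ?thesis using sparse_subset[of "insert f ?I" "insert f E"] by blast
    qed blast
  qed
  moreover have "insert e3 ?I = insert e1 (insert e2 (insert e3 E))" by blast
  ultimately show False using s by simp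
qed

lemma star_card:
  assumes st: "star E v e1 r1 e2 r2 e3 r3" and K: "finite K" "\<And>f. f \<in> K \<Longrightarrow> Some v \<notin> ends f"
  shows "card (insert e3 (insert e1 (insert e2 K))) = 3 + card K"
proof -
  have "e1 \<notin> K" "e2 \<notin> K" "e3 \<notin> K"
    using st K(2) arm_of_ends[of v r1 e1] arm_of_ends[of v r2 e2] arm_of_ends[of v r3 e3]
    unfolding star_def by blast+
  then show ?thesis using star_distinct[OF st] K(1) by auto
qed

text \<open>\<open>K\<close> will be a set of blocked candidates. It lies in the closure of
  \<open>E\<close>, so it stays sparse together with the three edges at \<open>v\<close>, although
  the count on \<open>n\<close> vertices makes it too large.\<close>

lemma star_contradiction:
  assumes st: "star E v e1 r1 e2 r2 e3 r3"
    and K: "sparse K" "\<And>f. f \<in> K \<Longrightarrow> Some v \<notin> ends f" "\<And>f. f \<in> K \<Longrightarrow> f \<in> E \<or> \<not> sparse (insert f E)"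
    and U: "span_verts (insert e3 (insert e1 (insert e2 K))) \<subseteq> U" "finite U" "card U \<le> n"
    and n: "2 * int n - (if potential_balanced (insert e3 (insert e1 (insert e2 K))) then 3 else slack)
      < 3 + int (card K)"
  shows False
proof -
  have "sparse (insert e1 (insert e2 K))"
    using starD[OF st] by (intro sparse_insert_two[OF K(1,2)])
  then have s: "sparse (insert e3 (insert e1 (insert e2 K)))" using K(3) by (intro star_closure[OF st]) auto
  have "\<not> sparse (insert e3 (insert e1 (insert e2 K)))"
    using U n star_card[OF st sparse_finite[OF K(1)] K(2)] sparse_finite[OF s]
    by (intro not_sparse_if_card[OF _ U]) auto
  then show False using s by blast
qed

text \<open>If a candidate outside \<open>E\<close> kept \<open>E\<close> sparse, the induction
  hypothesis would supply independent rows, and \<open>ext\<close> would place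
  \<open>v\<close>.\<close>

lemma star_blocked:
  assumes st: "star E v e1 r1 e2 r2 e3 r3"
    and no: "\<nexists>c. onto c (insert e1 (insert e2 (insert e3 E)))"
    and f: "proper f" "ends f \<subseteq> insert None (ends e1 \<union> ends e2 \<union> ends e3 - {Some v})"
    and ext: "\<And>c. onto c (insert f E) \<Longrightarrow> f \<notin> E \<Longrightarrow> \<exists>c. onto c (insert e1 (insert e2 (insert e3 E)))"
  shows "f \<in> E \<or> \<not> sparse (insert f E)"
  using assms unfolding star_def by blast

lemma star_blocked_join:
  assumes st: "star E v e1 r1 e2 r2 e3 r3"
    and no: "\<nexists>c. onto c (insert e1 (insert e2 (insert e3 E)))"
    and f: "proper f" "ends f \<subseteq> insert None (ends e1 \<union> ends e2 \<union> ends e3 - {Some v})"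
    and nf: "\<not> is_free r1" "\<not> is_free r2" "\<not> is_free r3"
    and j: "joins f r1 r2" and q: "det2 (point q r2 - point q r1) (point q r3 - point q r1) \<noteq> 0"
  shows "f \<in> E \<or> \<not> sparse (insert f E)"
proof (rule star_blocked[OF st no f])
  fix c assume c: "onto c (insert f E)" "f \<notin> E"
  have "\<And>e. e \<in> insert f E \<Longrightarrow> Some v \<notin> ends e" using starD(1)[OF st] f(2) by auto
  then show "\<exists>c. onto c (insert e1 (insert e2 (insert e3 E)))"
    using starD[OF st] by (intro extend_join[OF star_finite[OF st] c _ _ _ _ nf j q])
qed

text \<open>The candidates form a triangle. With the edges at \<open>v\<close> they are a balanced
  complete graph on four vertices, and 6 exceeds \<open>2 * 4 - 3\<close>.\<close>

lemma extend_three_vertices: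
  assumes st: "star E v e1 (To a s) e2 (To b t) e3 (To c w)" and ne: "a \<noteq> b" "a \<noteq> c" "b \<noteq> c"
  shows "\<exists>c. onto c (insert e1 (insert e2 (insert e3 E)))"
proof (rule ccontr)
  assume no: "\<nexists>c. onto c (insert e1 (insert e2 (insert e3 E)))"
  have nv: "a \<noteq> v" "b \<noteq> v" "c \<noteq> v" using starD(2-4)[OF st] by auto
  have en: "ends e1 = {Some v, Some a}" "ends e2 = {Some v, Some b}" "ends e3 = {Some v, Some c}"
    using starD(2-4)[OF st] by auto
  have no': "\<nexists>c. onto c (insert e1 (insert e3 (insert e2 E)))" "\<nexists>c. onto c (insert e2 (insert e3 (insert e1 E)))"
    unfolding insert_rotations(1)[of e1 e3 e2] insert_rotations(2)[of e2 e3 e1] by (fact no)+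
  define f12 f13 f23 where f: "f12 = Link a b (s = t)" "f13 = Link a c (s = w)" "f23 = Link b c (t = w)"
  let ?q = "two_point_config a 0 b 0"
  have 1: "f12 \<in> E \<or> \<not> sparse (insert f12 E)"
    by (rule star_blocked_join[OF st no, where q = ?q])
      (use ne nv in \<open>auto simp: f joins_Link en two_point_config_def det2_add\<close>)
  have 2: "f13 \<in> E \<or> \<not> sparse (insert f13 E)"
    by (rule star_blocked_join[OF star_swap23[OF st] no'(1), where q = ?q])
      (use ne nv in \<open>auto simp: f joins_Link en two_point_config_def det2_add\<close>)
  have 3: "f23 \<in> E \<or> \<not> sparse (insert f23 E)"
    by (rule star_blocked_join[OF star_swap23[OF star_swap12[OF st]] no'(2), where q = ?q])
      (use ne nv in \<open>auto simp: f joins_Link en two_point_config_def det2_add\<close>)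
  have "sparse {f23}" by (rule sparse_singleton[of b "To c (t = w)"]) (use ne in \<open>auto simp: f\<close>)
  then have K: "sparse {f12, f13, f23}"
    by (rule sparse_insert_two[where v = a and ?r1.0 = "To b (s = t)" and ?r2.0 = "To c (s = w)"])
      (use ne in \<open>auto simp: f\<close>)
  \<comment> \<open>The sign of each arm, taken as the potential of its far end relative to
    \<open>v\<close>, explains all six gains.\<close>
  let ?\<phi> = "\<lambda>u. u = v \<or> u = a \<and> s \<or> u = b \<and> t \<or> u = c \<and> w"
  have "compat ?\<phi> e" if "e \<in> insert e3 (insert e1 (insert e2 {f12, f13, f23}))" for e
    using that starD(2-4)[OF st] ne nv by (auto simp: f)
  then have bal: "potential_balanced (insert e3 (insert e1 (insert e2 {f12, f13, f23})))"
    unfolding potential_balanced_def by blast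
  show False
  proof (rule star_contradiction[OF st K, where n = 4])
    show "span_verts (insert e3 (insert e1 (insert e2 {f12, f13, f23}))) \<subseteq> {Some v, Some a, Some b, Some c}"
      by (auto simp: span_verts_def en f)
    show "2 * int 4 - (if potential_balanced (insert e3 (insert e1 (insert e2 {f12, f13, f23}))) then 3
        else slack) < 3 + int (card {f12, f13, f23})"
      using bal ne by (simp add: f)
  qed (use 1 2 3 nv in \<open>auto simp: f card_insert_if slack_def\<close>)
qed

text \<open>Antisymmetrically the two links between \<open>a\<close> and \<open>c\<close> suffice,
  as 5 edges exceed \<open>2 * 3 - 2\<close>. Symmetrically the bound is \<open>2 * 3 - 1\<close>,
  and \<open>Spoke a\<close>, which joins the antipodal points, is the sixth edge.\<close>

lemma extend_antipodal_vertex: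
  assumes st: "star E v e1 (To a s) e2 (To a (\<not> s)) e3 (To c w)" and ne: "a \<noteq> c"
  shows "\<exists>c. onto c (insert e1 (insert e2 (insert e3 E)))"
proof (rule ccontr)
  assume no: "\<nexists>c. onto c (insert e1 (insert e2 (insert e3 E)))"
  have nv: "a \<noteq> v" "c \<noteq> v" using starD(2-4)[OF st] by auto
  have en: "ends e1 = {Some v, Some a}" "ends e2 = {Some v, Some a}" "ends e3 = {Some v, Some c}"
    using starD(2-4)[OF st] by auto
  have no': "\<nexists>c. onto c (insert e1 (insert e3 (insert e2 E)))" "\<nexists>c. onto c (insert e2 (insert e3 (insert e1 E)))"
    unfolding insert_rotations(1)[of e1 e3 e2] insert_rotations(2)[of e2 e3 e1] by (fact no)+
  define f13 f23 where f: "f13 = Link a c (s = w)" "f23 = Link a c ((\<not> s) = w)"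
  let ?q = "two_point_config a 0 c 0"
  have 2: "f13 \<in> E \<or> \<not> sparse (insert f13 E)"
    by (rule star_blocked_join[OF star_swap23[OF st] no'(1), where q = ?q])
      (use ne nv in \<open>auto simp: f joins_Link en two_point_config_def det2_add simp del: not_iff\<close>)
  have 3: "f23 \<in> E \<or> \<not> sparse (insert f23 E)"
    by (rule star_blocked_join[OF star_swap23[OF star_swap12[OF st]] no'(2), where q = ?q])
      (use ne nv joins_Link[of a c "\<not> s" w] in \<open>auto simp: f en two_point_config_def det2_add\<close>)
  have f_ne: "f13 \<noteq> f23" by (simp add: f)
  have arms: "arm_of c (To a (s = w)) f13" "arm_of c (To a ((\<not> s) = w)) f23" "(s = w) \<noteq> ((\<not> s) = w)"
    using ne by (auto simp: f)
  show False
  proof (cases anti)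
    case True
    have K: "sparse {f13, f23}"
      by (rule sparse_insert_two[OF sparse_empty _ arms(1,2)]) (use ne in \<open>auto simp: f\<close>)
    show False
    proof (rule star_contradiction[OF st K, where n = 3])
      show "span_verts (insert e3 (insert e1 (insert e2 {f13, f23}))) \<subseteq> {Some v, Some a, Some c}"
        by (auto simp: span_verts_def en f)
    qed (use 2 3 nv f_ne True in \<open>auto simp: f card_insert_if slack_def\<close>)
  next
    case False
    have "f \<in> E \<or> \<not> sparse (insert f E)" if "f = Spoke a" for f
      by (rule star_blocked_join[OF st no, where q = ?q])
        (use ne nv False in \<open>auto simp: that joins_loop en two_point_config_def det2_add\<close>)
    then have 1: "Spoke a \<in> E \<or> \<not> sparse (insert (Spoke a) E)" by blast
    have "sparse {Spoke a}" by (rule sparse_singleton[of a Centre]) auto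
    then have K: "sparse {f13, f23, Spoke a}"
      by (rule sparse_insert_two[OF _ _ arms(1,2)]) (use ne in \<open>auto simp: f\<close>)
    show False
    proof (rule star_contradiction[OF st K, where n = 3])
      show "span_verts (insert e3 (insert e1 (insert e2 {f13, f23, Spoke a}))) \<subseteq> {Some v, Some a, Some c}"
        using False by (auto simp: span_verts_def en f)
    qed (use 1 2 3 nv f_ne False in \<open>auto simp: f card_insert_if slack_def\<close>)
  qed
qed

text \<open>Antisymmetrically the ground is a fourth vertex and the six edges are a balanced
  complete graph; symmetrically it is no vertex, and 6 exceeds \<open>2 * 3 - 1\<close>.\<close>

lemma extend_two_vertices_centre:
  assumes st: "star E v e1 (To a s) e2 (To b t) e3 Centre" and ne: "a \<noteq> b"
  shows "\<exists>c. onto c (insert e1 (insert e2 (insert e3 E)))"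
proof (rule ccontr)
  assume no: "\<nexists>c. onto c (insert e1 (insert e2 (insert e3 E)))"
  have nv: "a \<noteq> v" "b \<noteq> v" using starD(2-4)[OF st] by auto
  have en: "ends e1 = {Some v, Some a}" "ends e2 = {Some v, Some b}" "e3 = Spoke v"
    using starD(2-4)[OF st] by auto
  have no': "\<nexists>c. onto c (insert e1 (insert e3 (insert e2 E)))" "\<nexists>c. onto c (insert e2 (insert e3 (insert e1 E)))"
    unfolding insert_rotations(1)[of e1 e3 e2] insert_rotations(2)[of e2 e3 e1] by (fact no)+
  define f12 where f: "f12 = Link a b (s = t)"
  let ?q = "two_point_config a 0 b 0"
  have 1: "f12 \<in> E \<or> \<not> sparse (insert f12 E)"
    by (rule star_blocked_join[OF st no, where q = ?q])
      (use ne nv in \<open>auto simp: f joins_Link en two_point_config_def det2_add\<close>)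
  have 2: "Spoke a \<in> E \<or> \<not> sparse (insert (Spoke a) E)"
    by (rule star_blocked_join[OF star_swap23[OF st] no'(1), where q = ?q])
      (use ne nv in \<open>auto simp: joins_Spoke en two_point_config_def det2_add\<close>)
  have 3: "Spoke b \<in> E \<or> \<not> sparse (insert (Spoke b) E)"
    by (rule star_blocked_join[OF star_swap23[OF star_swap12[OF st]] no'(2), where q = ?q])
      (use ne nv in \<open>auto simp: joins_Spoke en two_point_config_def det2_add\<close>)
  have "sparse {Spoke b}" by (rule sparse_singleton[of b Centre]) auto
  then have K: "sparse {f12, Spoke a, Spoke b}"
    by (rule sparse_insert_two[where v = a and ?r1.0 = "To b (s = t)" and ?r2.0 = Centre])
      (use ne in \<open>auto simp: f\<close>)
  let ?\<phi> = "\<lambda>u. u = v \<or> u = a \<and> s \<or> u = b \<and> t"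
  have bal: "potential_balanced (insert e3 (insert e1 (insert e2 {f12, Spoke a, Spoke b})))" if anti
  proof -
    have "compat ?\<phi> e" if "e \<in> insert e3 (insert e1 (insert e2 {f12, Spoke a, Spoke b}))" for e
      using that \<open>anti\<close> starD(2-4)[OF st] ne nv by (auto simp: f)
    then show ?thesis unfolding potential_balanced_def by blast
  qed
  let ?U = "{Some v, Some a, Some b} \<union> (if anti then {None} else {})"
  show False
  proof (rule star_contradiction[OF st K, where U = ?U and n = "if anti then 4 else 3"])
    show "span_verts (insert e3 (insert e1 (insert e2 {f12, Spoke a, Spoke b}))) \<subseteq> ?U"
      by (auto simp: span_verts_def en f)
  qed (use 1 2 3 nv bal ne in \<open>auto simp: f card_insert_if slack_def\<close>)
qed

text \<open>Antisymmetrically \<open>Wild a i\<close> is blocked for every \<open>i\<close>; two of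
  them make 5 edges on \<open>v\<close>, \<open>a\<close> and the ground, more than
  \<open>2 * 3 - 2\<close>. Symmetrically \<open>Spoke a\<close> makes 4 edges on \<open>v\<close>
  and \<open>a\<close>, more than \<open>2 * 2 - 1\<close>.\<close>

lemma extend_antipodal_centre:
  assumes st: "star E v e1 (To a s) e2 (To a (\<not> s)) e3 Centre"
  shows "\<exists>c. onto c (insert e1 (insert e2 (insert e3 E)))"
proof (rule ccontr)
  assume no: "\<nexists>c. onto c (insert e1 (insert e2 (insert e3 E)))"
  have nv: "a \<noteq> v" using starD(2-4)[OF st] by auto
  have en: "ends e1 = {Some v, Some a}" "ends e2 = {Some v, Some a}" "e3 = Spoke v"
    using starD(2-4)[OF st] by auto
  have arms: "arm_of v (To a s) e1" "arm_of v (To a (\<not> s)) e2" "arm_of v Centre e3"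
    and av: "\<And>e. e \<in> E \<Longrightarrow> Some v \<notin> ends e"
    using starD(2-4,5,7)[OF st] starD(1)[OF st] by simp_all
  show False
  proof (cases anti)
    case True
    have W: "Wild a i \<in> E \<or> \<not> sparse (insert (Wild a i) E)" for i
      by (rule star_blocked[OF st no]) (use True nv en extend_antipodal_centre_anti[OF True star_finite[OF st] _ _ av arms] in auto)
    have K: "sparse {Wild a 0, Wild a 1}"
      by (rule sparse_insert_two[OF sparse_empty, of a "Free_dir 0" _ "Free_dir 1"]) (use True in auto)
    show False
    proof (rule star_contradiction[OF st K, where n = 3])
      show "span_verts (insert e3 (insert e1 (insert e2 {Wild a 0, Wild a 1}))) \<subseteq> {Some v, Some a, None}"
        by (auto simp: span_verts_def en)
    qed (use W True nv in \<open>auto simp: card_insert_if slack_def\<close>)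
  next
    case False
    have S: "Spoke a \<in> E \<or> \<not> sparse (insert (Spoke a) E)"
      by (rule star_blocked[OF st no]) (use False nv en extend_antipodal_centre_sym[OF False _ _ av arms] in auto)
    have K: "sparse {Spoke a}" by (rule sparse_singleton[of a Centre]) auto
    show False
    proof (rule star_contradiction[OF st K, where n = 2])
      show "span_verts (insert e3 (insert e1 (insert e2 {Spoke a}))) \<subseteq> {Some v, Some a}"
        using False by (auto simp: span_verts_def en)
    qed (use S False nv in \<open>auto simp: card_insert_if slack_def\<close>)
  qed
qed

text \<open>Each neighbouring free vertex of \<open>v\<close> carries two blocked wild rows, which
  pin it to the ground. With one such neighbour 5 edges exceed \<open>2 * 3 - 2\<close>, with two 7
  edges exceed \<open>2 * 4 - 2\<close>.\<close>

lemma extend_wild: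
  assumes st: "star E v e1 (To a s) e2 r e3 (Free_dir i)"
  shows "\<exists>c. onto c (insert e1 (insert e2 (insert e3 E)))"
proof (rule ccontr)
  assume no: "\<nexists>c. onto c (insert e1 (insert e2 (insert e3 E)))"
  have nv: "a \<noteq> v" using starD(2-4)[OF st] by auto
  have en: "ends e1 = {Some v, Some a}" "e3 = Wild v i" using starD(2-4)[OF st] by auto
  have A: anti using starD(4,10)[OF st] by auto
  have arms: "arm_of v (To a s) e1" "arm_of v r e2" "arm_of v (Free_dir i) e3" "r \<noteq> To a s" "r \<noteq> Free_dir i"
    and av: "\<And>e. e \<in> E \<Longrightarrow> Some v \<notin> ends e"
    using starD(2-4,5,7)[OF st] starD(1)[OF st] by simp_all
  have W: "Wild a j \<in> E \<or> \<not> sparse (insert (Wild a j) E)" for j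
    by (rule star_blocked[OF st no]) (use A nv en extend_free_direction[OF A star_finite[OF st] _ _ av arms] in auto)
  have K: "sparse {Wild a 0, Wild a 1}"
    by (rule sparse_insert_two[OF sparse_empty, of a "Free_dir 0" _ "Free_dir 1"]) (use A in auto)
  show False
  proof (cases "\<exists>b t. r = To b t \<and> b \<noteq> a")
    case True
    then obtain b t where r: "r = To b t" "b \<noteq> a" by blast
    have nb: "b \<noteq> v" using arms r by auto
    have en2: "ends e2 = {Some v, Some b}" using arms r by auto
    have no': "\<nexists>c. onto c (insert e2 (insert e1 (insert e3 E)))" unfolding insert_rotations(3)[of e2 e1 e3] by (fact no)
    have W': "Wild b j \<in> E \<or> \<not> sparse (insert (Wild b j) E)" for j
      using arms r
      by (intro star_blocked[OF star_swap12[OF st] no'])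
        (use A nb en en2 extend_free_direction[OF A star_finite[OF st] _ _ av _ arms(1,3)] in auto)
    have K': "sparse {Wild b 0, Wild b 1, Wild a 0, Wild a 1}"
      by (rule sparse_insert_two[OF K, of b "Free_dir 0" _ "Free_dir 1"]) (use A r in auto)
    show False
    proof (rule star_contradiction[OF st K', where n = 4])
      show "span_verts (insert e3 (insert e1 (insert e2 {Wild b 0, Wild b 1, Wild a 0, Wild a 1})))
          \<subseteq> {Some v, Some a, Some b, None}"
        by (auto simp: span_verts_def en en2)
    qed (use W W' A nv nb r in \<open>auto simp: card_insert_if slack_def\<close>)
  next
    case False
    then have "ends e2 \<subseteq> {Some v, Some a, None}" using arms(2) by (cases r) auto
    show False
    proof (rule star_contradiction[OF st K, where n = 3])
      show "span_verts (insert e3 (insert e1 (insert e2 {Wild a 0, Wild a 1}))) \<subseteq> {Some v, Some a, None}"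
        using \<open>ends e2 \<subseteq> {Some v, Some a, None}\<close> by (auto simp: span_verts_def en)
    qed (use W A nv in \<open>auto simp: card_insert_if slack_def\<close>)
  qed
qed

text \<open>Otherwise all three edges would join \<open>v\<close> to the ground, against the bound
  \<open>2 * 2 - 2\<close>; symmetrically there is only one such proper arm.\<close>

lemma star_has_vertex:
  assumes st: "star E v e1 r1 e2 r2 e3 r3"
  shows "\<exists>a s. r1 = To a s \<or> r2 = To a s \<or> r3 = To a s"
proof (rule ccontr)
  assume no: "\<not> ?thesis"
  have "anti" using starD(2-10)[OF st] no by (cases r1; cases r2; cases r3) auto
  have "\<not> sparse {e1, e2, e3}"
  proof (rule not_sparse_if_card)
    show "span_verts {e1, e2, e3} \<subseteq> {Some v, None}"
      using starD(2-10)[OF st] no by (cases r1; cases r2; cases r3) (auto simp: span_verts_def)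
    show "2 * int 2 - (if potential_balanced {e1, e2, e3} then 3 else slack) < int (card {e1, e2, e3})"
      using star_distinct[OF st] \<open>anti\<close> by (simp add: slack_def)
  qed (auto simp: card_insert_if slack_def)
  moreover have "sparse (insert e1 (insert e2 (insert e3 E)))" using starD(11)[OF st] .
  ultimately show False using sparse_subset[of _ "{e1, e2, e3}"] by blast
qed

lemma extend_by_three:
  assumes "star E v e1 r1 e2 r2 e3 r3"
  shows "\<exists>c. onto c (insert e1 (insert e2 (insert e3 E)))"
proof -
  have first: "\<exists>c. onto c (insert e1 (insert e2 (insert e3 E)))"
    if st: "star E v e1 (To a s) e2 r2 e3 r3" for e1 a s e2 r2 e3 r3
  proof -
    have st': "star E v e1 (To a s) e3 r3 e2 r2" using st by (rule star_swap23)
    have comm: "insert e1 (insert e3 (insert e2 E)) = insert e1 (insert e2 (insert e3 E))"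
      "insert e2 (insert e3 (insert e1 E)) = insert e1 (insert e2 (insert e3 E))" by blast+
    have ne: "To a s \<noteq> r2" "To a s \<noteq> r3" "r2 \<noteq> r3" using starD(5-7)[OF st] by auto
    show ?thesis
    proof (cases r2)
      case r2: (Free_dir i)
      then show ?thesis using extend_wild[of E v e1 a s e3 r3 e2 i] st' comm by auto
    next
      case r2: Centre
      show ?thesis
      proof (cases r3)
        case (Free_dir i)
        then show ?thesis using extend_wild st by auto
      next
        case r3: (To b t)
        show ?thesis
        proof (cases "a = b")
          case True
          then have "t = (\<not> s)" using ne r3 by auto
          then show ?thesis using extend_antipodal_centre[of E v e1 a s e3 e2] st' r2 r3 True comm by auto
        next
          case False
          then show ?thesis using extend_two_vertices_centre[of E v e1 a s e3 b t e2] st' r2 r3 comm by auto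
        qed
      qed (use ne r2 in auto)
    next
      case r2: (To b t)
      show ?thesis
      proof (cases r3)
        case (Free_dir i)
        then show ?thesis using extend_wild st by auto
      next
        case r3: Centre
        show ?thesis
        proof (cases "a = b")
          case True
          then have "t = (\<not> s)" using ne r2 by auto
          then show ?thesis using extend_antipodal_centre[of E v e1 a s e2 e3] st r2 r3 True by auto
        next
          case False
          then show ?thesis using extend_two_vertices_centre[of E v e1 a s e2 b t e3] st r2 r3 by auto
        qed
      next
        case r3: (To c w)
        consider "a \<noteq> b" "a \<noteq> c" "b \<noteq> c" | "a = b" "a \<noteq> c" | "a = c" "a \<noteq> b" | "b = c" "a \<noteq> b" | "a = b" "a = c"
          by blast
        then show ?thesis
        proof cases
          case 1 then show ?thesis using extend_three_vertices st r2 r3 by auto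
        next
          case 2
          then have "t = (\<not> s)" using ne r2 by auto
          then show ?thesis using extend_antipodal_vertex[of E v e1 a s e2 e3 c w] st r2 r3 2 by auto
        next
          case 3
          then have "w = (\<not> s)" using ne r3 by auto
          then show ?thesis using extend_antipodal_vertex[of E v e1 a s e3 e2 b t] st' r2 r3 3 comm by auto
        next
          case 4
          then have "w = (\<not> t)" using ne r2 r3 by auto
          then show ?thesis
            using extend_antipodal_vertex[of E v e2 b t e3 e1 a s] star_swap23[OF star_swap12[OF st]] r2 r3 4 comm by auto
        next
          case 5
          then show ?thesis using ne r2 r3 by auto
        qed
      qed
    qed
  qed
  obtain a s where "r1 = To a s \<or> r2 = To a s \<or> r3 = To a s" using star_has_vertex[OF assms] by blast
  then consider "r1 = To a s" | "r2 = To a s" | "r3 = To a s" by blast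
  then show ?thesis
  proof cases
    case 1 then show ?thesis using first assms by blast
  next
    case 2
    then have "\<exists>c. onto c (insert e2 (insert e1 (insert e3 E)))" using first star_swap12[OF assms] by blast
    then show ?thesis by (simp add: insert_commute)
  next
    case 3
    then have "\<exists>c. onto c (insert e3 (insert e1 (insert e2 E)))"
      using first star_swap12[OF star_swap23[OF assms]] by blast
    then show ?thesis by (simp add: insert_commute)
  qed
qed

text \<open>The measure counts free vertices only, so an added edge may reach the ground at no
  cost.\<close>

theorem sparse_imp_onto:
  assumes "sparse E" "\<And>e. e \<in> E \<Longrightarrow> proper e"
  shows "\<exists>c. onto c E"
  using assms
proof (induction "card {v. Some v \<in> span_verts E}" arbitrary: E rule: less_induct)
  case less
  have fE: "finite E" using less.prems sparse_finite by blast
  have fS: "finite {v. Some v \<in> span_verts F}" if "finite F" for F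
    using finite_vimageI[OF finite_span_verts[OF that], of Some] by (simp add: vimage_def)
  show ?case
  proof (cases "E = {}")
    case True then show ?thesis by (simp add: onto_def)
  next
    case False
    then obtain v where v: "Some v \<in> span_verts E" "card {e \<in> E. Some v \<in> ends e} \<le> 3"
      using low_degree_vertex less.prems(1) by blast
    define D where "D = {e \<in> E. Some v \<in> ends e}"
    define E' where "E' = E - D"
    have ED: "E = D \<union> E'" by (auto simp: E'_def D_def)
    have sE': "sparse E'" by (rule sparse_subset[OF less.prems(1)]) (auto simp: E'_def)
    have av: "\<And>e. e \<in> E' \<Longrightarrow> Some v \<notin> ends e" by (auto simp: E'_def D_def)
    have fD: "finite D" "finite E'" using fE by (auto simp: D_def E'_def)
    have IH: "\<exists>c. onto c F" if F: "sparse F" "\<And>e. e \<in> F \<Longrightarrow> proper e"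
      "span_verts F \<subseteq> insert None (span_verts E - {Some v})" for F
    proof (rule less.hyps[OF _ F(1,2)])
      show "card {u. Some u \<in> span_verts F} < card {u. Some u \<in> span_verts E}"
        using F(3) v(1) by (intro psubset_card_mono fS fE) auto
    qed
    have vE': "span_verts E' \<subseteq> insert None (span_verts E - {Some v})"
      using av by (auto simp: span_verts_def ED)
    obtain c' where c': "onto c' E'" using IH[OF sE' _ vE'] less.prems(2) ED by blast
    have arm: "\<exists>r. arm_of v r e" if "e \<in> D" for e
      using arm_exists[of e v] that less.prems(2)[of e] by (auto simp: D_def)
    have arm_ne: "r \<noteq> r'" if "e \<in> D" "e' \<in> D" "e \<noteq> e'" "arm_of v r e" "arm_of v r' e'" for e e' r r'
      using sparse_arms_distinct[OF less.prems(1) _ _ that(3,4,5)] that(1,2) by (auto simp: D_def)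
    have "D \<noteq> {}" using v(1) by (auto simp: D_def span_verts_def)
    then have "card D \<noteq> 0" using fD by simp
    then consider "card D = 1" | "card D = 2" | "card D = 3" using v(2) by (fold D_def) linarith
    then show ?thesis
    proof cases
      case 1
      then obtain e where D: "D = {e}" using card_1_singletonE by blast
      obtain r where r: "arm_of v r e" using arm D by blast
      \<comment> \<open>Degree one is padded to degree two by a wild row with another index, which
        is dropped again afterwards.\<close>
      have "r \<noteq> Free_dir 0 \<or> r \<noteq> Free_dir 1" by auto
      then obtain i where i: "r \<noteq> Free_dir i" by blast
      have "\<exists>c. onto c (insert e (insert (Wild v i) E'))"
        by (rule extend_by_two[OF fD(2) c' av r _ i]) simp_all
      moreover have "E \<subseteq> insert e (insert (Wild v i) E')" using ED D by auto
      ultimately show ?thesis using onto_subset by metis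
    next
      case 2
      then obtain e e' where D: "D = {e, e'}" "e \<noteq> e'" by (meson card_2_iff)
      obtain r r' where r: "arm_of v r e" "arm_of v r' e'" using arm D by blast
      then have "\<exists>c. onto c (insert e (insert e' E'))"
        using arm_ne D by (intro extend_by_two[OF fD(2) c' av r]) auto
      then show ?thesis using ED D by simp
    next
      case 3
      then obtain e1 e2 e3 where D: "D = {e1, e2, e3}" "e1 \<noteq> e2" "e1 \<noteq> e3" "e2 \<noteq> e3" by (metis card_3_iff)
      have e: "e1 \<in> D" "e2 \<in> D" "e3 \<in> D" using D by auto
      obtain r1 r2 r3 where r: "arm_of v r1 e1" "arm_of v r2 e2" "arm_of v r3 e3"
        using arm[OF e(1)] arm[OF e(2)] arm[OF e(3)] by metis
      have ne: "r1 \<noteq> r2" "r1 \<noteq> r3" "r2 \<noteq> r3" using arm_ne e r D(2-4) by metis+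
      have pr: "proper e1" "proper e2" "proper e3" using e less.prems(2) by (auto simp: D_def)
      have EE: "insert e1 (insert e2 (insert e3 E')) = E" using ED D by auto
      have "star E' v e1 r1 e2 r2 e3 r3"
        unfolding star_def EE
      proof (intro conjI ballI allI impI)
        fix f assume f: "proper f" "ends f \<subseteq> insert None (ends e1 \<union> ends e2 \<union> ends e3 - {Some v})"
          "sparse (insert f E')"
        show "\<exists>c. onto c (insert f E')"
        proof (rule IH[OF f(3)])
          show "span_verts (insert f E') \<subseteq> insert None (span_verts E - {Some v})"
            using f(2) vE' D by (auto simp: span_verts_def ED)
        qed (use f(1) less.prems(2) ED in auto)
      qed (use r ne pr less.prems(1) av in auto)
      then show ?thesis using extend_by_three EE by metis
    qed
  qed
qed

end

section \<open>The covering framework\<close>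

lemma functions_on_spanned:
  assumes "finite A" obtains T where "finite T" "functions_on A \<subseteq> cfun.span T"
proof -
  have "cfun.subspace (functions_on A)"
    by (auto simp: cfun.subspace_def functions_on_def scale_fun_def)
  then show ?thesis
    using edge_function_basis_exists[OF assms, of "functions_on A"] that unfolding edge_function_basis_def by blast
qed

lemma independent_family_card:
  assumes S: "S \<subseteq> functions_on A" "finite A" and I: "finite I" "\<And>i. i \<in> I \<Longrightarrow> x i \<in> S"
    and ind: "\<And>c i. \<lbrakk>\<And>e. (\<Sum>i\<in>I. c i * x i e) = 0; i \<in> I\<rbrakk> \<Longrightarrow> c i = 0"
  shows "card I \<le> cfun.dim S"
proof -
  have inj: "inj_on x I"
  proof (rule inj_onI, rule ccontr)
    fix i k assume ik: "i \<in> I" "k \<in> I" "x i = x k" "i \<noteq> k"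
    define c :: "'b \<Rightarrow> complex" where "c l = (if l = i then 1 else 0) - (if l = k then 1 else 0)" for l
    have "(\<Sum>l\<in>I. c l * x l e) = 0" for e
      using ik I by (simp add: c_def left_diff_distrib sum_subtractf if_distrib[of "\<lambda>z. z * _"] cong: if_cong)
    then show False using ind[of c i] ik by (simp add: c_def)
  qed
  have "\<not> cfun.dependent (x ` I)"
  proof
    assume "cfun.dependent (x ` I)"
    then obtain u where u: "\<exists>v\<in>x ` I. u v \<noteq> 0" "(\<Sum>v\<in>x ` I. scale_fun (u v) v) = 0"
      using cfun.dependent_finite[of "x ` I"] I by auto
    have "(\<Sum>i\<in>I. u (x i) * x i e) = 0" for e
      using fun_cong[OF u(2), of e] by (simp add: sum.reindex[OF inj] sum_fun_apply scale_fun_def)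
    then show False using ind[of "\<lambda>i. u (x i)"] u(1) by auto
  qed
  moreover obtain B where B: "B \<subseteq> S" "\<not> cfun.dependent B" "S \<subseteq> cfun.span B" "card B = cfun.dim S"
    by (rule cfun.basis_exists)
  moreover obtain T where "finite T" "functions_on A \<subseteq> cfun.span T" using functions_on_spanned[OF S(2)] .
  ultimately have "card (x ` I) \<le> card B"
    using cfun.independent_span_bound[of T B] cfun.independent_span_bound[of B "x ` I"] S I by blast
  then show ?thesis using B(4) inj by (simp add: card_image)
qed

lemma edge_form_linear:
  "edge_form p (\<lambda>u. \<Sum>k\<in>K. a k *s m k u) u v = (\<Sum>k\<in>K. a k * edge_form p (m k) u v)"
  by (simp add: edge_form_def sum_2 sum_distrib_left sum_subtractf algebra_simps flip: sum.distrib)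

lemma edge_form_config:
  "edge_form (\<lambda>u. q u + t *\<^sub>R p u) m u v = edge_form q m u v + of_real t * edge_form p m u v"
  by (simp add: edge_form_def complex_vec_def sum_2 algebra_simps)

locale half_turn_cover = gain_graph \<Gamma> G V0 \<psi>
  for \<Gamma> :: "('g, 'm) monoid_scheme" (structure) and G :: "('v, 'e) pre_digraph"
    and V0 :: "'v set" and \<psi> :: "'e \<Rightarrow> 'g" +
  fixes \<gamma> :: 'g and \<tau> :: "'g \<Rightarrow> real^2^2"
  assumes order: "order \<Gamma> = 2" and gamma: "\<gamma> \<in> carrier \<Gamma>" and gen: "generate \<Gamma> {\<gamma>} = carrier \<Gamma>"
    and hom: "\<tau> \<in> hom \<Gamma> C2_group" and inj: "inj_on \<tau> (carrier \<Gamma>)"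
begin

section \<open>The group and its representation\<close>

lemma gamma_ne: "\<gamma> \<noteq> \<one>"
proof
  assume "\<gamma> = \<one>"
  then have "carrier \<Gamma> = {\<one>}" using gen generate_one by simp
  then show False using order by (simp add: order_def)
qed

lemma carrier_eq: "carrier \<Gamma> = {\<one>, \<gamma>}"
proof -
  have "finite (carrier \<Gamma>)" using order unfolding order_def by (simp add: card_ge_0_finite)
  moreover have "{\<one>, \<gamma>} \<subseteq> carrier \<Gamma>" using gamma by simp
  moreover have "card {\<one>, \<gamma>} = card (carrier \<Gamma>)" using gamma_ne order by (simp add: order_def)
  ultimately show ?thesis using card_subset_eq by metis
qed

lemma gamma_sq: "\<gamma> \<otimes> \<gamma> = \<one>"
proof (rule ccontr)
  assume "\<gamma> \<otimes> \<gamma> \<noteq> \<one>"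
  then have "\<gamma> \<otimes> \<gamma> = \<gamma>" using carrier_eq gamma m_closed by blast
  then show False using gamma gamma_ne by (simp add: r_cancel_one')
qed

lemma C2_rotation_mult: "C2_rotation *v x = - x" "C2_rotation ** C2_rotation = mat 1" "C2_rotation \<noteq> mat 1"
  by (auto simp: C2_rotation_def cart_eq_iff matrix_vector_mult_def matrix_matrix_mult_def
      sum_2 forall_2 Finite_Cartesian_Product.mat_def)

lemma tau_one: "\<tau> \<one> = mat 1"
proof -
  have "\<tau> \<one> = \<tau> \<one> ** \<tau> \<one>" using hom_mult[OF hom, of \<one> \<one>] by (simp add: C2_group_def)
  moreover have "\<tau> \<one> \<in> {mat 1, C2_rotation}" using hom by (auto simp: hom_def C2_group_def)
  ultimately show ?thesis using C2_rotation_mult by auto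
qed

lemma tau_gamma: "\<tau> \<gamma> = C2_rotation"
proof -
  have "\<tau> \<gamma> \<in> {mat 1, C2_rotation}" using hom gamma by (auto simp: hom_def C2_group_def)
  moreover have "\<tau> \<gamma> \<noteq> \<tau> \<one>" using inj gamma gamma_ne by (auto simp: inj_on_def)
  ultimately show ?thesis using tau_one by auto
qed

lemma tau_apply: "g \<in> carrier \<Gamma> \<Longrightarrow> \<tau> g *v x = sg (g = \<one>) *\<^sub>R x"
  using carrier_eq tau_one tau_gamma gamma_ne C2_rotation_mult by auto

lemma complex_tau_apply: "g \<in> carrier \<Gamma> \<Longrightarrow> complex_mat (\<tau> g) *v z = of_real (sg (g = \<one>)) *s z"
  using carrier_eq tau_one tau_gamma gamma_ne
  by (auto simp: cart_eq_iff matrix_vector_mult_def complex_mat_def C2_rotation_def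
      sum_2 forall_2 Finite_Cartesian_Product.mat_def)

section \<open>Symmetric functions on the covering\<close>

abbreviation "CV \<equiv> cover_verts \<Gamma> G V0"
abbreviation "CE \<equiv> cover_edges \<Gamma> G V0 \<psi>"
abbreviation "SV j \<equiv> sym_motions \<Gamma> G V0 \<tau> (rho \<gamma> j)"
abbreviation "SW j \<equiv> sym_edge_functions \<Gamma> G V0 \<psi> (rho \<gamma> j)"
abbreviation "Rm \<equiv> rigidity_map CE"

text \<open>A representative of the edge orbit over \<open>e\<close>. By \<open>SW_zero\<close> a
  function in \<open>SW j\<close> is determined by its values there, so these edges stand for the
  rows of a block.\<close>

definition rep :: "'e \<Rightarrow> ('g, 'v) cover_vertex set" where
  "rep e = {lift_vertex V0 \<one> (tail G e), lift_vertex V0 (\<psi> e) (head G e)}"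

lemma lift_in_CV: "g \<in> carrier \<Gamma> \<Longrightarrow> v \<in> verts G \<Longrightarrow> lift_vertex V0 g v \<in> CV"
  by (auto simp: cover_verts_def lift_vertex_def)

lemma act_lift: "act \<Gamma> h (lift_vertex V0 g v) = lift_vertex V0 (h \<otimes> g) v"
  by (simp add: lift_vertex_def)

lemma act_CV: "g \<in> carrier \<Gamma> \<Longrightarrow> u \<in> CV \<Longrightarrow> act \<Gamma> g u \<in> CV"
  by (auto simp: cover_verts_def)

lemma act_act: "u \<in> CV \<Longrightarrow> act \<Gamma> \<gamma> (act \<Gamma> \<gamma> u) = u"
  using gamma gamma_sq by (auto simp: cover_verts_def simp flip: m_assoc)

lemma act_one: "u \<in> CV \<Longrightarrow> act \<Gamma> \<one> u = u"
  by (auto simp: cover_verts_def)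

lemma CE_eq: "CE = {act \<Gamma> h ` rep e | h e. h \<in> carrier \<Gamma> \<and> e \<in> arcs G}"
proof -
  have "{lift_vertex V0 h (tail G e), lift_vertex V0 (h \<otimes> \<psi> e) (head G e)} = act \<Gamma> h ` rep e"
    if "h \<in> carrier \<Gamma>" for h e
    using that by (simp add: rep_def act_lift)
  then show ?thesis unfolding cover_edges_def by blast
qed

lemma finite_CE: "finite CE"
proof -
  have "CE = (\<lambda>(h, e). act \<Gamma> h ` rep e) ` (carrier \<Gamma> \<times> arcs G)" by (auto simp: CE_eq)
  then show ?thesis using carrier_eq by simp
qed

lemma rep_subset: "e \<in> arcs G \<Longrightarrow> rep e \<subseteq> CV"
  by (auto simp: rep_def gain_closed intro!: lift_in_CV)

lemma rep_CE: "e \<in> arcs G \<Longrightarrow> rep e \<in> CE"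
proof -
  assume e: "e \<in> arcs G"
  then have "rep e = act \<Gamma> \<one> ` rep e" using rep_subset act_one by force
  then show ?thesis using e unfolding CE_eq by auto
qed

lemma CE_cases: assumes "f \<in> CE" obtains u v where "f = {u, v}" "u \<in> CV" "v \<in> CV"
proof -
  obtain h e where "h \<in> carrier \<Gamma>" "e \<in> arcs G" "f = act \<Gamma> h ` rep e" using assms unfolding CE_eq by blast
  then show ?thesis using rep_subset[of e] act_CV that[of "act \<Gamma> h (lift_vertex V0 \<one> (tail G e))"
      "act \<Gamma> h (lift_vertex V0 (\<psi> e) (head G e))"] by (auto simp: rep_def)
qed

lemma act_CE: assumes "f \<in> CE" shows "act \<Gamma> \<gamma> ` f \<in> CE"
proof -
  obtain h e where h: "h \<in> carrier \<Gamma>" "e \<in> arcs G" "f = act \<Gamma> h ` rep e" using assms unfolding CE_eq by blast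
  have "act \<Gamma> \<gamma> ` f = act \<Gamma> (\<gamma> \<otimes> h) ` rep e"
    using h gamma gain_closed[of e] by (simp add: rep_def act_lift flip: m_assoc)
  then show ?thesis using h gamma unfolding CE_eq by blast
qed

lemma Rm_outside: "f \<notin> CE \<Longrightarrow> Rm p m f = 0"
  by (simp add: rigidity_map_def)

lemma Rm_functions: "Rm p m \<in> functions_on CE"
  by (simp add: functions_on_def Rm_outside)

lemma Rm_linear: "Rm p (\<lambda>u. \<Sum>k\<in>K. a k *s m k u) f = (\<Sum>k\<in>K. a k * Rm p (m k) f)"
proof (cases "f \<in> CE")
  case True
  then obtain u v where "f = {u, v}" using CE_cases by metis
  then show ?thesis using True by (simp add: rigidity_map_edge edge_form_linear)
qed (simp add: Rm_outside)

lemma Rm_config: "Rm (\<lambda>u. q u + t *\<^sub>R p u) m f = Rm q m f + of_real t * Rm p m f"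
proof (cases "f \<in> CE")
  case True
  then obtain u v where "f = {u, v}" using CE_cases by metis
  then show ?thesis using True by (simp add: rigidity_map_edge edge_form_config)
qed (simp add: Rm_outside)

lemma cnj_rho: "cnj (rho \<gamma> j \<one>) = 1" "cnj (rho \<gamma> j \<gamma>) = (- 1) ^ j"
  using gamma_ne by (auto simp: rho_def)

lemma SV_iff: "m \<in> SV j \<longleftrightarrow> m \<in> functions_on CV \<and> (\<forall>u\<in>CV. m (act \<Gamma> \<gamma> u) = - ((- 1) ^ j) *s m u)"
proof -
  have "\<gamma> = \<one> \<longleftrightarrow> False" using gamma_ne by simp
  then show ?thesis unfolding sym_motions_def carrier_eq
    using act_one gamma by (auto simp: complex_tau_apply cnj_rho vector_smult_assoc)
qed

lemma SW_iff: "w \<in> SW j \<longleftrightarrow> w \<in> functions_on CE \<and> (\<forall>f\<in>CE. w (act \<Gamma> \<gamma> ` f) = (- 1) ^ j * w f)"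
proof -
  have "act \<Gamma> \<one> ` f = f" if "f \<in> CE" for f using CE_cases[OF that] act_one by (metis image_empty image_insert)
  then show ?thesis unfolding sym_edge_functions_def carrier_eq by (auto simp: cnj_rho)
qed

definition sym_pos :: "(('g, 'v) cover_vertex \<Rightarrow> real^2) \<Rightarrow> bool" where
  "sym_pos q \<longleftrightarrow> (\<forall>u\<in>CV. q (act \<Gamma> \<gamma> u) = - q u)"

lemma sym_pos_iff: "sym_pos q \<longleftrightarrow> symmetric_realisation \<Gamma> G V0 \<tau> q"
proof -
  have "\<gamma> = \<one> \<longleftrightarrow> False" using gamma_ne by simp
  then show ?thesis unfolding symmetric_realisation_def sym_pos_def carrier_eq
    using act_one gamma by (auto simp: tau_apply)
qed

lemma Rm_SW:
  assumes "sym_pos q" "m \<in> SV j" shows "Rm q m \<in> SW j"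
  unfolding SW_iff
proof (intro conjI ballI Rm_functions)
  fix f assume f: "f \<in> CE"
  then obtain u v where uv: "f = {u, v}" "u \<in> CV" "v \<in> CV" using CE_cases by metis
  have "act \<Gamma> \<gamma> ` f = {act \<Gamma> \<gamma> u, act \<Gamma> \<gamma> v}" using uv by simp
  moreover have "edge_form q m (act \<Gamma> \<gamma> u) (act \<Gamma> \<gamma> v) = (- 1) ^ j * edge_form q m u v"
    using assms uv unfolding SV_iff sym_pos_def
    by (simp add: edge_form_def complex_vec_def sum_2 algebra_simps)
  ultimately show "Rm q m (act \<Gamma> \<gamma> ` f) = (- 1) ^ j * Rm q m f"
    using f act_CE[OF f] uv by (simp add: rigidity_map_edge)
qed

lemma SW_zero:
  assumes w: "w \<in> SW j" and z: "\<And>e. e \<in> arcs G \<Longrightarrow> w (rep e) = 0" shows "w f = 0"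
proof (cases "f \<in> CE")
  case False
  then show ?thesis using w unfolding SW_iff functions_on_def by blast
next
  case True
  then obtain h e where h: "h \<in> carrier \<Gamma>" "e \<in> arcs G" "f = act \<Gamma> h ` rep e" unfolding CE_eq by blast
  show ?thesis
  proof (cases "h = \<gamma>")
    case True
    have "w (act \<Gamma> \<gamma> ` rep e) = (- 1) ^ j * w (rep e)" using w rep_CE[OF h(2)] unfolding SW_iff by blast
    then show ?thesis using True h(3) z[OF h(2)] by simp
  next
    case False
    then have "h = \<one>" using h(1) carrier_eq by blast
    moreover have "act \<Gamma> \<one> ` rep e = rep e" using rep_subset[OF h(2)] act_one by (force simp: image_iff)
    ultimately show ?thesis using z[OF h(2)] h(3) by simp
  qed
qed

lemma SV_sum: "(\<And>k. k \<in> K \<Longrightarrow> m k \<in> SV j) \<Longrightarrow> (\<lambda>u. \<Sum>k\<in>K. a k *s m k u) \<in> SV j"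
  unfolding SV_iff functions_on_def
  by (auto simp: vec.scale_sum_right vector_smult_assoc mult.commute intro!: sum.neutral sum.cong)

lemma SW_sum: "(\<And>k. k \<in> K \<Longrightarrow> w k \<in> SW j) \<Longrightarrow> (\<lambda>f. \<Sum>k\<in>K. a k * w k f) \<in> SW j"
  unfolding SW_iff functions_on_def
  by (auto simp: sum_distrib_left mult.left_commute intro!: sum.neutral sum.cong)


section \<open>The two blocks of the rigidity map\<close>

lemma SV_split:
  assumes "m \<in> functions_on CV"
  obtains m0 m1 where "m0 \<in> SV 0" "m1 \<in> SV 1" "m = (\<lambda>u. m0 u + m1 u)"
proof -
  define h where "h s u = (if u \<in> CV then (1/2) *s (m u + s *s m (act \<Gamma> \<gamma> u)) else 0)" for s u
  have eq: "h s (act \<Gamma> \<gamma> u) = s *s h s u" if "u \<in> CV" "s * s = 1" for s u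
    using that act_CV[OF gamma that(1)] act_act[OF that(1)]
    by (simp add: h_def cart_eq_iff algebra_simps)
  have "h (- 1) \<in> SV 0" "h 1 \<in> SV 1"
    unfolding SV_iff using eq by (auto simp: functions_on_def h_def)
  moreover have "m = (\<lambda>u. h (- 1) u + h 1 u)"
    using assms by (auto simp: h_def functions_on_def fun_eq_iff cart_eq_iff field_simps)
  ultimately show ?thesis using that by blast
qed

lemma Rm_add: "Rm p (\<lambda>u. m u + m' u) f = Rm p m f + Rm p m' f"
proof (cases "f \<in> CE")
  case True
  then obtain u v where "f = {u, v}" using CE_cases by metis
  then show ?thesis using True by (simp add: rigidity_map_edge edge_form_def sum_2 algebra_simps)
qed (simp add: Rm_outside)

lemma SV_functions: "m \<in> SV j \<Longrightarrow> m \<in> functions_on CV"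
  unfolding SV_iff by blast

lemma SW_opposite_zero:
  assumes "w \<in> SW i" "w' \<in> SW j" "(- 1) ^ i = - ((- 1) ^ j :: complex)" "\<And>f. w f + w' f = 0"
  shows "w f = 0" "w' f = 0"
proof -
  have "w f = 0"
  proof (cases "f \<in> CE")
    case True
    then have "w (act \<Gamma> \<gamma> ` f) = (- 1) ^ i * w f" "w' (act \<Gamma> \<gamma> ` f) = (- 1) ^ j * w' f"
      using assms(1,2) unfolding SW_iff by blast+
    then have "(- 1) ^ j * (w' f - w f) = 0" using assms(4)[of "act \<Gamma> \<gamma> ` f"] assms(3) by (simp add: algebra_simps)
    then have "w' f = w f" by simp
    then show ?thesis using assms(4)[of f] by simp
  next
    case False
    then show ?thesis using assms(1) unfolding SW_iff functions_on_def by blast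
  qed
  then show "w f = 0" "w' f = 0" using assms(4)[of f] by simp_all
qed

lemma finite_independent_in_CE:
  assumes "\<not> cfun.dependent B" "B \<subseteq> functions_on CE" shows "finite B"
proof -
  obtain T where "finite T" "functions_on CE \<subseteq> cfun.span T" using functions_on_spanned[OF finite_CE] .
  then show ?thesis using cfun.independent_span_bound[of T B] assms by blast
qed

text \<open>
  The position \<open>q + r p\<close> with generic \<open>r\<close> has the full rank of \<open>q\<close> on the block \<open>j\<close> and at least the
  rank of \<open>p\<close> on the block \<open>i\<close>, so the maximality of the total rank at \<open>p\<close> bounds the rank of
  block \<open>j\<close> at \<open>p\<close> from below.
\<close>

lemma generic_onto:
  assumes ij: "(- 1) ^ i = - ((- 1) ^ j :: complex)" "{i, j} = {0, 1}"
    and p: "sym_pos p" and generic: "\<And>q. sym_pos q \<Longrightarrow> rigidity_rank CV CE q \<le> rigidity_rank CV CE p"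
    and q: "sym_pos q" and m: "\<And>a. a \<in> arcs G \<Longrightarrow> m a \<in> SV j"
      "\<And>a e. a \<in> arcs G \<Longrightarrow> e \<in> arcs G \<Longrightarrow> Rm q (m a) (rep e) = (if e = a then 1 else 0)"
  shows "\<exists>n. (\<forall>a\<in>arcs G. n a \<in> SV j) \<and>
    (\<forall>a\<in>arcs G. \<forall>e\<in>arcs G. Rm p (n a) (rep e) = (if e = a then 1 else 0))"
proof -
  obtain B where B: "B \<subseteq> Rm p ` SV i" "\<not> cfun.dependent B" "Rm p ` SV i \<subseteq> cfun.span B"
    by (rule cfun.basis_exists)
  obtain B1 where B1: "B1 \<subseteq> Rm p ` SV j" "\<not> cfun.dependent B1" "Rm p ` SV j \<subseteq> cfun.span B1"
    by (rule cfun.basis_exists)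
  have fB: "finite B" "finite B1"
    using finite_independent_in_CE B(1,2) B1(1,2) Rm_functions by blast+
  have "\<forall>b\<in>B. \<exists>m\<in>SV i. Rm p m = b" using B(1) by blast
  then obtain n0 where n0: "\<And>b. b \<in> B \<Longrightarrow> n0 b \<in> SV i" "\<And>b. b \<in> B \<Longrightarrow> Rm p (n0 b) = b" by metis
  have "\<forall>b\<in>B1. \<exists>m\<in>SV j. Rm p m = b" using B1(1) by blast
  then obtain n1 where n1: "\<And>b. b \<in> B1 \<Longrightarrow> n1 b \<in> SV j" "\<And>b. b \<in> B1 \<Longrightarrow> Rm p (n1 b) = b" by metis
  \<comment> \<open>Extending \<open>B\<close> to a basis of all functions turns the coordinates
    with respect to \<open>B\<close> into linear functionals that also apply to images at other
    positions.\<close>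
  define E0 where "E0 = cfun.extend_basis B"
  have E0: "B \<subseteq> E0" "\<not> cfun.dependent E0" "cfun.span E0 = UNIV"
    unfolding E0_def using B(2) cfun.extend_basis_superset cfun.independent_extend_basis cfun.span_extend_basis by blast+
  define coord where "coord b w = cfun.representation E0 w b" for b w
  have lin: "coord b (\<lambda>f. \<Sum>k\<in>K. a k * w k f) = (\<Sum>k\<in>K. a k * coord b (w k))" for b K and a :: "'k \<Rightarrow> complex" and w
  proof -
    have "(\<lambda>f. \<Sum>k\<in>K. a k * w k f) = (\<Sum>k\<in>K. scale_fun (a k) (w k))"
      by (simp add: fun_eq_iff sum_fun_apply scale_fun_def)
    then show ?thesis
      unfolding coord_def using E0(2,3) by (simp add: cfun.representation_sum cfun.representation_scale)
  qed
  have coord_zero: "coord b (\<lambda>f. 0) = 0" for b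
    unfolding coord_def zero_fun_def[symmetric] by (simp add: cfun.representation_zero)
  have lin2: "coord b (\<lambda>f. x f + s * y f) = coord b x + s * coord b y" for b x y s
  proof -
    have "(\<lambda>f. x f + s * y f) = x + scale_fun s y" by (simp add: fun_eq_iff scale_fun_def)
    then show ?thesis
      unfolding coord_def using E0(2,3) by (simp add: cfun.representation_add cfun.representation_scale)
  qed
  have coord_basis: "coord b k = (if k = b then 1 else 0)" if "k \<in> B" for b k
    unfolding coord_def using cfun.representation_basis[OF E0(2), of k] that E0(1) by auto
  \<comment> \<open>At \<open>q + r p\<close> the coordinates of the images of \<open>n0\<close>
    form the matrix at \<open>q\<close> plus \<open>r\<close> times the identity. For
    \<open>m\<close>, which is dual at \<open>q\<close>, the matrix is the identity plus
    \<open>r\<close> times the matrix at \<open>p\<close>; dividing by \<open>r\<close> gives the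
    form in \<open>bad2\<close>, with \<open>inverse r\<close> as parameter.\<close>
  define bad1 where "bad1 = {s. \<not> (\<forall>w. \<exists>c. \<forall>b\<in>B. (\<Sum>k\<in>B. coord b (Rm q (n0 k)) * c k) + s * c b = w b)}"
  define bad2 where
    "bad2 = {s. \<not> (\<forall>w. \<exists>c. \<forall>e\<in>arcs G. (\<Sum>a\<in>arcs G. Rm p (m a) (rep e) * c a) + s * c e = w e)}"
  have "finite bad1" unfolding bad1_def by (rule finite_not_solvable[OF fB(1)])
  moreover have "finite bad2" unfolding bad2_def by (rule finite_not_solvable[OF finite_arcs])
  ultimately have "finite ((of_real :: real \<Rightarrow> complex) -` bad1)" "finite ((\<lambda>r. inverse (of_real r :: complex)) -` bad2)"
    by (auto intro!: finite_vimageI inj_onI)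
  then obtain r :: real where "r \<notin> of_real -` bad1 \<union> (\<lambda>r. inverse (of_real r :: complex)) -` bad2 \<union> {0}"
    using ex_new_if_finite[OF infinite_UNIV_char_0] by (metis finite.emptyI finite.insertI finite_UnI)
  then have r: "r \<noteq> 0" "of_real r \<notin> bad1" "inverse (of_real r) \<notin> bad2" by auto
  have s1: "\<exists>c. \<forall>b\<in>B. (\<Sum>k\<in>B. coord b (Rm q (n0 k)) * c k) + of_real r * c b = w b" for w
    using r(2) unfolding bad1_def mem_Collect_eq not_not by (rule spec)
  have s2: "\<exists>c. \<forall>e\<in>arcs G. (\<Sum>a\<in>arcs G. Rm p (m a) (rep e) * c a) + inverse (of_real r) * c e = w e" for w
    using r(3) unfolding bad2_def mem_Collect_eq not_not by (rule spec)
  define qr where "qr = (\<lambda>u. q u + r *\<^sub>R p u)"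
  have qr: "sym_pos qr" using p q by (simp add: sym_pos_def qr_def)
  have Rqr: "Rm qr x f = Rm q x f + of_real r * Rm p x f" for x f
    unfolding qr_def by (rule Rm_config)
  have "\<exists>N\<in>SV i. \<forall>b\<in>B. coord b (Rm qr N) = (if b = b' then 1 else 0)" for b'
  proof -
    obtain c where c: "\<And>b. b \<in> B \<Longrightarrow> (\<Sum>k\<in>B. coord b (Rm q (n0 k)) * c k) + of_real r * c b = (if b = b' then 1 else 0)"
      using s1[of "\<lambda>b. if b = b' then 1 else 0"] by blast
    define N where "N = (\<lambda>u. \<Sum>k\<in>B. c k *s n0 k u)"
    have "N \<in> SV i" unfolding N_def using n0(1) by (rule SV_sum)
    moreover have "coord b (Rm qr N) = (if b = b' then 1 else 0)" if b: "b \<in> B" for b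
    proof -
      have "Rm qr N = (\<lambda>f. (\<Sum>k\<in>B. c k * Rm q (n0 k) f) + of_real r * (\<Sum>k\<in>B. c k * k f))"
        by (simp add: fun_eq_iff Rqr N_def Rm_linear n0(2) distrib_left sum.distrib sum_distrib_left mult.left_commute)
      then have "coord b (Rm qr N) = (\<Sum>k\<in>B. c k * coord b (Rm q (n0 k))) + of_real r * (\<Sum>k\<in>B. c k * coord b k)"
        by (simp only: lin2 lin)
      also have "(\<Sum>k\<in>B. c k * coord b k) = c b"
        using b fB(1) by (simp add: coord_basis if_distrib cong: if_cong sum.cong)
      finally show ?thesis using c[OF b] by (simp add: mult.commute)
    qed
    ultimately show ?thesis by blast
  qed
  then obtain N where N: "\<And>b'. N b' \<in> SV i" "\<And>b b'. b \<in> B \<Longrightarrow> coord b (Rm qr (N b')) = (if b = b' then 1 else 0)"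
    by metis
  have "\<exists>M\<in>SV j. \<forall>e\<in>arcs G. Rm qr M (rep e) = (if e = a then 1 else 0)" for a
  proof -
    obtain c where c: "\<And>e. e \<in> arcs G \<Longrightarrow> (\<Sum>a\<in>arcs G. Rm p (m a) (rep e) * c a) + inverse (of_real r) * c e
        = (if e = a then inverse (of_real r) else 0)"
      using s2[of "\<lambda>e. if e = a then inverse (of_real r) else 0"] by blast
    define M where "M = (\<lambda>u. \<Sum>k\<in>arcs G. c k *s m k u)"
    have "M \<in> SV j" unfolding M_def using m(1) by (rule SV_sum)
    moreover have "Rm qr M (rep e) = (if e = a then 1 else 0)" if e: "e \<in> arcs G" for e
    proof -
      have "Rm qr M (rep e) = (\<Sum>k\<in>arcs G. c k * (if e = k then 1 else 0)) + of_real r * (\<Sum>k\<in>arcs G. c k * Rm p (m k) (rep e))"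
        using e by (simp add: Rqr M_def Rm_linear m(2) distrib_left sum.distrib sum_distrib_left mult.left_commute)
      also have "(\<Sum>k\<in>arcs G. c k * (if e = k then 1 else 0)) = c e"
        using e finite_arcs by (simp add: if_distrib cong: if_cong)
      also have "(\<Sum>k\<in>arcs G. c k * Rm p (m k) (rep e)) = (if e = a then inverse (of_real r) else 0) - inverse (of_real r) * c e"
        using c[OF e] by (simp add: algebra_simps mult.commute)
      finally show ?thesis using r(1) by (cases "e = a") (simp_all add: field_simps)
    qed
    ultimately show ?thesis by blast
  qed
  then obtain M where M: "\<And>a. M a \<in> SV j" "\<And>a e. e \<in> arcs G \<Longrightarrow> Rm qr (M a) (rep e) = (if e = a then 1 else 0)"
    by metis
  have card_le: "card B + card (arcs G) \<le> rigidity_rank CV CE qr"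
  proof -
    define I where "I = Inl ` B \<union> Inr ` arcs G"
    define x where "x = case_sum (\<lambda>b. Rm qr (N b)) (\<lambda>a. Rm qr (M a))"
    have fI: "finite I" by (simp add: I_def fB finite_arcs)
    have sumI: "(\<Sum>l\<in>I. g l) = (\<Sum>b\<in>B. g (Inl b)) + (\<Sum>a\<in>arcs G. g (Inr a))" for g :: "_ \<Rightarrow> complex"
      unfolding I_def by (subst sum.union_disjoint) (auto simp: fB finite_arcs sum.reindex)
    have "card I = card B + card (arcs G)"
      unfolding I_def by (subst card_Un_disjoint) (auto simp: fB finite_arcs card_image)
    moreover have "card I \<le> cfun.dim (Rm qr ` functions_on CV)"
    proof (rule independent_family_card[OF _ finite_CE fI, of _ x])
      show "Rm qr ` functions_on CV \<subseteq> functions_on CE" using Rm_functions by blast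
      show "x l \<in> Rm qr ` functions_on CV" if "l \<in> I" for l
        using N(1)[THEN SV_functions] M(1)[THEN SV_functions] by (cases l) (auto simp: x_def intro!: imageI)
      fix c l assume zero: "\<And>f. (\<Sum>l\<in>I. c l * x l f) = 0" and l: "l \<in> I"
      define w where "w = (\<lambda>f. \<Sum>b\<in>B. c (Inl b) * Rm qr (N b) f)"
      define w' where "w' = (\<lambda>f. \<Sum>a\<in>arcs G. c (Inr a) * Rm qr (M a) f)"
      \<comment> \<open>A relation splits into one in each block; the first is tested by
        \<open>coord\<close>, the second by the values at representatives.\<close>
      have "w \<in> SW i" "w' \<in> SW j"
        unfolding w_def w'_def using Rm_SW[OF qr] N(1) M(1) by (auto intro!: SW_sum)
      moreover have "w f + w' f = 0" for f using zero[of f] by (simp add: sumI x_def w_def w'_def)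
      ultimately have "w = (\<lambda>f. 0)" "\<And>f. w' f = 0" using SW_opposite_zero ij(1) by blast+
      show "c l = 0"
      proof (cases l)
        case (Inl b)
        then have b: "b \<in> B" using l by (auto simp: I_def)
        have "coord b w = (\<Sum>k\<in>B. c (Inl k) * (if b = k then 1 else 0))" unfolding w_def lin using b by (simp add: N(2))
        also have "\<dots> = c (Inl b)" using b fB(1) by (simp add: if_distrib cong: if_cong)
        finally show ?thesis using coord_zero \<open>w = (\<lambda>f. 0)\<close> Inl by simp
      next
        case (Inr a)
        then have a: "a \<in> arcs G" using l by (auto simp: I_def)
        have "w' (rep a) = (\<Sum>k\<in>arcs G. c (Inr k) * (if a = k then 1 else 0))" unfolding w'_def using a by (simp add: M(2))
        also have "\<dots> = c (Inr a)" using a finite_arcs by (simp add: if_distrib cong: if_cong)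
        finally show ?thesis using \<open>\<And>f. w' f = 0\<close> Inr by simp
      qed
    qed
    ultimately show ?thesis by (simp add: rigidity_rank_def)
  qed
  have "Rm p ` functions_on CV \<subseteq> cfun.span (B \<union> B1)"
  proof (rule image_subsetI)
    fix x :: "('g, 'v) cover_vertex \<Rightarrow> complex^2" assume "x \<in> functions_on CV"
    then obtain m0 m1 where mm: "m0 \<in> SV 0" "m1 \<in> SV 1" "x = (\<lambda>u. m0 u + m1 u)" by (rule SV_split)
    have "Rm p y \<in> cfun.span (B \<union> B1)" if "y \<in> SV i \<or> y \<in> SV j" for y
      using that B(3) B1(3) cfun.span_mono[of B "B \<union> B1"] cfun.span_mono[of B1 "B \<union> B1"] by blast
    moreover have "m0 \<in> SV i \<or> m0 \<in> SV j" "m1 \<in> SV i \<or> m1 \<in> SV j"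
      using mm(1,2) ij(2) by (auto simp: doubleton_eq_iff)
    ultimately have "Rm p m0 \<in> cfun.span (B \<union> B1)" "Rm p m1 \<in> cfun.span (B \<union> B1)" by blast+
    then have "Rm p m0 + Rm p m1 \<in> cfun.span (B \<union> B1)" by (rule cfun.span_add)
    moreover have "Rm p x = Rm p m0 + Rm p m1" unfolding mm(3) by (simp add: fun_eq_iff Rm_add)
    ultimately show "Rm p x \<in> cfun.span (B \<union> B1)" by simp
  qed
  then have "rigidity_rank CV CE p \<le> card (B \<union> B1)"
    unfolding rigidity_rank_def using fB by (intro cfun.dim_le_card) auto
  also have "\<dots> \<le> card B + card B1" by (rule card_Un_le)
  \<comment> \<open>Genericity compares the upper bound \<open>|B| + |B1|\<close> for the rank at
    \<open>p\<close> with the lower bound \<open>|B| + |arcs G|\<close> at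
    \<open>q + r p\<close>.\<close>
  finally have "card (arcs G) \<le> card B1" using card_le generic[OF qr] by linarith
  then obtain B2 where B2: "B2 \<subseteq> B1" "card B2 = card (arcs G)" by (meson obtain_subset_with_card_n)
  have fB2: "finite B2" using B2 fB(2) finite_subset by blast
  have ind2: "\<not> cfun.dependent B2" using B1(2) B2(1) cfun.dependent_mono by blast
  \<comment> \<open>Evaluation at the representatives is injective on \<open>SW j\<close>, so
    \<open>|arcs G|\<close> independent images have a regular matrix of values.\<close>
  have solve: "\<exists>c. \<forall>e\<in>arcs G. (\<Sum>b\<in>B2. b (rep e) * c b) = w e" for w
  proof (rule square_inj_imp_onto[OF finite_arcs fB2 B2(2)[symmetric]])
    fix c b assume z: "\<And>e. e \<in> arcs G \<Longrightarrow> (\<Sum>b\<in>B2. b (rep e) * c b) = 0" and b: "b \<in> B2"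
    have "(\<lambda>f. \<Sum>b\<in>B2. c b * b f) \<in> SW j"
    proof (rule SW_sum)
      fix b assume "b \<in> B2"
      then show "b \<in> SW j" using B2(1) n1 Rm_SW[OF p] by (metis subsetD)
    qed
    then have "(\<Sum>b\<in>B2. c b * b f) = 0" for f
      using SW_zero[of "\<lambda>f. \<Sum>b\<in>B2. c b * b f"] z by (simp add: mult.commute)
    then have "(\<Sum>b\<in>B2. scale_fun (c b) b) = 0" by (simp add: fun_eq_iff sum_fun_apply scale_fun_def)
    then show "c b = 0" using ind2 cfun.dependent_finite[OF fB2] b by blast
  qed
  have "\<exists>n\<in>SV j. \<forall>e\<in>arcs G. Rm p n (rep e) = (if e = a then 1 else 0)" for a
  proof -
    obtain c where c: "\<forall>e\<in>arcs G. (\<Sum>b\<in>B2. b (rep e) * c b) = (if e = a then 1 else 0)"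
      using solve[of "\<lambda>e. if e = a then 1 else 0"] by blast
    define n where "n = (\<lambda>u. \<Sum>b\<in>B2. c b *s n1 b u)"
    have "n \<in> SV j" unfolding n_def using n1(1) B2(1) by (intro SV_sum) blast
    moreover have "Rm p n (rep e) = (\<Sum>b\<in>B2. b (rep e) * c b)" for e
      unfolding n_def Rm_linear by (intro sum.cong) (use n1(2) B2(1) in \<open>auto simp: mult.commute\<close>)
    ultimately show ?thesis using c by (intro bexI[of _ n]) simp_all
  qed
  then show ?thesis by metis
qed

end

section \<open>Tight gain graphs\<close>

locale half_turn_problem = half_turn_cover \<Gamma> G V0 \<psi> \<gamma> \<tau> + half_turn_rows parity
  for \<Gamma> :: "('g, 'm) monoid_scheme" (structure) and G :: "('v, 'e) pre_digraph"
    and V0 :: "'v set" and \<psi> :: "'e \<Rightarrow> 'g" and \<gamma> \<tau> and parity :: nat +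
  assumes V0_card: "card V0 \<le> 1" and parity: "parity = 0 \<or> parity = 1"
    and tight: "gain_tight \<Gamma> G V0 \<psi> (2 * int parity) (1 + int parity)"
begin

lemma finite_V0: "finite V0"
  using fixed_verts finite_verts by (rule finite_subset)

lemma V0_unique: "u \<in> V0 \<Longrightarrow> v \<in> V0 \<Longrightarrow> u = v"
  using V0_card finite_V0 by (metis card_le_Suc0_iff_eq One_nat_def)

lemma not_both_fixed: "e \<in> arcs G \<Longrightarrow> tail G e \<in> V0 \<Longrightarrow> head G e \<notin> V0"
  using V0_unique fixed_no_loop by metis

lemma slack_eq: "slack = 1 + int parity"
  using parity unfolding slack_def anti_def by auto

section \<open>From gain sparsity to sparse constraint sets\<close>

definition arc_subgraph :: "'e set \<Rightarrow> ('v, 'e) pre_digraph" where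
  "arc_subgraph A = \<lparr>verts = tail G ` A \<union> head G ` A, arcs = A, tail = tail G, head = head G\<rparr>"

lemma arc_subgraph_simps [simp]: "verts (arc_subgraph A) = tail G ` A \<union> head G ` A"
  "arcs (arc_subgraph A) = A" "tail (arc_subgraph A) = tail G" "head (arc_subgraph A) = head G"
  by (simp_all add: arc_subgraph_def)

lemma arc_subgraph: "A \<subseteq> arcs G \<Longrightarrow> subgraph (arc_subgraph A) G"
  unfolding subgraph_def compatible_def by (auto intro!: wf_digraph.intro simp: wf_digraph_axioms)

lemma sparse_count:
  assumes "A \<subseteq> arcs G" "A \<noteq> {}"
  shows "int (card A) \<le> 2 * int (card (verts (arc_subgraph A) - V0))
    + 2 * int parity * int (card (verts (arc_subgraph A) \<inter> V0)) - (1 + int parity)"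
    and "balanced \<Gamma> V0 \<psi> (arc_subgraph A) \<Longrightarrow> int (card A) \<le> 2 * int (card (verts (arc_subgraph A))) - 3"
proof -
  have s: "gain_sparse \<Gamma> G V0 \<psi> (2 * int parity) (1 + int parity)" using tight unfolding gain_tight_def by blast
  show "int (card A) \<le> 2 * int (card (verts (arc_subgraph A) - V0))
    + 2 * int parity * int (card (verts (arc_subgraph A) \<inter> V0)) - (1 + int parity)"
    using s[unfolded gain_sparse_def, THEN conjunct2, rule_format, of "arc_subgraph A"] arc_subgraph[OF assms(1)] assms(2)
    by (simp del: arc_subgraph_simps(1))
  show "int (card A) \<le> 2 * int (card (verts (arc_subgraph A))) - 3" if "balanced \<Gamma> V0 \<psi> (arc_subgraph A)"
    using s[unfolded gain_sparse_def, THEN conjunct1, rule_format, of "arc_subgraph A"] arc_subgraph[OF assms(1)] assms(2) that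
    by (simp del: arc_subgraph_simps(1))
qed

text \<open>A single loop would violate the bound \<open>2 * 1 - 2\<close>.\<close>

lemma anti_no_loop: "anti \<Longrightarrow> e \<in> arcs G \<Longrightarrow> tail G e \<noteq> head G e"
proof
  assume "anti" and e: "e \<in> arcs G" and loop: "tail G e = head G e"
  then have "parity = 1" by (simp add: anti_def)
  moreover have "head G e \<notin> V0" using fixed_no_loop[OF e loop] loop by simp
  then have "{head G e} - V0 = {head G e}" "{head G e} \<inter> V0 = {}" by auto
  ultimately show False using sparse_count(1)[of "{e}"] e by (simp add: loop)
qed

text \<open>A loop joins \<open>p(v)\<close> to \<open>-p(v)\<close>; in the symmetric case its row
  is a multiple of the row of an edge from \<open>v\<close> to the origin, so both get the label
  \<open>Spoke\<close>.\<close>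

definition lab :: "'e \<Rightarrow> 'v constraint" where
  "lab e = (if tail G e = head G e \<or> head G e \<in> V0 then Spoke (tail G e)
    else if tail G e \<in> V0 then Spoke (head G e) else Link (tail G e) (head G e) (\<psi> e = \<one>))"

lemma proper_lab: "proper (lab e)"
  by (simp add: lab_def)

lemma gain_eqI: "e \<in> arcs G \<Longrightarrow> f \<in> arcs G \<Longrightarrow> (\<psi> e = \<one>) = (\<psi> f = \<one>) \<Longrightarrow> \<psi> e = \<psi> f"
  using gain_closed[of e] gain_closed[of f] carrier_eq by auto

text \<open>The two edges would share a label. Together they span one free vertex and the fixed one,
  and 2 exceeds the symmetric bound \<open>2 * 1 - 1\<close>.\<close>

lemma loop_fixed_parallel_free:
  assumes "e \<in> arcs G" "f \<in> arcs G" "tail G e = head G e" "tail G f \<in> V0 \<or> head G f \<in> V0"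
    "tail G e = tail G f \<or> tail G e = head G f"
  shows False
proof -
  have "\<not> anti" using anti_no_loop assms by blast
  then have p0: "parity = 0" using parity by (simp add: anti_def)
  have ne: "e \<noteq> f" using assms fixed_no_loop by metis
  have nf: "tail G e \<notin> V0" using fixed_no_loop assms by blast
  obtain v0 where v0: "v0 \<in> V0" "{tail G f, head G f} = {tail G e, v0}"
    using assms(4,5) nf by (metis insert_commute)
  have "verts (arc_subgraph {e, f}) = {tail G e, head G e} \<union> {tail G f, head G f}" by auto
  then have v0: "v0 \<in> V0" "verts (arc_subgraph {e, f}) = {tail G e, v0}" using v0 assms(3) by auto
  then have "verts (arc_subgraph {e, f}) - V0 = {tail G e}" using nf by auto
  then show False using sparse_count(1)[of "{e, f}"] assms(1,2) ne p0 by (simp del: arc_subgraph_simps)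
qed

lemma lab_inj: "inj_on lab (arcs G)"
proof (rule inj_onI, rule ccontr)
  fix e f assume e: "e \<in> arcs G" and f: "f \<in> arcs G" and eq: "lab e = lab f" and ne: "e \<noteq> f"
  define fixed_arc where "fixed_arc e \<longleftrightarrow> tail G e \<in> V0 \<or> head G e \<in> V0" for e
  define is_loop where "is_loop e \<longleftrightarrow> tail G e = head G e" for e
  have loop_gain: "\<psi> a = \<gamma>" if "a \<in> arcs G" "is_loop a" for a
    using gain_loop[of a] gain_closed[of a] that carrier_eq by (auto simp: is_loop_def)
  have lf: "\<not> (is_loop a \<and> fixed_arc a)" if "a \<in> arcs G" for a
    using fixed_no_loop[of a] that by (auto simp: is_loop_def fixed_arc_def)
  consider (ll) "is_loop e" "is_loop f" | (lf) "is_loop e" "fixed_arc f" | (fl) "fixed_arc e" "is_loop f"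
    | (ff) "fixed_arc e" "fixed_arc f" | (link) "\<not> is_loop e" "\<not> fixed_arc e" "\<not> is_loop f" "\<not> fixed_arc f"
    using eq unfolding lab_def is_loop_def fixed_arc_def by (auto split: if_splits)
  then show False
  proof cases
    case ll
    then have "tail G e = tail G f" "head G e = head G f"
      using eq unfolding lab_def is_loop_def by auto
    then show False using gain_parallel[OF e f ne] loop_gain e f ll by auto
  next
    case lf
    then have "tail G e = tail G f \<or> tail G e = head G f"
      using eq unfolding lab_def is_loop_def by (auto split: if_splits)
    then show False using loop_fixed_parallel_free[OF e f] lf by (auto simp: is_loop_def fixed_arc_def)
  next
    case fl
    then have "tail G f = tail G e \<or> tail G f = head G e"
      using eq unfolding lab_def is_loop_def by (auto split: if_splits)
    then show False using loop_fixed_parallel_free[OF f e] fl by (auto simp: is_loop_def fixed_arc_def)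
  next
    case ff
    have "{tail G e, head G e} = {tail G f, head G f}"
      using ff eq not_both_fixed[OF e] not_both_fixed[OF f] V0_unique lf[OF e] lf[OF f]
      unfolding lab_def fixed_arc_def is_loop_def by (auto split: if_splits)
    then show False using fixed_no_parallel[OF e f ne] ff(1) by (auto simp: fixed_arc_def)
  next
    case link
    then have "tail G e = tail G f" "head G e = head G f" "(\<psi> e = \<one>) = (\<psi> f = \<one>)"
      using eq unfolding lab_def is_loop_def fixed_arc_def by auto
    then show False using gain_parallel[OF e f ne] gain_eqI[OF e f] by blast
  qed
qed

lemma Some_ends_lab:
  assumes "e \<in> arcs G" shows "Some w \<in> ends (lab e) \<longleftrightarrow> (w = tail G e \<or> w = head G e) \<and> w \<notin> V0"
  using not_both_fixed[OF assms] fixed_no_loop[OF assms] by (auto simp: lab_def)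

lemma None_ends_lab:
  assumes "e \<in> arcs G" shows "None \<in> ends (lab e) \<longleftrightarrow> anti \<and> (tail G e \<in> V0 \<or> head G e \<in> V0)"
  using anti_no_loop[OF _ assms] by (auto simp: lab_def)

lemma mult_one_iff: "g \<in> carrier \<Gamma> \<Longrightarrow> h \<in> carrier \<Gamma> \<Longrightarrow> g \<otimes> h = \<one> \<longleftrightarrow> (g = \<one> \<longleftrightarrow> h = \<one>)"
  using gamma_ne gamma_sq gamma by (auto simp: carrier_eq)

lemma inv_self: "g \<in> carrier \<Gamma> \<Longrightarrow> inv g = g"
  using gamma_sq gamma inv_equality[of \<gamma> \<gamma>] by (auto simp: carrier_eq)

lemma compat_link:
  assumes "e \<in> arcs G" "compat \<phi> (lab e)" "tail G e \<notin> V0" "head G e \<notin> V0"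
  shows "(\<phi> (tail G e) = \<phi> (head G e)) \<longleftrightarrow> \<psi> e = \<one>"
  using assms anti_no_loop[OF _ assms(1)] by (auto simp: lab_def split: if_splits)

text \<open>Along a walk the gains telescope to the comparison of the potentials at its ends; with
  two group elements, a gain is known once it is known whether it is the identity.\<close>

lemma potential_walk_gain:
  assumes A: "A \<subseteq> arcs G" "\<And>e. e \<in> A \<Longrightarrow> compat \<phi> (lab e)"
    and c: "pre_digraph.cas (both_directions (arc_subgraph A \<restriction> W)) u c v"
      "set c \<subseteq> arcs (both_directions (arc_subgraph A \<restriction> W))" "W \<inter> V0 = {}"
  shows "walk_gain \<Gamma> \<psi> c \<in> carrier \<Gamma> \<and> (walk_gain \<Gamma> \<psi> c = \<one> \<longleftrightarrow> \<phi> u = \<phi> v)"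
  using c(1,2)
proof (induction c arbitrary: u)
  case Nil
  then show ?case by (simp add: pre_digraph.cas.simps)
next
  case (Cons a c)
  let ?D = "both_directions (arc_subgraph A \<restriction> W)"
  obtain e b where a: "a = (e, b)" by (cases a)
  have e: "e \<in> A" "tail G e \<in> W" "head G e \<in> W"
    using Cons.prems(2) by (auto simp: a both_directions_def induce_subgraph_def)
  have ea: "e \<in> arcs G" using A e by blast
  have t: "tail ?D a = (if b then tail G e else head G e)" "head ?D a = (if b then head G e else tail G e)"
    by (simp_all add: a both_directions_def induce_subgraph_def)
  have cas: "tail ?D a = u" "pre_digraph.cas ?D (head ?D a) c v"
    using Cons.prems(1) by (simp_all add: pre_digraph.cas.simps)
  define g where "g = (if b then \<psi> e else inv (\<psi> e))"
  have g: "g = \<psi> e" "g \<in> carrier \<Gamma>" using gain_closed[OF ea] inv_self by (auto simp: g_def)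
  have "(\<phi> (tail G e) = \<phi> (head G e)) \<longleftrightarrow> \<psi> e = \<one>"
    using compat_link[OF ea A(2)[OF e(1)]] e c(3) by blast
  then have ge: "g = \<one> \<longleftrightarrow> \<phi> u = \<phi> (head ?D a)" using g t cas(1) by (cases b) auto
  have IH: "walk_gain \<Gamma> \<psi> c \<in> carrier \<Gamma>" "walk_gain \<Gamma> \<psi> c = \<one> \<longleftrightarrow> \<phi> (head ?D a) = \<phi> v"
    using Cons.IH[OF cas(2)] Cons.prems(2) by auto
  have "walk_gain \<Gamma> \<psi> (a # c) = g \<otimes> walk_gain \<Gamma> \<psi> c" by (simp add: a g_def)
  then show ?case using mult_one_iff[OF g(2) IH(1)] g(2) IH ge by auto
qed

text \<open>This implication suffices: sets with a potential need the bound with 3, and all others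
  only the weaker count.\<close>

lemma potential_imp_balanced:
  assumes A: "A \<subseteq> arcs G" "potential_balanced (lab ` A)"
  shows "balanced \<Gamma> V0 \<psi> (arc_subgraph A)"
proof -
  obtain \<phi> where phi: "\<And>e. e \<in> A \<Longrightarrow> compat \<phi> (lab e)" using A(2) by (auto simp: potential_balanced_def)
  show ?thesis
    unfolding balanced_def
  proof (intro allI impI, elim conjE)
    fix c
    assume "pre_digraph.cycle (both_directions (arc_subgraph A \<restriction> (verts (arc_subgraph A) - V0))) c"
    then obtain u where "pre_digraph.awalk (both_directions (arc_subgraph A \<restriction> (verts (arc_subgraph A) - V0))) u c u"
      by (auto simp: pre_digraph.cycle_def)
    then show "walk_gain \<Gamma> \<psi> c = \<one>"
      using potential_walk_gain[OF A(1) phi, of "verts (arc_subgraph A) - V0" u c u]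
      by (auto simp: pre_digraph.awalk_def)
  qed
qed

text \<open>Antisymmetrically the fixed vertex is the ground and both counts carry over.
  Symmetrically a set with a potential has no spokes and so avoids the fixed vertex; any set that
  meets it is held only to the count with 1.\<close>

lemma lab_sparse: "sparse (lab ` arcs G)"
  unfolding sparse_def
proof (intro conjI allI impI)
  show "finite (lab ` arcs G)" by simp
  fix F assume F: "F \<subseteq> lab ` arcs G" "F \<noteq> {}"
  define A where "A = {e \<in> arcs G. lab e \<in> F}"
  have A: "A \<subseteq> arcs G" "lab ` A = F" using F by (auto simp: A_def)
  then have Ane: "A \<noteq> {}" using F by blast
  have cA: "card F = card A" using A lab_inj by (metis card_image inj_on_subset)
  define W where "W = verts (arc_subgraph A)"
  have finW: "finite W" using A(1) finite_subset[OF _ finite_arcs] by (auto simp: W_def)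
  have span: "span_verts F = Some ` (W - V0) \<union> {x. x = None \<and> anti \<and> W \<inter> V0 \<noteq> {}}"
  proof (rule Set.set_eqI)
    fix x
    have ex: "x \<in> span_verts F \<longleftrightarrow> (\<exists>e\<in>A. x \<in> ends (lab e))" using A(2) by (auto simp: span_verts_def)
    show "x \<in> span_verts F \<longleftrightarrow> x \<in> Some ` (W - V0) \<union> {x. x = None \<and> anti \<and> W \<inter> V0 \<noteq> {}}"
    proof (cases x)
      case None
      have "x \<in> span_verts F \<longleftrightarrow> (\<exists>e\<in>A. anti \<and> (tail G e \<in> V0 \<or> head G e \<in> V0))"
        unfolding ex unfolding None using None_ends_lab A(1) by blast
      then show ?thesis using None by (auto simp: W_def)
    next
      case (Some w)
      have "x \<in> span_verts F \<longleftrightarrow> (\<exists>e\<in>A. (w = tail G e \<or> w = head G e) \<and> w \<notin> V0)"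
        unfolding ex unfolding Some using Some_ends_lab A(1) by blast
      then show ?thesis using Some by (auto simp: W_def)
    qed
  qed
  have cV: "card (W \<inter> V0) = (if W \<inter> V0 = {} then 0 else 1)"
  proof (cases "W \<inter> V0 = {}")
    case False
    then obtain v where "W \<inter> V0 = {v}" using V0_unique by blast
    then show ?thesis by simp
  qed simp
  have cS: "card (span_verts F) = card (W - V0) + (if anti then card (W \<inter> V0) else 0)"
    unfolding span using finW by (subst card_Un_disjoint) (auto simp: card_image cV)
  have cW: "card W = card (W - V0) + card (W \<inter> V0)"
  proof -
    have "W = (W - V0) \<union> (W \<inter> V0)" "(W - V0) \<inter> (W \<inter> V0) = {}" by blast+
    then show ?thesis using card_Un_disjoint[of "W - V0" "W \<inter> V0"] finW by simp
  qed
  have all: "int (card A) \<le> 2 * int (card (W - V0)) + 2 * int parity * int (card (W \<inter> V0)) - (1 + int parity)"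
    using sparse_count(1)[OF A(1) Ane] by (simp add: W_def)
  show "int (card F) \<le> bound F"
  proof (cases "potential_balanced F")
    case True
    then have "balanced \<Gamma> V0 \<psi> (arc_subgraph A)" using potential_imp_balanced A by blast
    then have "int (card A) \<le> 2 * int (card W) - 3" using sparse_count(2)[OF A(1) Ane] by (simp add: W_def)
    moreover have "W \<inter> V0 = {}" if "\<not> anti"
    proof (rule ccontr)
      assume "W \<inter> V0 \<noteq> {}"
      then obtain e where e: "e \<in> A" "tail G e \<in> V0 \<or> head G e \<in> V0" by (auto simp: W_def)
      then obtain w where "lab e = Spoke w" unfolding lab_def by metis
      then have "Spoke w \<in> F" using e A by (metis imageI)
      then show False using True that by (auto simp: potential_balanced_def)
    qed
    ultimately show ?thesis using True cS cW cA by (cases anti) (auto simp: bound_def)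
  next
    case False
    then have "bound F = 2 * int (card (span_verts F)) - (1 + int parity)" unfolding bound_def by (simp add: slack_eq)
    moreover have "parity = (if anti then 1 else 0)" using parity by (auto simp: anti_def)
    ultimately show ?thesis using all cS cA by (auto split: if_splits)
  qed
qed

end

text \<open>The functionals of \<open>I\<close> and \<open>K\<close> are jointly onto:
  \<open>M\<close> realises values on \<open>I\<close>, and \<open>T\<close> corrects those on
  \<open>K\<close> without disturbing \<open>I\<close>. There are as many functionals as
  coordinates, so they are jointly injective, and \<open>\<mu>\<close> minus its components along
  \<open>T\<close> vanishes on \<open>S\<close>.\<close>

lemma kernel_spanned_by_dual:
  fixes f :: "'i \<Rightarrow> ('v \<Rightarrow> complex^2) \<Rightarrow> complex" and T :: "'i \<Rightarrow> 'v \<Rightarrow> complex^2"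
  assumes fin: "finite I" "finite K" "finite S" "I \<inter> K = {}" "card I + card K = 2 * card S"
    and add: "\<And>i m m'. f i (\<lambda>v. m v + m' v) = f i m + f i m'"
    and scale: "\<And>i a m. f i (\<lambda>v. a *s m v) = a * f i m"
    and loc: "\<And>i m m'. i \<in> I \<union> K \<Longrightarrow> (\<And>v. v \<in> S \<Longrightarrow> m v = m' v) \<Longrightarrow> f i m = f i m'"
    and T: "\<And>i k. i \<in> I \<Longrightarrow> k \<in> K \<Longrightarrow> f i (T k) = 0"
      "\<And>k l. k \<in> K \<Longrightarrow> l \<in> K \<Longrightarrow> f k (T l) = (if k = l then 1 else 0)"
    and M: "\<And>i l. i \<in> I \<Longrightarrow> l \<in> I \<Longrightarrow> f i (M l) = (if i = l then 1 else 0)"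
    and zero: "\<And>i. i \<in> I \<Longrightarrow> f i \<mu> = 0" and v: "v \<in> S"
  shows "\<mu> v = (\<Sum>k\<in>K. f k \<mu> *s T k v)"
proof -
  have f0: "f i (\<lambda>v. 0) = 0" for i using scale[of i 0 "\<lambda>v. 0"] by simp
  have lin: "f i (\<lambda>v. \<Sum>k\<in>A. a k *s m k v) = (\<Sum>k\<in>A. a k * f i (m k))" for i A and a :: "'x \<Rightarrow> complex" and m
    by (induction A rule: infinite_finite_induct) (simp_all add: f0 add scale)
  define U :: "'v \<times> 2 \<Rightarrow> 'v \<Rightarrow> complex^2"
    where "U = (\<lambda>(v, k) u. if u = v then axis k 1 else 0)"
  let ?J = "S \<times> (UNIV :: 2 set)"
  have expand: "f i m = (\<Sum>x\<in>?J. f i (U x) * (m (fst x) $ snd x))" if i: "i \<in> I \<union> K" for i m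
  proof -
    have "f i m = f i (\<lambda>u. \<Sum>x\<in>?J. (m (fst x) $ snd x) *s U x u)"
    proof (rule loc[OF i])
      fix u assume u: "u \<in> S"
      have "(\<Sum>x\<in>?J. (m (fst x) $ snd x) *s U x u) = (\<Sum>v\<in>S. \<Sum>k\<in>UNIV. (m v $ k) *s U (v, k) u)"
        by (simp add: sum.cartesian_product case_prod_unfold)
      also have "\<dots> = (\<Sum>v\<in>S. if v = u then (\<Sum>k\<in>UNIV. (m v $ k) *s axis k 1) else 0)"
        by (intro sum.cong) (auto simp: U_def)
      also have "\<dots> = m u" using u fin(3) by (simp add: basis_expansion)
      finally show "m u = (\<Sum>x\<in>?J. (m (fst x) $ snd x) *s U x u)" by simp
    qed
    then show ?thesis by (simp add: lin mult.commute)
  qed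
  have dual: "(\<Sum>k\<in>K. a k * f i (T k)) = a i" if "i \<in> K" for a i
  proof -
    have "(\<Sum>k\<in>K. a k * f i (T k)) = (\<Sum>k\<in>K. if k = i then a k else 0)"
      using T(2)[OF that] by (intro sum.cong) auto
    then show ?thesis using that fin(2) by simp
  qed
  define \<nu> where "\<nu> = (\<lambda>v. \<mu> v + (- 1) *s (\<Sum>k\<in>K. f k \<mu> *s T k v))"
  have nu: "f i \<nu> = f i \<mu> - (\<Sum>k\<in>K. f k \<mu> * f i (T k))" for i
    unfolding \<nu>_def by (subst add, subst scale, subst lin) simp
  have "\<nu> (fst (v, k)) $ snd (v, k) = 0" for k
  proof (rule square_onto_imp_inj[of "I \<union> K" ?J "\<lambda>i x. f i (U x)" "\<lambda>x. \<nu> (fst x) $ snd x"])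
    show "finite (I \<union> K)" "finite ?J" using fin by auto
    show "card (I \<union> K) = card ?J" using fin by (simp add: card_Un_disjoint card_cartesian_product)
    show "(v, k) \<in> ?J" using v by simp
    show "(\<Sum>x\<in>?J. f i (U x) * (\<nu> (fst x) $ snd x)) = 0" if i: "i \<in> I \<union> K" for i
    proof -
      have "f i \<nu> = 0"
      proof (cases "i \<in> I")
        case True then show ?thesis using nu zero T(1) by simp
      next
        case False
        then have "i \<in> K" using i by blast
        then show ?thesis using nu dual by simp
      qed
      then show ?thesis using expand[OF i, of \<nu>] by simp
    qed
    fix w
    define m0 where "m0 = (\<lambda>v. \<Sum>l\<in>I. w l *s M l v)"
    define m1 where "m1 = (\<lambda>v. m0 v + (\<Sum>k\<in>K. (w k - f k m0) *s T k v))"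
    have m1: "f i m1 = f i m0 + (\<Sum>k\<in>K. (w k - f k m0) * f i (T k))" for i
      unfolding m1_def by (subst add, subst lin) (rule refl)
    have "f i m1 = w i" if i: "i \<in> I \<union> K" for i
    proof (cases "i \<in> I")
      case True
      then have "f i m1 = f i m0" using m1 T(1) by simp
      also have "\<dots> = (\<Sum>l\<in>I. w l * f i (M l))" unfolding m0_def lin ..
      also have "\<dots> = (\<Sum>l\<in>I. if l = i then w l else 0)" using M[OF True] by (intro sum.cong) auto
      also have "\<dots> = w i" using True fin(1) by simp
      finally show ?thesis .
    next
      case False
      then have "i \<in> K" using i by blast
      then show ?thesis using m1 dual[of i "\<lambda>k. w k - f k m0"] by simp
    qed
    then have "(\<Sum>x\<in>?J. f i (U x) * (m1 (fst x) $ snd x)) = w i" if "i \<in> I \<union> K" for i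
      using expand[OF that, of m1] that by simp
    then show "\<exists>c. \<forall>i\<in>I \<union> K. (\<Sum>x\<in>?J. f i (U x) * c x) = w i"
      by (intro exI[of _ "\<lambda>x. m1 (fst x) $ snd x"]) blast
  qed
  then have "\<nu> v = 0" by (simp add: cart_eq_iff)
  then show ?thesis by (simp add: \<nu>_def)
qed

context half_turn_problem
begin

section \<open>Lifting configurations and motions to the covering\<close>

definition lift_config :: "('v \<Rightarrow> nat \<Rightarrow> real^2) \<Rightarrow> ('g, 'v) cover_vertex \<Rightarrow> real^2" where
  "lift_config c u = (case u of Fixed v \<Rightarrow> 0 | Free g v \<Rightarrow> sg (g = \<one>) *\<^sub>R c v 0)"

definition lift_motion :: "('v \<Rightarrow> complex^2) \<Rightarrow> ('g, 'v) cover_vertex \<Rightarrow> complex^2" where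
  "lift_motion \<mu> u = (case u of Fixed v \<Rightarrow> 0
    | Free g v \<Rightarrow> if Free g v \<in> CV then of_real (chi (g = \<one>)) *s \<mu> v else 0)"

lemma chi_parity: "chi False = - ((- 1) ^ parity)" "chi True = 1"
  using parity by (auto simp: chi_def anti_def)

lemma Free_CV: "Free g v \<in> CV \<longleftrightarrow> g \<in> carrier \<Gamma> \<and> v \<in> verts G - V0"
  by (auto simp: cover_verts_def)

lemma lift_config_sym: "sym_pos (lift_config c)"
  unfolding sym_pos_def
proof
  fix u assume u: "u \<in> CV"
  show "lift_config c (act \<Gamma> \<gamma> u) = - lift_config c u"
  proof (cases u)
    case (Free g v)
    then have "g \<in> carrier \<Gamma>" using u Free_CV by blast
    then have "\<gamma> \<otimes> g = \<one> \<longleftrightarrow> g \<noteq> \<one>" using mult_one_iff[OF gamma] gamma_ne by blast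
    then show ?thesis by (simp add: Free lift_config_def sg_def)
  qed (simp add: lift_config_def)
qed

lemma lift_motion_SV: "lift_motion \<mu> \<in> SV parity"
  unfolding SV_iff
proof (intro conjI ballI)
  show "lift_motion \<mu> \<in> functions_on CV"
    by (auto simp: functions_on_def lift_motion_def split: cover_vertex.splits)
  fix u assume u: "u \<in> CV"
  show "lift_motion \<mu> (act \<Gamma> \<gamma> u) = - ((- 1) ^ parity) *s lift_motion \<mu> u"
  proof (cases u)
    case (Free g v)
    then have g: "g \<in> carrier \<Gamma>" using u Free_CV by blast
    then have e: "\<gamma> \<otimes> g = \<one> \<longleftrightarrow> g \<noteq> \<one>" using mult_one_iff[OF gamma] gamma_ne by blast
    have sq: "(- 1) ^ parity * (- 1) ^ parity = (1 :: complex)" by (simp flip: power_add)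
    have "Free (\<gamma> \<otimes> g) v \<in> CV" using u act_CV[OF gamma u] by (simp add: Free)
    then show ?thesis using u e sq
      by (cases "g = \<one>") (simp_all add: Free lift_motion_def chi_parity vector_smult_assoc)
  qed (simp add: lift_motion_def)
qed

lemma complex_edge_form:
  assumes "p u - p v = a *\<^sub>R x" "m u - m v = of_real b *s complex_vec y"
  shows "edge_form p m u v = of_real (a * b * (x \<bullet> y))"
  unfolding edge_form_def assms by (simp add: complex_vec_def inner_vec_def sum_2 algebra_simps)

text \<open>The factor is a sign except for loops, where position and velocity differences are both
  doubled and give 4.\<close>

lemma Rm_lift:
  assumes e: "e \<in> arcs G"
  shows "\<exists>\<kappa>. \<kappa> \<noteq> 0 \<and> (\<forall>c m. Rm (lift_config c) (lift_motion (\<lambda>v. complex_vec (m v))) (rep e)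
    = of_real (\<kappa> * row c m (lab e)))"
proof -
  define s where "s = (\<psi> e = \<one>)"
  have verts: "tail G e \<in> verts G" "head G e \<in> verts G" using e by auto
  have psi: "\<psi> e \<in> carrier \<Gamma>" by (rule gain_closed[OF e])
  have one: "\<one> \<in> carrier \<Gamma>" by simp
  have cfg: "lift_config c (lift_vertex V0 g v) = (if v \<in> V0 then 0 else sg (g = \<one>) *\<^sub>R c v 0)" for c g v
    by (simp add: lift_config_def lift_vertex_def)
  have mot: "lift_motion \<mu> (lift_vertex V0 g v) = (if v \<in> V0 then 0 else of_real (chi (g = \<one>)) *s \<mu> v)"
    if "g \<in> carrier \<Gamma>" "v \<in> verts G" for \<mu> g v
    using that Free_CV by (auto simp: lift_motion_def lift_vertex_def)
  let ?u = "lift_vertex V0 \<one> (tail G e)" and ?v = "lift_vertex V0 (\<psi> e) (head G e)"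
  have rm: "Rm p m (rep e) = edge_form p m ?u ?v" for p m
    using rep_CE[OF e] unfolding rep_def by (rule rigidity_map_edge)
  have cT: "chi True = 1" "sg True = 1" by (simp_all add: chi_parity)
  have cv: "complex_vec (x + y) = complex_vec x + complex_vec y" "complex_vec (r *\<^sub>R x) = of_real r *s complex_vec x"
    "complex_vec (x - y) = complex_vec x - complex_vec y" for x y r
    by (simp_all add: complex_vec_def cart_eq_iff)
  consider (fixed_head) "head G e \<in> V0" "tail G e \<notin> V0" | (fixed_tail) "tail G e \<in> V0" "head G e \<notin> V0"
    | (loop) "tail G e = head G e" "tail G e \<notin> V0" "head G e \<notin> V0"
    | (link) "tail G e \<noteq> head G e" "tail G e \<notin> V0" "head G e \<notin> V0"
    using not_both_fixed[OF e] by blast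
  then show ?thesis
  proof cases
    case fixed_head
    have "edge_form (lift_config c) (lift_motion (\<lambda>v. complex_vec (m v))) ?u ?v = of_real (1 * 1 * (c (tail G e) 0 \<bullet> m (tail G e)))" for c m
      by (rule complex_edge_form) (simp_all add: cfg mot one psi verts fixed_head cT)
    then show ?thesis using fixed_head by (intro exI[of _ 1]) (simp add: rm lab_def)
  next
    case fixed_tail
    have "edge_form (lift_config c) (lift_motion (\<lambda>v. complex_vec (m v))) ?u ?v
        = of_real ((- sg s) * (- chi s) * (c (head G e) 0 \<bullet> m (head G e)))" for c m
      by (rule complex_edge_form) (simp_all add: cfg mot one psi verts fixed_tail s_def)
    then show ?thesis using fixed_tail by (intro exI[of _ "sg s * chi s"]) (auto simp: rm lab_def)
  next
    case loop
    then have "\<not> anti" "\<psi> e \<noteq> \<one>" using anti_no_loop[OF _ e] gain_loop[OF e] by blast+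
    then have "chi (\<psi> e = \<one>) = - 1" by (simp add: chi_sym)
    have "edge_form (lift_config c) (lift_motion (\<lambda>v. complex_vec (m v))) ?u ?v = of_real (2 * 2 * (c (tail G e) 0 \<bullet> m (tail G e)))" for c m
      by (rule complex_edge_form)
        (use loop \<open>\<psi> e \<noteq> \<one>\<close> \<open>chi (\<psi> e = \<one>) = - 1\<close> in \<open>simp_all add: cfg mot one psi verts[unfolded loop(1)] cT
          cart_eq_iff\<close>)
    then show ?thesis using loop by (intro exI[of _ 4]) (simp add: rm lab_def)
  next
    case link
    have "edge_form (lift_config c) (lift_motion (\<lambda>v. complex_vec (m v))) ?u ?v
        = of_real (1 * 1 * ((c (tail G e) 0 - sg s *\<^sub>R c (head G e) 0) \<bullet> (m (tail G e) - chi s *\<^sub>R m (head G e))))" for c m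
      by (rule complex_edge_form) (simp_all add: cfg mot one psi verts link s_def cT cv)
    then show ?thesis using link by (intro exI[of _ 1]) (simp add: rm lab_def s_def)
  qed
qed

lemma dual_motions_somewhere:
  "\<exists>c m. (\<forall>a. m a \<in> SV parity) \<and>
    (\<forall>a\<in>arcs G. \<forall>e\<in>arcs G. Rm (lift_config c) (m a) (rep e) = (if e = a then 1 else 0))"
proof -
  obtain c where c: "onto c (lab ` arcs G)" using sparse_imp_onto[OF lab_sparse] proper_lab by blast
  obtain \<kappa> where k: "\<And>e. e \<in> arcs G \<Longrightarrow> \<kappa> e \<noteq> 0"
    "\<And>e m. e \<in> arcs G \<Longrightarrow> Rm (lift_config c) (lift_motion (\<lambda>v. complex_vec (m v))) (rep e) = of_real (\<kappa> e * row c m (lab e))"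
    using Rm_lift by metis
  have "\<exists>m. \<forall>e\<in>arcs G. row c m (lab e) = (if lab e = lab a then 1 / \<kappa> a else 0)" for a
    using c[unfolded onto_def, rule_format, of "\<lambda>l. if l = lab a then 1 / \<kappa> a else 0"] by auto
  then obtain m where m: "\<And>a e. e \<in> arcs G \<Longrightarrow> row c (m a) (lab e) = (if lab e = lab a then 1 / \<kappa> a else 0)" by metis
  have "Rm (lift_config c) (lift_motion (\<lambda>v. complex_vec (m a v))) (rep e) = (if e = a then 1 else 0)"
    if "a \<in> arcs G" "e \<in> arcs G" for a e
    using that k m lab_inj by (auto simp: inj_on_def)
  then show ?thesis using lift_motion_SV by (intro exI[of _ c] exI[of _ "\<lambda>a. lift_motion (\<lambda>v. complex_vec (m a v))"]) blast
qed


lemma lift_motion_add: "lift_motion (\<lambda>v. m v + m' v) = (\<lambda>u. lift_motion m u + lift_motion m' u)"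
  by (auto simp: lift_motion_def fun_eq_iff vector_add_ldistrib split: cover_vertex.splits)

lemma lift_motion_scale: "lift_motion (\<lambda>v. a *s m v) = (\<lambda>u. a *s lift_motion m u)"
  by (auto simp: lift_motion_def fun_eq_iff vector_smult_assoc mult.commute split: cover_vertex.splits)

lemma lift_motion_cong:
  assumes "\<And>v. v \<in> verts G - V0 \<Longrightarrow> m v = m' v" shows "lift_motion m = lift_motion m'"
  using assms Free_CV by (auto simp: lift_motion_def fun_eq_iff split: cover_vertex.splits)

lemma Rm_scale: "Rm p (\<lambda>u. a *s m u) f = a * Rm p m f"
  using Rm_linear[of p "\<lambda>_. a" "\<lambda>_. m" "{0 :: nat}" f] by simp

lemma Rm_translate:
  assumes "\<And>u. u \<in> CV \<Longrightarrow> m u = m' u + t" shows "Rm p m f = Rm p m' f"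
proof (cases "f \<in> CE")
  case True
  then obtain u v where "f = {u, v}" "u \<in> CV" "v \<in> CV" using CE_cases by metis
  then show ?thesis using True assms by (simp add: rigidity_map_edge edge_form_def)
qed (simp add: Rm_outside)

lemma CV_cases:
  assumes "u \<in> CV"
  obtains (Fixed) v where "u = Fixed v" "v \<in> V0"
    | (one) v where "u = Free \<one> v" "v \<in> verts G - V0"
    | (turned) v where "u = Free \<gamma> v" "v \<in> verts G - V0"
  using assms carrier_eq by (auto simp: cover_verts_def)

text \<open>Lifted motions vanish at the fixed vertex. A symmetric motion does so anyway; from an
  antisymmetric one the velocity \<open>t\<close> of the fixed vertex is subtracted, since
  translations are antisymmetric.\<close>

lemma SV_decompose:
  assumes m: "m \<in> SV parity"
  obtains \<mu> t where "\<not> anti \<Longrightarrow> t = 0" "\<And>u. u \<in> CV \<Longrightarrow> m u = lift_motion \<mu> u + t"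
proof -
  define t where "t = (if anti \<and> V0 \<noteq> {} then m (Fixed (SOME v. v \<in> V0)) else 0)"
  define \<mu> where "\<mu> v = m (Free \<one> v) - t" for v
  have sym: "m (act \<Gamma> \<gamma> u) = - ((- 1) ^ parity) *s m u" if "u \<in> CV" for u using m that unfolding SV_iff by blast
  have "m u = lift_motion \<mu> u + t" if u: "u \<in> CV" for u
    using u
  proof (cases rule: CV_cases)
    case (Fixed v)
    have "(SOME v. v \<in> V0) = v" using V0_unique Fixed(2) by (metis someI)
    moreover have "m u = 0" if "\<not> anti"
    proof -
      have "parity = 0" using that parity by (simp add: anti_def)
      then have "m u = - m u" using sym[OF u] by (simp add: Fixed cart_eq_iff)
      then show ?thesis by (simp add: cart_eq_iff)
    qed
    ultimately show ?thesis using Fixed by (auto simp: t_def lift_motion_def)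
  next
    case (one v)
    then show ?thesis using u by (simp add: lift_motion_def chi_parity \<mu>_def)
  next
    case (turned v)
    have one: "Free \<one> v \<in> CV" using turned Free_CV by simp
    have "m u = chi False *s (\<mu> v + t)"
      using sym[OF one] turned gamma by (simp add: chi_parity \<mu>_def)
    moreover have "of_real (chi False) *s t = t"
      by (cases anti) (simp_all add: t_def chi_anti)
    ultimately show ?thesis using u turned gamma_ne by (simp add: lift_motion_def vector_add_ldistrib)
  qed
  moreover have "\<not> anti \<Longrightarrow> t = 0" by (simp add: t_def)
  ultimately show ?thesis using that by blast
qed

text \<open>The functionals \<open>lf\<close> are coordinates on the span of the known motions
  \<open>T\<close>; with the orbit rows they are as many as the free velocity coordinates. The
  motions \<open>n a\<close> are lifts only up to translations, which the rigidity map does not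
  see.\<close>

lemma kernel_motions:
  fixes lf :: "nat \<Rightarrow> ('v \<Rightarrow> complex^2) \<Rightarrow> complex"
  assumes K: "finite K" "card (arcs G) + card K = 2 * card (verts G - V0)"
    and add: "\<And>i m m'. lf i (\<lambda>v. m v + m' v) = lf i m + lf i m'"
    and scale: "\<And>i a m. lf i (\<lambda>v. a *s m v) = a * lf i m"
    and loc: "\<And>i m m'. i \<in> K \<Longrightarrow> (\<And>v. v \<in> verts G - V0 \<Longrightarrow> m v = m' v) \<Longrightarrow> lf i m = lf i m'"
    and T: "\<And>k f. k \<in> K \<Longrightarrow> Rm p (lift_motion (T k)) f = 0"
      "\<And>k l. k \<in> K \<Longrightarrow> l \<in> K \<Longrightarrow> lf k (T l) = (if k = l then 1 else 0)"
    and n: "\<And>a. a \<in> arcs G \<Longrightarrow> n a \<in> SV parity"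
      "\<And>a e. a \<in> arcs G \<Longrightarrow> e \<in> arcs G \<Longrightarrow> Rm p (n a) (rep e) = (if e = a then 1 else 0)"
    and m: "m \<in> SV parity" "\<And>f. Rm p m f = 0"
  shows "\<exists>b t. (\<not> anti \<longrightarrow> t = 0) \<and>
    (\<forall>u\<in>CV. m u = lift_motion (\<lambda>v. \<Sum>k\<in>K. b k *s T k v) u + t)"
proof -
  obtain \<mu> t where t: "\<not> anti \<Longrightarrow> t = 0" and mu: "\<And>u. u \<in> CV \<Longrightarrow> m u = lift_motion \<mu> u + t"
    using SV_decompose[OF m(1)] by blast
  have "\<exists>\<nu> s. \<forall>u\<in>CV. n a u = lift_motion \<nu> u + s" if "a \<in> arcs G" for a
    using SV_decompose[OF n(1)[OF that]] by metis
  then obtain \<nu> s where nu: "\<And>a u. a \<in> arcs G \<Longrightarrow> u \<in> CV \<Longrightarrow> n a u = lift_motion (\<nu> a) u + s a" by metis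
  define f where "f = case_sum (\<lambda>a \<mu>. Rm p (lift_motion \<mu>) (rep a)) lf"
  have span: "\<mu> v = (\<Sum>k\<in>Inr ` K. f k \<mu> *s (T \<circ> projr) k v)" if v: "v \<in> verts G - V0" for v
  proof (rule kernel_spanned_by_dual[where I = "Inl ` arcs G" and S = "verts G - V0" and M = "\<nu> \<circ> projl" and f = f])
    show "card (Inl ` arcs G) + card (Inr ` K) = 2 * card (verts G - V0)" using K by (simp add: card_image)
    show "f i (\<lambda>v. m v + m' v) = f i m + f i m'" for i m m'
      by (cases i) (simp_all add: f_def lift_motion_add Rm_add add)
    show "f i (\<lambda>v. a *s m v) = a * f i m" for i a m
      by (cases i) (simp_all add: f_def lift_motion_scale Rm_scale scale)
    show "f i m = f i m'" if "i \<in> Inl ` arcs G \<union> Inr ` K" "\<And>v. v \<in> verts G - V0 \<Longrightarrow> m v = m' v" for i m m'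
      using that(1) lift_motion_cong[of m m'] that(2) loc[of _ m m'] by (auto simp: f_def)
    show "f i ((\<nu> \<circ> projl) l) = (if i = l then 1 else 0)" if il: "i \<in> Inl ` arcs G" "l \<in> Inl ` arcs G" for i l
    proof -
      obtain e a where ea: "i = Inl e" "l = Inl a" "e \<in> arcs G" "a \<in> arcs G" using il by blast
      have "Rm p (lift_motion (\<nu> a)) (rep e) = Rm p (n a) (rep e)"
        using Rm_translate[of "n a" "lift_motion (\<nu> a)" "s a"] nu ea(4) by simp
      then show ?thesis using n(2)[OF ea(4,3)] ea by (simp add: f_def)
    qed
    show "f i \<mu> = 0" if "i \<in> Inl ` arcs G" for i
      using that Rm_translate[OF mu] m(2) by (auto simp: f_def)
    show "f i ((T \<circ> projr) k) = 0" if "i \<in> Inl ` arcs G" "k \<in> Inr ` K" for i k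
      using that T(1) by (auto simp: f_def)
    show "f k ((T \<circ> projr) l) = (if k = l then 1 else 0)" if kl: "k \<in> Inr ` K" "l \<in> Inr ` K" for k l
    proof -
      obtain k' l' where "k = Inr k'" "l = Inr l'" "k' \<in> K" "l' \<in> K" using kl by blast
      then show ?thesis using T(2)[of k' l'] by (simp add: f_def)
    qed
    show "v \<in> verts G - V0" by (fact v)
    show "finite (Inr ` K)" using K(1) by (rule finite_imageI)
  qed auto
  have "\<mu> v = (\<Sum>k\<in>K. lf k \<mu> *s T k v)" if v: "v \<in> verts G - V0" for v
  proof -
    have "(\<Sum>k\<in>Inr ` K. f k \<mu> *s (T \<circ> projr) k v) = (\<Sum>k\<in>K. lf k \<mu> *s T k v)"
      by (simp add: sum.reindex f_def)
    with span[OF v] show ?thesis by (rule trans)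
  qed
  then have eq: "lift_motion \<mu> = lift_motion (\<lambda>v. \<Sum>k\<in>K. lf k \<mu> *s T k v)" by (rule lift_motion_cong)
  have "m u = lift_motion (\<lambda>v. \<Sum>k\<in>K. lf k \<mu> *s T k v) u + t" if "u \<in> CV" for u
    unfolding eq[symmetric] by (rule mu[OF that])
  then show ?thesis using t by (intro exI[of _ "\<lambda>k. lf k \<mu>"] exI[of _ t]) blast
qed

section \<open>The given generic framework\<close>

context
  fixes p :: "'v \<Rightarrow> real^2"
  assumes framework: "covering_framework \<Gamma> G V0 \<tau> p" and generic: "C2_generic \<Gamma> G V0 \<psi> \<tau> p"
begin

abbreviation (input) "P \<equiv> cover_pos \<tau> p"

lemma P_apply: "v \<in> V0 \<Longrightarrow> P (Fixed v) = 0" "g \<in> carrier \<Gamma> \<Longrightarrow> P (Free g v) = sg (g = \<one>) *\<^sub>R p v"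
  using framework tau_apply by (simp_all add: covering_framework_def)

lemma P_sym: "sym_pos P"
  unfolding sym_pos_def
proof
  fix u assume u: "u \<in> CV"
  then show "P (act \<Gamma> \<gamma> u) = - P u"
  proof (cases rule: CV_cases)
    case (Fixed v) then show ?thesis using P_apply(1) by simp
  next
    case (one v) then show ?thesis using gamma gamma_ne by (simp add: P_apply(2) del: cover_pos.simps)
  next
    case (turned v) then show ?thesis
      using turned gamma gamma_ne gamma_sq by (simp add: P_apply(2) del: cover_pos.simps)
  qed
qed

lemma dual_motions:
  "\<exists>n. (\<forall>a\<in>arcs G. n a \<in> SV parity) \<and>
    (\<forall>a\<in>arcs G. \<forall>e\<in>arcs G. Rm P (n a) (rep e) = (if e = a then 1 else 0))"
proof -
  obtain c m where m: "\<And>a. m a \<in> SV parity"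
    "\<And>a e. a \<in> arcs G \<Longrightarrow> e \<in> arcs G \<Longrightarrow> Rm (lift_config c) (m a) (rep e) = (if e = a then 1 else 0)"
    using dual_motions_somewhere by metis
  show ?thesis
  proof (rule generic_onto[where i = "1 - parity" and q = "lift_config c" and m = m])
    show "(- 1) ^ (1 - parity) = - ((- 1) ^ parity :: complex)" "{1 - parity, parity} = {0, 1}"
      using parity by auto
    show "rigidity_rank CV CE q \<le> rigidity_rank CV CE P" if "sym_pos q" for q
      using generic that unfolding C2_generic_def sym_pos_iff by blast
  qed (use P_sym lift_config_sym m in auto)
qed

lemma onto_SW:
  assumes w: "w \<in> SW parity" shows "\<exists>m\<in>SV parity. Rm P m = w"
proof -
  obtain n where n: "\<And>a. a \<in> arcs G \<Longrightarrow> n a \<in> SV parity"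
    "\<And>a e. a \<in> arcs G \<Longrightarrow> e \<in> arcs G \<Longrightarrow> Rm P (n a) (rep e) = (if e = a then 1 else 0)"
    using dual_motions by metis
  define m where "m = (\<lambda>u. \<Sum>a\<in>arcs G. w (rep a) *s n a u)"
  have m: "m \<in> SV parity" unfolding m_def using n(1) by (rule SV_sum)
  \<comment> \<open>The difference \<open>Rm P m - w\<close>, written as a sum over two indices so
    that \<open>SW_sum\<close> shows it to be symmetric.\<close>
  define d where "d = (\<lambda>f. \<Sum>k\<in>{True, False}. (if k then 1 else - 1) * (if k then Rm P m f else w f))"
  have d: "d f = Rm P m f - w f" for f by (simp add: d_def)
  have "d \<in> SW parity" unfolding d_def by (rule SW_sum[where w = "\<lambda>k. if k then Rm P m else w", simplified if_distribR])
      (use Rm_SW[OF P_sym m] w in auto)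
  moreover have "d (rep e) = 0" if e: "e \<in> arcs G" for e
  proof -
    have "Rm P m (rep e) = (\<Sum>a\<in>arcs G. w (rep a) * (if e = a then 1 else 0))"
      unfolding m_def Rm_linear using e by (simp add: n(2))
    also have "\<dots> = w (rep e)" using e by (simp add: if_distrib cong: if_cong)
    finally show ?thesis by (simp add: d)
  qed
  ultimately have "d f = 0" for f by (rule SW_zero)
  then have "Rm P m = w" using d by (simp add: fun_eq_iff)
  then show ?thesis using m by blast
qed

lemma tight_card: "int (card (arcs G)) = 2 * int (card (verts G - V0)) + 2 * int parity * int (card V0) - (1 + int parity)"
proof -
  have "verts G \<inter> V0 = V0" using fixed_verts by blast
  then show ?thesis using tight unfolding gain_tight_def by simp
qed

lemma rotation_motion:
  fixes r defines "r \<equiv> \<lambda>x :: real^2. vector [- (x $ 2), x $ 1] :: real^2"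
  assumes "\<not> anti" "u \<in> CV"
  shows "lift_motion (\<lambda>v. complex_vec (r (p v))) u = complex_vec (r (P u))"
  using assms(3)
proof (cases rule: CV_cases)
  case (Fixed v)
  then show ?thesis using P_apply(1)[of v]
    by (simp add: lift_motion_def r_def complex_vec_def cart_eq_iff forall_2)
next
  case (one v)
  then show ?thesis using assms(3) P_apply(2)[of \<one> v]
    by (simp add: lift_motion_def chi_sym[OF assms(2)])
next
  case (turned v)
  then show ?thesis using assms(3) P_apply(2)[of \<gamma> v] turned gamma gamma_ne
    by (simp add: lift_motion_def chi_sym[OF assms(2)] r_def complex_vec_def cart_eq_iff forall_2)
qed

text \<open>Rotations about the origin are symmetric, translations antisymmetric. Tightness leaves
  one dimension for the rotation or two for the translations; with a fixed vertex the antisymmetric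
  count leaves none, its velocity having been split off as a translation.\<close>

lemma kernel_trivial:
  assumes m: "m \<in> SV parity" and z: "\<And>f. Rm P m f = 0"
  shows "trivial_motion CV P m"
proof -
  obtain n where n: "\<And>a. a \<in> arcs G \<Longrightarrow> n a \<in> SV parity"
    "\<And>a e. a \<in> arcs G \<Longrightarrow> e \<in> arcs G \<Longrightarrow> Rm P (n a) (rep e) = (if e = a then 1 else 0)"
    using dual_motions by metis
  have hull: "affine hull (P ` CV) = UNIV" using framework by (simp add: covering_framework_def)
  consider (sym) "\<not> anti" "parity = 0" | (pinned) "anti" "parity = 1" "V0 \<noteq> {}" | (free) "anti" "parity = 1" "V0 = {}"
    using parity anti_def by blast
  then show ?thesis
  proof cases
    case sym
    define r where "r = (\<lambda>x :: real^2. vector [- (x $ 2), x $ 1] :: real^2)"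
    have rot: "lift_motion (\<lambda>v. complex_vec (r (p v))) u = complex_vec (r (P u))" if "u \<in> CV" for u
      unfolding r_def by (rule rotation_motion[OF sym(1) that])
    \<comment> \<open>The rotation has to be detected at a vertex that it moves; one exists because
      the points affinely span the plane.\<close>
    have "\<exists>x\<in>verts G - V0. p x \<noteq> 0"
    proof (rule ccontr)
      assume "\<not> ?thesis"
      then have p0: "p v = 0" if "v \<in> verts G - V0" for v using that by blast
      have "P u = 0" if "u \<in> CV" for u
        using that by (cases rule: CV_cases) (use p0 P_apply gamma in auto)
      then have "P ` CV \<subseteq> {0}" by blast
      then have "affine hull (P ` CV) \<subseteq> {0}" using hull_mono[of "P ` CV" "{0}" affine] by simp
      then have "(axis 1 1 :: real^2) = 0" using hull by blast
      then show False by simp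
    qed
    then obtain x where x: "x \<in> verts G - V0" "p x \<noteq> 0" by blast
    \<comment> \<open>The component of the velocity of \<open>x\<close> along the rotation field,
      normalised to be 1 on the rotation.\<close>
    define lf where "lf = (\<lambda>(_ :: nat) (\<mu> :: 'v \<Rightarrow> complex^2).
      (\<Sum>i\<in>UNIV. complex_vec (r (p x)) $ i * \<mu> x $ i) / of_real (p x \<bullet> p x))"
    have px: "complex_of_real (p x \<bullet> p x) \<noteq> 0" using x by simp
    have "\<exists>b t. (\<not> anti \<longrightarrow> t = 0) \<and>
      (\<forall>u\<in>CV. m u = lift_motion (\<lambda>v. \<Sum>k\<in>{0 :: nat}. b k *s complex_vec (r (p v))) u + t)"
    proof (rule kernel_motions[where K = "{0}" and lf = lf and p = P and n = n and m = m and T = "\<lambda>_ v. complex_vec (r (p v))"])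
      show "card (arcs G) + card {0 :: nat} = 2 * card (verts G - V0)" using tight_card sym by simp
      show "lf i (\<lambda>v. m v + m' v) = lf i m + lf i m'" for i m m'
        by (simp add: lf_def sum_2 add_divide_distrib algebra_simps)
      show "lf i (\<lambda>v. a *s m v) = a * lf i m" for i a m
        by (simp add: lf_def sum_2 add_divide_distrib algebra_simps)
      show "lf i m = lf i m'" if "\<And>v. v \<in> verts G - V0 \<Longrightarrow> m v = m' v" for i m m'
        using that[OF x(1)] by (simp add: lf_def)
      show "lf k (\<lambda>v. complex_vec (r (p v))) = (if k = l then 1 else 0)" if "k \<in> {0}" "l \<in> {0}" for k l
        using that px by (simp add: lf_def r_def complex_vec_def inner_vec_def sum_2 add.commute)
      show "Rm P (lift_motion (\<lambda>v. complex_vec (r (p v)))) f = 0" for f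
      proof (cases "f \<in> CE")
        case True
        then obtain u v where uv: "f = {u, v}" "u \<in> CV" "v \<in> CV" using CE_cases by metis
        have "edge_form P (lift_motion (\<lambda>v. complex_vec (r (p v)))) u v = 0"
          unfolding edge_form_def using rot[OF uv(2)] rot[OF uv(3)]
          by (simp add: sum_2 r_def complex_vec_def algebra_simps)
        then show ?thesis using True uv by (simp add: rigidity_map_edge)
      qed (simp add: Rm_outside)
    qed (use n m z in auto)
    then obtain b t where t: "\<not> anti \<Longrightarrow> t = 0"
      and bt: "\<And>u. u \<in> CV \<Longrightarrow> m u = lift_motion (\<lambda>v. \<Sum>k\<in>{0 :: nat}. b k *s complex_vec (r (p v))) u + t"
      by blast
    define M :: "complex^2^2" where "M = vector [vector [0, - b 0], vector [b 0, 0]]"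
    have "m u = M *v complex_vec (P u) + 0" if "u \<in> CV" for u
      using bt[OF that] t[OF sym(1)] rot[OF that]
      by (simp add: lift_motion_scale M_def r_def complex_vec_def matrix_vector_mult_def sum_2
          cart_eq_iff forall_2)
    moreover have "Finite_Cartesian_Product.transpose M = - M"
      by (simp add: M_def Finite_Cartesian_Product.transpose_def cart_eq_iff forall_2)
    ultimately show ?thesis unfolding trivial_motion_def by blast
  next
    case pinned
    then have "card V0 = 1" using V0_card finite_V0 by (simp add: le_Suc_eq)
    then have c: "card (arcs G) + card {} = 2 * card (verts G - V0)" using tight_card pinned by simp
    have "\<exists>b t. (\<not> anti \<longrightarrow> t = 0) \<and> (\<forall>u\<in>CV. m u = lift_motion (\<lambda>v. \<Sum>k\<in>({} :: nat set). b k *s (0 :: complex^2)) u + t)"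
      by (rule kernel_motions[where K = "{}" and lf = "\<lambda>_ _. 0" and p = P and n = n and m = m and T = "\<lambda>_ _. 0"])
        (use c n m z in auto)
    then obtain b t where bt: "\<And>u. u \<in> CV \<Longrightarrow> m u = lift_motion (\<lambda>v. \<Sum>k\<in>({} :: nat set). b k *s (0 :: complex^2)) u + t"
      by blast
    have "m u = 0 *v complex_vec (P u) + t" if "u \<in> CV" for u
      using bt[OF that] by (simp add: lift_motion_def split: cover_vertex.splits)
    moreover have "Finite_Cartesian_Product.transpose (0 :: complex^2^2) = - 0"
      by (simp add: Finite_Cartesian_Product.transpose_def cart_eq_iff)
    ultimately show ?thesis unfolding trivial_motion_def by blast
  next
    case free
    have "verts G - V0 \<noteq> {}"
    proof
      assume "verts G - V0 = {}"
      then have "CV = {}" using free by (auto simp: cover_verts_def)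
      then show False using hull by simp
    qed
    then obtain x where x: "x \<in> verts G - V0" by blast
    define d where "d k = (if k = 0 then 1 else 2 :: 2)" for k :: nat
    have const: "lift_motion (\<lambda>v. s) u = s" if "u \<in> CV" for u s
      using that
    proof (cases rule: CV_cases)
      case (Fixed v)
      then show ?thesis using free(3) by blast
    qed (use that free(1) in \<open>auto simp: lift_motion_def chi_anti\<close>)
    have "\<exists>b t. (\<not> anti \<longrightarrow> t = 0) \<and>
      (\<forall>u\<in>CV. m u = lift_motion (\<lambda>v. \<Sum>k\<in>{0 :: nat, 1}. b k *s (axis (d k) 1)) u + t)"
    proof (rule kernel_motions[where K = "{0, 1}" and lf = "\<lambda>k \<mu>. \<mu> x $ d k" and p = P and n = n and m = m
          and T = "\<lambda>k v. axis (d k) 1"])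
      show "card (arcs G) + card {0 :: nat, 1} = 2 * card (verts G - V0)" using tight_card free by simp
      show "Rm P (lift_motion (\<lambda>v. axis (d k) 1)) f = 0" for k f
      proof -
        have "Rm P (lift_motion (\<lambda>v. axis (d k) 1)) f = Rm P (\<lambda>u. 0) f"
          by (rule Rm_translate[where t = "axis (d k) 1"]) (simp add: const)
        then show ?thesis using Rm_scale[of P 0 "\<lambda>u. 0" f] by simp
      qed
      show "(axis (d l) 1 :: complex^2) $ d k = (if k = l then 1 else 0)" if "k \<in> {0, 1}" "l \<in> {0, 1}" for k l
        using that by (auto simp: d_def axis_def)
    qed (use n m z x in auto)
    then obtain b t where bt: "\<And>u. u \<in> CV \<Longrightarrow> m u = lift_motion (\<lambda>v. \<Sum>k\<in>{0 :: nat, 1}. b k *s (axis (d k) 1)) u + t"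
      by blast
    have "m u = 0 *v complex_vec (P u) + ((\<Sum>k\<in>{0 :: nat, 1}. b k *s axis (d k) 1) + t)" if "u \<in> CV" for u
      using bt[OF that] const[OF that] by simp
    moreover have "Finite_Cartesian_Product.transpose (0 :: complex^2^2) = - 0"
      by (simp add: Finite_Cartesian_Product.transpose_def cart_eq_iff)
    ultimately show ?thesis unfolding trivial_motion_def by blast
  qed
qed

theorem isostatic: "sym_isostatic \<Gamma> G V0 \<psi> \<tau> p (rho \<gamma> parity)"
  unfolding sym_isostatic_def
proof (intro conjI ballI impI allI)
  fix m assume "m \<in> SV parity" "infinitesimal_motion CV CE P m"
  then show "trivial_motion CV P m" by (intro kernel_trivial) (auto simp: infinitesimal_motion_def fun_eq_iff)
next
  fix B C y c
  assume BC: "motion_basis B (SV parity) \<and> edge_function_basis C (SW parity)"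
    and y: "\<forall>b\<in>B. (\<Sum>c\<in>C. y c * block_entry CE P C c b) = 0" and c: "c \<in> C"
  have C': "finite C" "\<not> cfun.dependent C" "cfun.span C = SW parity" using BC unfolding edge_function_basis_def by auto
  have B': "finite B" "\<not> vfun.dependent B" "vfun.span B = SV parity" using BC unfolding motion_basis_def by auto
  \<comment> \<open>A row dependence \<open>y\<close> is a functional on \<open>SW parity\<close>
    that vanishes on all images. Since the block is onto, it vanishes on \<open>c\<close> too, where
    its value is \<open>y c\<close>.\<close>
  have "c \<in> SW parity" using c C'(3) cfun.span_base by blast
  then obtain m where m: "m \<in> SV parity" "Rm P m = c" using onto_SW by blast
  define u where "u = vfun.representation B m"
  have "m = (\<Sum>b\<in>B. scale_vfun (u b) b)"
    unfolding u_def using vfun.sum_representation_eq[OF B'(2) _ B'(1)] B'(3) m(1) by auto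
  then have "m = (\<lambda>v. \<Sum>b\<in>B. u b *s b v)" by (simp add: fun_eq_iff sum_fun_apply scale_vfun_def)
  then have "c f = (\<Sum>b\<in>B. u b * Rm P b f)" for f
    using Rm_linear[of P u "\<lambda>b. b" B f] m(2) by metis
  then have cm: "c = (\<Sum>b\<in>B. scale_fun (u b) (Rm P b))"
    by (simp add: fun_eq_iff sum_fun_apply scale_fun_def)
  have inC: "Rm P b \<in> cfun.span C" if "b \<in> B" for b
    using that Rm_SW[OF P_sym] B'(3) C'(3) vfun.span_base by blast
  have "cfun.representation C c d = (\<Sum>b\<in>B. u b * cfun.representation C (Rm P b) d)" for d
    unfolding cm using C'(2) inC
    by (simp add: cfun.representation_sum cfun.representation_scale cfun.span_scale)
  then have "(\<Sum>d\<in>C. y d * cfun.representation C c d) = (\<Sum>d\<in>C. \<Sum>b\<in>B. u b * (y d * block_entry CE P C d b))"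
    by (simp add: block_entry_def sum_distrib_left mult.left_commute)
  also have "\<dots> = (\<Sum>b\<in>B. u b * (\<Sum>d\<in>C. y d * block_entry CE P C d b))"
    by (subst sum.swap) (simp add: sum_distrib_left)
  also have "\<dots> = 0" using y by simp
  finally show "y c = 0"
    using C'(1) c by (simp add: cfun.representation_basis[OF C'(2) c] if_distrib cong: if_cong)
qed

end

end

theorem theorem7p10:
  fixes \<Gamma> :: "('g, 'm) monoid_scheme" and \<gamma> :: 'g
    and G :: "('v, 'e) pre_digraph" and V0 :: "'v set" and \<psi> :: "'e \<Rightarrow> 'g"
    and \<tau> :: "'g \<Rightarrow> real^2^2" and p :: "'v \<Rightarrow> real^2"
  assumes "group \<Gamma>" and "order \<Gamma> = 2"
    and "\<gamma> \<in> carrier \<Gamma>" and "generate \<Gamma> {\<gamma>} = carrier \<Gamma>"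
    and "gain_graph \<Gamma> G V0 \<psi>" and "Digraph_Component.connected G" and "card V0 \<le> 1"
    and "\<tau> \<in> hom \<Gamma> C2_group" and "inj_on \<tau> (carrier \<Gamma>)"
    and "covering_framework \<Gamma> G V0 \<tau> p" and "C2_generic \<Gamma> G V0 \<psi> \<tau> p"
  shows "(gain_tight \<Gamma> G V0 \<psi> 0 1 \<longrightarrow> sym_isostatic \<Gamma> G V0 \<psi> \<tau> p (rho \<gamma> 0)) \<and>
         (gain_tight \<Gamma> G V0 \<psi> 2 2 \<longrightarrow> sym_isostatic \<Gamma> G V0 \<psi> \<tau> p (rho \<gamma> 1))"
proof -
  have cover: "half_turn_cover \<Gamma> G V0 \<psi> \<gamma> \<tau>"
    by (intro half_turn_cover.intro half_turn_cover_axioms.intro) fact+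
  show ?thesis
  proof (intro conjI impI)
    assume "gain_tight \<Gamma> G V0 \<psi> 0 1"
    then have "half_turn_problem \<Gamma> G V0 \<psi> \<gamma> \<tau> 0"
      using assms(7) by (intro half_turn_problem.intro half_turn_problem_axioms.intro cover) simp_all
    then show "sym_isostatic \<Gamma> G V0 \<psi> \<tau> p (rho \<gamma> 0)"
      using assms(10,11) by (rule half_turn_problem.isostatic)
  next
    assume "gain_tight \<Gamma> G V0 \<psi> 2 2"
    then have "half_turn_problem \<Gamma> G V0 \<psi> \<gamma> \<tau> 1"
      using assms(7) by (intro half_turn_problem.intro half_turn_problem_axioms.intro cover) simp_all
    then show "sym_isostatic \<Gamma> G V0 \<psi> \<tau> p (rho \<gamma> 1)"
      using assms(10,11) by (rule half_turn_problem.isostatic)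
  qed
qed

end
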